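(* A polynomial-time $c$-approximation algorithm for the hypergraph matching problem in general hypergraphs yields a polynomial-time $O((c\log^*(n))^2)$-approximation algorithm for the Santa Claus problem with arbitrary linear utility functions.
   Context: Santa Claus problem with linear utilities: players $P$, resources $R$, and nonnegative values $v_{ij}$ for $i\in P$, $j\in R$; player $i$'s utility for a set $S$ is $\sum_{j\in S}v_{ij}$ (no relation between different players' values). The goal is to partition $R$ into sets $S_i$, $i\in P$, maximizing $\min_i\sum_{j\in S_i}v_{ij}$; a $\beta$-approximation outputs a solution of value at least $\mathrm{OPT}/\beta$. Here $n$ denotes the size (number of players/resources) of the Santa Claus instance. Hypergraph matching problem in general hypergraphs: given a hypergraph $\mathcal{H}=(P\cup R,\mathcal{C})$ in which every hyperedge contains exactly one vertex of $P$ (no regularity or size assumptions), an $\alpha$-relaxed perfect matching selects for every $i\in P$ a hyperedge $C\ni i$ and assigns to $i$ at least $|C\cap R|/\alpha$ of the resources in $C$, with no resource assigned to more than one vertex of $P$. The problem is to find the minimum $\alpha^*$ such that an $\alpha^*$-relaxed perfect matching exists and output such a matching; a $c$-approximation outputs a $(c\alpha^* )$-relaxed perfect matching. *)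

theory Defs
  imports Complex_Main "HOL-Library.FuncSet" "HOL-Library.Disjoint_Sets"
begin

section \<open>Polynomial-time computation\<close>

text \<open>
  The machine model is the imperative language of while programs over binary trees. Every
  expression is charged the full size of all trees it touches, so values are paid for as if they
  were copied, and the trees stored by a program grow by no more than the elapsed time.
  Hence the model and multi-tape Turing machines simulate each other with polynomial overhead.
\<close>

datatype data = Leaf | Node data data

fun dsize :: "data \<Rightarrow> nat" where
  "dsize Leaf = 1"
| "dsize (Node a b) = dsize a + dsize b + 1"

fun left :: "data \<Rightarrow> data" where
  "left Leaf = Leaf"
| "left (Node a b) = a"

fun right :: "data \<Rightarrow> data" where
  "right Leaf = Leaf"
| "right (Node a b) = b"

type_synonym store = "nat \<Rightarrow> data"

datatype expr = Var nat | LeafE | NodeE expr expr | LeftE expr | RightE expr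

fun eval_expr :: "expr \<Rightarrow> store \<Rightarrow> data" where
  "eval_expr (Var x) s = s x"
| "eval_expr LeafE s = Leaf"
| "eval_expr (NodeE a b) s = Node (eval_expr a s) (eval_expr b s)"
| "eval_expr (LeftE a) s = left (eval_expr a s)"
| "eval_expr (RightE a) s = right (eval_expr a s)"

fun expr_cost :: "expr \<Rightarrow> store \<Rightarrow> nat" where
  "expr_cost (Var x) s = dsize (s x)"
| "expr_cost LeafE s = 1"
| "expr_cost (NodeE a b) s = expr_cost a s + expr_cost b s + dsize (eval_expr (NodeE a b) s)"
| "expr_cost (LeftE a) s = expr_cost a s + dsize (eval_expr (LeftE a) s)"
| "expr_cost (RightE a) s = expr_cost a s + dsize (eval_expr (RightE a) s)"

datatype prog = Skip | Assign nat expr | Seq prog prog | If expr prog prog | While expr prog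

text \<open>\<open>exec p s t s'\<close>: started in store \<open>s\<close>, program \<open>p\<close> halts after time \<open>t\<close> in store \<open>s'\<close>.
  A guard counts as true iff it does not evaluate to \<^const>\<open>Leaf\<close>.\<close>

inductive exec :: "prog \<Rightarrow> store \<Rightarrow> nat \<Rightarrow> store \<Rightarrow> bool" where
  exec_Skip: "exec Skip s 1 s"
| exec_Assign: "exec (Assign x e) s (1 + expr_cost e s) (s(x := eval_expr e s))"
| exec_Seq: "exec p s t s' \<Longrightarrow> exec q s' t' s'' \<Longrightarrow> exec (Seq p q) s (t + t') s''"
| exec_IfTrue: "eval_expr e s \<noteq> Leaf \<Longrightarrow> exec p s t s' \<Longrightarrow>
    exec (If e p q) s (1 + expr_cost e s + t) s'"
| exec_IfFalse: "eval_expr e s = Leaf \<Longrightarrow> exec q s t s' \<Longrightarrow>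
    exec (If e p q) s (1 + expr_cost e s + t) s'"
| exec_WhileFalse: "eval_expr e s = Leaf \<Longrightarrow> exec (While e p) s (1 + expr_cost e s) s"
| exec_WhileTrue: "eval_expr e s \<noteq> Leaf \<Longrightarrow> exec p s t s' \<Longrightarrow> exec (While e p) s' t' s'' \<Longrightarrow>
    exec (While e p) s (1 + expr_cost e s + t + t') s''"

lemma exec_deterministic:
  "exec p s t s' \<Longrightarrow> exec p s u s'' \<Longrightarrow> u = t \<and> s'' = s'"
proof (induction arbitrary: u s'' rule: exec.induct)
  case (exec_Skip s)
  then show ?case by cases simp
next
  case (exec_Assign x e s)
  then show ?case by cases simp
next
  case (exec_Seq p s t s' q t' s1)
  from exec_Seq.prems show ?case by cases (metis exec_Seq.IH)
next
  case (exec_IfTrue e s p t s' q)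
  from exec_IfTrue.prems show ?case by cases (metis exec_IfTrue.IH, metis exec_IfTrue.hyps(1))
next
  case (exec_IfFalse e s q t s' p)
  from exec_IfFalse.prems show ?case by cases (metis exec_IfFalse.hyps(1), metis exec_IfFalse.IH)
next
  case (exec_WhileFalse e s p)
  from exec_WhileFalse.prems show ?case by cases (simp, metis exec_WhileFalse.hyps)
next
  case (exec_WhileTrue e s p t s' t' s1)
  from exec_WhileTrue.prems show ?case
    by cases (metis exec_WhileTrue.hyps(1), metis exec_WhileTrue.IH)
qed

text \<open>Input and output are passed in variable 0; all other variables initially hold \<^const>\<open>Leaf\<close>.
  \<open>valid\<close> singles out the instances of a problem, \<open>enc\<close> encodes them, and \<open>sol x out\<close> says that
  the output \<open>out\<close> is acceptable for the instance \<open>x\<close>.\<close>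

definition poly_time_solves ::
  "prog \<Rightarrow> ('i \<Rightarrow> bool) \<Rightarrow> ('i \<Rightarrow> data) \<Rightarrow> ('i \<Rightarrow> data \<Rightarrow> bool) \<Rightarrow> bool" where
  "poly_time_solves p valid enc sol \<longleftrightarrow>
     (\<exists>a d :: nat. \<forall>x. valid x \<longrightarrow>
        (\<exists>t s'. exec p ((\<lambda>_. Leaf)(0 := enc x)) t s' \<and> t \<le> a * dsize (enc x) ^ d \<and> sol x (s' 0)))"

text \<open>Numbers are written in binary, least significant bit first.\<close>

fun enc_nat :: "nat \<Rightarrow> data" where
  "enc_nat n = (if n = 0 then Leaf
     else Node (if odd n then Node Leaf Leaf else Leaf) (enc_nat (n div 2)))"

declare enc_nat.simps [simp del]

fun enc_list :: "('a \<Rightarrow> data) \<Rightarrow> 'a list \<Rightarrow> data" where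
  "enc_list f [] = Leaf"
| "enc_list f (x # xs) = Node (f x) (enc_list f xs)"

fun enc_pair :: "('a \<Rightarrow> data) \<Rightarrow> ('b \<Rightarrow> data) \<Rightarrow> 'a \<times> 'b \<Rightarrow> data" where
  "enc_pair f g (x, y) = Node (f x) (g y)"

text \<open>Only used for nonnegative rationals; the fraction is in lowest terms.\<close>

definition enc_rat :: "rat \<Rightarrow> data" where
  "enc_rat r = enc_pair (\<lambda>p. enc_nat (nat p)) (\<lambda>q. enc_nat (nat q)) (quotient_of r)"


section \<open>The Santa Claus problem\<close>

definition allocations :: "'p set \<Rightarrow> 'r set \<Rightarrow> ('p \<Rightarrow> 'r set) set" where
  "allocations P R =
     {S \<in> P \<rightarrow>\<^sub>E Pow R. disjoint_family_on S P \<and> (\<Union>i\<in>P. S i) = R}"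

definition santa_value :: "'p set \<Rightarrow> ('p \<Rightarrow> 'r \<Rightarrow> real) \<Rightarrow> ('p \<Rightarrow> 'r set) \<Rightarrow> real" where
  "santa_value P v S = Min ((\<lambda>i. \<Sum>j\<in>S i. v i j) ` P)"

definition santa_opt :: "'p set \<Rightarrow> 'r set \<Rightarrow> ('p \<Rightarrow> 'r \<Rightarrow> real) \<Rightarrow> real" where
  "santa_opt P R v = Max (santa_value P v ` allocations P R)"

text \<open>An input is a matrix of rationals whose rows are the players and whose columns are the
  resources; an output lists the bundle of every player.\<close>

definition santa_instance :: "rat list list \<Rightarrow> bool" where
  "santa_instance V \<longleftrightarrow>
     V \<noteq> [] \<and> (\<forall>r\<in>set V. length r = length (hd V) \<and> (\<forall>x\<in>set r. x \<ge> 0))"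

definition santa_players :: "rat list list \<Rightarrow> nat set" where
  "santa_players V = {..<length V}"

definition santa_resources :: "rat list list \<Rightarrow> nat set" where
  "santa_resources V = {..<length (hd V)}"

definition santa_val :: "rat list list \<Rightarrow> nat \<Rightarrow> nat \<Rightarrow> real" where
  "santa_val V i j = real_of_rat (V ! i ! j)"

definition santa_size :: "rat list list \<Rightarrow> nat" where
  "santa_size V = card (santa_players V) + card (santa_resources V)"

definition santa_solution :: "(nat \<Rightarrow> real) \<Rightarrow> rat list list \<Rightarrow> data \<Rightarrow> bool" where
  "santa_solution \<beta> V out \<longleftrightarrow>
     (\<exists>(L :: nat list list) S. out = enc_list (enc_list enc_nat) L \<and>
        length L = length V \<and> S = restrict (\<lambda>i. set (L ! i)) (santa_players V) \<and>
        S \<in> allocations (santa_players V) (santa_resources V) \<and>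
        santa_value (santa_players V) (santa_val V) S \<ge>
          santa_opt (santa_players V) (santa_resources V) (santa_val V) / \<beta> (santa_size V))"

definition poly_time_santa_approx :: "(nat \<Rightarrow> real) \<Rightarrow> prog \<Rightarrow> bool" where
  "poly_time_santa_approx \<beta> p \<longleftrightarrow>
     poly_time_solves p santa_instance (enc_list (enc_list enc_rat)) (santa_solution \<beta>)"


section \<open>Hypergraph matching\<close>

text \<open>\<open>C i\<close> is the hyperedge selected for \<open>i\<close> and \<open>A i\<close> the set of resources of \<open>C i\<close> assigned
  to \<open>i\<close>.\<close>

definition relaxed_perfect_matching ::
  "'v set \<Rightarrow> 'v set \<Rightarrow> 'v set set \<Rightarrow> real \<Rightarrow> ('v \<Rightarrow> 'v set) \<Rightarrow> ('v \<Rightarrow> 'v set) \<Rightarrow> bool" where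
  "relaxed_perfect_matching P R E \<alpha> C A \<longleftrightarrow>
     \<alpha> \<ge> 1 \<and>
     (\<forall>i\<in>P. C i \<in> E \<and> i \<in> C i \<and> A i \<subseteq> C i \<inter> R \<and>
        real (card (A i)) \<ge> real (card (C i \<inter> R)) / \<alpha>) \<and>
     disjoint_family_on A P"

text \<open>The infimum is a minimum whenever the set is nonempty, because for fixed \<open>C\<close> and \<open>A\<close> the
  admissible \<open>\<alpha>\<close> form a closed half-line and only finitely many \<open>C\<close> and \<open>A\<close> matter.\<close>

definition min_relaxation :: "'v set \<Rightarrow> 'v set \<Rightarrow> 'v set set \<Rightarrow> real" where
  "min_relaxation P R E = Inf {\<alpha>. \<exists>C A. relaxed_perfect_matching P R E \<alpha> C A}"

text \<open>An input \<open>(m, k, es)\<close> has \<open>P = {0..<m}\<close>, \<open>R = {m..<m+k}\<close> and the vertex sets of the lists in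
  \<open>es\<close> as hyperedges.\<close>

type_synonym hypergraph = "nat \<times> nat \<times> nat list list"

fun hg_players :: "hypergraph \<Rightarrow> nat set" where
  "hg_players (m, k, es) = {..<m}"

fun hg_resources :: "hypergraph \<Rightarrow> nat set" where
  "hg_resources (m, k, es) = {m..<m + k}"

fun hg_edges :: "hypergraph \<Rightarrow> nat set set" where
  "hg_edges (m, k, es) = set (map set es)"

fun hg_instance :: "hypergraph \<Rightarrow> bool" where
  "hg_instance (m, k, es) \<longleftrightarrow>
     distinct (map set es) \<and> (\<forall>e\<in>set es. distinct e) \<and>
     (\<forall>C\<in>hg_edges (m, k, es). C \<subseteq> hg_players (m, k, es) \<union> hg_resources (m, k, es) \<and>
        card (C \<inter> hg_players (m, k, es)) = 1)"

fun enc_hypergraph :: "hypergraph \<Rightarrow> data" where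
  "enc_hypergraph (m, k, es) =
     Node (enc_list enc_nat [0..<m])
       (Node (enc_list enc_nat [m..<m + k]) (enc_list (enc_list enc_nat) es))"

text \<open>The output lists, for every player, the selected hyperedge and the assigned resources. If
  the hypergraph has no relaxed perfect matching at all, any output is accepted.\<close>

definition matching_solution :: "real \<Rightarrow> hypergraph \<Rightarrow> data \<Rightarrow> bool" where
  "matching_solution c H out \<longleftrightarrow>
     (\<exists>\<alpha> C A. relaxed_perfect_matching (hg_players H) (hg_resources H) (hg_edges H) \<alpha> C A) \<longrightarrow>
     (\<exists>L :: (nat list \<times> nat list) list.
        out = enc_list (enc_pair (enc_list enc_nat) (enc_list enc_nat)) L \<and>
        length L = card (hg_players H) \<and>
        relaxed_perfect_matching (hg_players H) (hg_resources H) (hg_edges H)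
          (c * min_relaxation (hg_players H) (hg_resources H) (hg_edges H))
          (\<lambda>i. set (fst (L ! i))) (\<lambda>i. set (snd (L ! i))))"

definition poly_time_matching_approx :: "real \<Rightarrow> prog \<Rightarrow> bool" where
  "poly_time_matching_approx c p \<longleftrightarrow>
     poly_time_solves p hg_instance enc_hypergraph (matching_solution c)"


section \<open>Iterated logarithm\<close>

definition log_star :: "nat \<Rightarrow> nat" where
  "log_star n = (LEAST k. (log 2 ^^ k) (real n) \<le> 1)"

end

theory Submission imports Defs begin

text \<open>
  Round all values to powers of two and guess a power of two \<open>2 ^ s\<close> close to the optimum. In the
  hypergraph, every player selects some \<open>a\<close> and asks for \<open>2 ^ a / 2 ^ g\<close> blocks worth \<open>2 ^ s / 2 ^ a\<close>
  each; every block selects a class \<open>k \<ge> a\<close> and asks for \<open>2 ^ (k - a)\<close> slots; every slot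
  takes one resource worth at least \<open>2 ^ s / 2 ^ k\<close>. Only the first two steps involve edges with several
  resources, so an \<open>\<alpha>\<close>-relaxed matching gives every player value \<open>2 ^ s / (2 ^ g * \<alpha>\<^sup>2)\<close>. Conversely, if
  the optimum is at least \<open>2 ^ s\<close>, a perfect matching exists as soon as \<open>2 ^ g\<close> exceeds a constant
  times \<open>log_star n\<close>: the classes split into about \<open>log_star n\<close> windows, each of which
  starts at some \<open>a\<close> and has no more classes than blocks are asked for at \<open>a\<close>, and for every player
  one of these windows holds a \<open>1 / log_star n\<close> fraction of the value. The algorithm tries
  all \<open>s\<close> and \<open>g\<close> and keeps the best allocation, so it never computes \<open>log_star n\<close> or \<open>c\<close>.
\<close>

section \<open>Polynomial-time computable functions\<close>

subsection \<open>Running programs on disjoint variables\<close>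

text \<open>On an edge with a single resource, a positive share is the whole resource, so choosing
  concrete resources at the slots costs no factor; \<alpha> is paid once per multi-resource step.
  Demand is passed down through the copies: whoever asks for a block or slot consumes its copy, and
  a vertex that lost its copy cannot stay idle. One edge per bundle, or per combination of classes,
  would be too many. A player therefore fixes only the block size, and the blocks pick classes
  independently. The price is that each class may waste almost one block, which is why a window may
  contain only as many classes as blocks are demanded. Classes can be cut off at the bit length of
  the number of resources, since everything below is worth at most half of the target; this keeps
  all block and slot counts polynomial. For an infeasible hypergraph the solver may return any tree,
  so decoding is total and every candidate is tested. The loss obtained is
  \<open>256 * (log_star n + 2) * c^2\<close>, linear in \<open>log_star n\<close>; the constant 768
  absorbs the additive 2.\<close>

lemma dsize_pos: "dsize d \<ge> 1"
  by (induction d) auto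

lemma dsize_eval_expr: "dsize (eval_expr e s) \<le> expr_cost e s"
  by (cases e) auto

lemma dsize_left_right: "dsize (left d) \<le> dsize d" "dsize (right d) \<le> dsize d"
  by (cases d; simp)+

text \<open>A fixed expression touches a fixed number of trees and at most adds up their sizes;
  constants are absorbed because every tree has size at least 1.\<close>

lemma expr_cost_linear: "\<exists>k. \<forall>s m. (\<forall>x. dsize (s x) \<le> m) \<longrightarrow> expr_cost e s \<le> k * m"
proof (induction e)
  case (Var x)
  show ?case by (rule exI[of _ 1]) auto
next
  case LeafE
  show ?case
  proof (rule exI[of _ 1], intro allI impI)
    fix s :: store and m assume "\<forall>x. dsize (s x) \<le> m"
    then show "expr_cost LeafE s \<le> 1 * m" using dsize_pos[of "s 0"] by (simp add: order_trans)
  qed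
next
  case (NodeE e1 e2)
  then obtain k1 k2 where k: "\<forall>s m. (\<forall>x. dsize (s x) \<le> m) \<longrightarrow> expr_cost e1 s \<le> k1 * m"
    "\<forall>s m. (\<forall>x. dsize (s x) \<le> m) \<longrightarrow> expr_cost e2 s \<le> k2 * m" by blast
  show ?case
  proof (rule exI[of _ "2 * k1 + 2 * k2 + 1"], intro allI impI)
    fix s :: store and m assume m: "\<forall>x. dsize (s x) \<le> m"
    have "1 \<le> m" using dsize_pos[of "s 0"] m by (meson order_trans)
    moreover have "expr_cost e1 s \<le> k1 * m" "expr_cost e2 s \<le> k2 * m" using k m by blast+
    ultimately show "expr_cost (NodeE e1 e2) s \<le> (2 * k1 + 2 * k2 + 1) * m"
      using dsize_eval_expr[of e1 s] dsize_eval_expr[of e2 s] by (simp add: algebra_simps)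
  qed
next
  case (LeftE e)
  then obtain k where k: "\<forall>s m. (\<forall>x. dsize (s x) \<le> m) \<longrightarrow> expr_cost e s \<le> k * m" by blast
  show ?case
  proof (rule exI[of _ "2 * k"], intro allI impI)
    fix s :: store and m assume "\<forall>x. dsize (s x) \<le> m"
    then have "expr_cost e s \<le> k * m" using k by blast
    then show "expr_cost (LeftE e) s \<le> (2 * k) * m"
      using dsize_eval_expr[of e s] dsize_left_right(1)[of "eval_expr e s"] by simp
  qed
next
  case (RightE e)
  then obtain k where k: "\<forall>s m. (\<forall>x. dsize (s x) \<le> m) \<longrightarrow> expr_cost e s \<le> k * m" by blast
  show ?case
  proof (rule exI[of _ "2 * k"], intro allI impI)
    fix s :: store and m assume "\<forall>x. dsize (s x) \<le> m"
    then have "expr_cost e s \<le> k * m" using k by blast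
    then show "expr_cost (RightE e) s \<le> (2 * k) * m"
      using dsize_eval_expr[of e s] dsize_left_right(2)[of "eval_expr e s"] by simp
  qed
qed

text \<open>Whatever is stored was paid for when it was assigned. This turns time bounds into bounds
  on output sizes.\<close>

lemma exec_dsize_le: "exec p s t s' \<Longrightarrow> dsize (s' x) \<le> dsize (s x) + t"
proof (induction rule: exec.induct)
  case (exec_Assign y e s)
  then show ?case using dsize_eval_expr[of e s] by simp
qed auto

section \<open>Subroutine calls: clean-up and renaming of variables\<close>

fun assigned_bound :: "prog \<Rightarrow> nat" where
  "assigned_bound Skip = 0"
| "assigned_bound (Assign x e) = Suc x"
| "assigned_bound (Seq p q) = max (assigned_bound p) (assigned_bound q)"
| "assigned_bound (If e p q) = max (assigned_bound p) (assigned_bound q)"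
| "assigned_bound (While e p) = assigned_bound p"

lemma exec_unassigned: "exec p s t s' \<Longrightarrow> assigned_bound p \<le> x \<Longrightarrow> s' x = s x"
  by (induction rule: exec.induct) auto

fun clear_vars :: "nat \<Rightarrow> prog" where
  "clear_vars 0 = Skip"
| "clear_vars (Suc n) = Seq (Assign (Suc n) LeafE) (clear_vars n)"

lemma exec_clear_vars:
  "exec (clear_vars n) s (2 * n + 1) (\<lambda>x. if 1 \<le> x \<and> x \<le> n then Leaf else s x)"
proof (induction n arbitrary: s)
  case 0
  have "(\<lambda>x. if 1 \<le> x \<and> x \<le> (0::nat) then Leaf else s x) = s" by auto
  then show ?case using exec_Skip[of s] by simp
next
  case (Suc n)
  let ?s = "s(Suc n := Leaf)"
  have "exec (Assign (Suc n) LeafE) s 2 ?s" using exec_Assign[of "Suc n" LeafE s] by (simp add: numeral_2_eq_2)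
  moreover have "(\<lambda>x. if 1 \<le> x \<and> x \<le> n then Leaf else ?s x) =
      (\<lambda>x. if 1 \<le> x \<and> x \<le> Suc n then Leaf else s x)" by (auto simp: fun_eq_iff)
  ultimately show ?case using exec_Seq[OF _ Suc.IH, of _ s 2 ?s] by simp
qed

fun shift_expr :: "nat \<Rightarrow> expr \<Rightarrow> expr" where
  "shift_expr K (Var x) = Var (x + K)"
| "shift_expr K LeafE = LeafE"
| "shift_expr K (NodeE a b) = NodeE (shift_expr K a) (shift_expr K b)"
| "shift_expr K (LeftE a) = LeftE (shift_expr K a)"
| "shift_expr K (RightE a) = RightE (shift_expr K a)"

fun shift_prog :: "nat \<Rightarrow> prog \<Rightarrow> prog" where
  "shift_prog K Skip = Skip"
| "shift_prog K (Assign x e) = Assign (x + K) (shift_expr K e)"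
| "shift_prog K (Seq p q) = Seq (shift_prog K p) (shift_prog K q)"
| "shift_prog K (If e p q) = If (shift_expr K e) (shift_prog K p) (shift_prog K q)"
| "shift_prog K (While e p) = While (shift_expr K e) (shift_prog K p)"

text \<open>The caller owns the first \<open>K\<close> variables; the callee's store
  \<open>s\<close> sits above them.\<close>

definition merge :: "nat \<Rightarrow> store \<Rightarrow> store \<Rightarrow> store" where
  "merge K u s = (\<lambda>x. if x < K then u x else s (x - K))"

lemma eval_shift_expr: "eval_expr (shift_expr K e) (merge K u s) = eval_expr e s"
  by (induction e) (auto simp: merge_def)

lemma expr_cost_shift_expr: "expr_cost (shift_expr K e) (merge K u s) = expr_cost e s"
  by (induction e) (simp_all add: eval_shift_expr, simp add: merge_def)

lemma merge_upd: "(merge K u s)(x + K := d) = merge K u (s(x := d))"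
  by (auto simp: merge_def fun_eq_iff)

lemma exec_shift_prog: "exec p s t s' \<Longrightarrow> exec (shift_prog K p) (merge K u s) t (merge K u s')"
proof (induction rule: exec.induct)
  case (exec_Skip s)
  show ?case using exec.exec_Skip by simp
next
  case (exec_Assign x e s)
  show ?case
    using exec.exec_Assign[of "x + K" "shift_expr K e" "merge K u s"]
    unfolding eval_shift_expr expr_cost_shift_expr merge_upd shift_prog.simps .
next
  case (exec_Seq p s t s' q t' s'')
  then show ?case by (simp add: exec.intros)
next
  case (exec_IfTrue e s p t s' q)
  then show ?case
    using exec.exec_IfTrue[of "shift_expr K e" "merge K u s"]
    by (simp add: eval_shift_expr expr_cost_shift_expr)
next
  case (exec_IfFalse e s q t s' p)
  then show ?case
    using exec.exec_IfFalse[of "shift_expr K e" "merge K u s"]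
    by (simp add: eval_shift_expr expr_cost_shift_expr)
next
  case (exec_WhileFalse e s p)
  then show ?case
    using exec.exec_WhileFalse[of "shift_expr K e" "merge K u s"]
    by (simp add: eval_shift_expr expr_cost_shift_expr)
next
  case (exec_WhileTrue e s p t s' t' s'')
  then show ?case
    using exec.exec_WhileTrue[of "shift_expr K e" "merge K u s"]
    by (simp add: eval_shift_expr expr_cost_shift_expr)
qed

definition runs :: "prog \<Rightarrow> store \<Rightarrow> nat \<Rightarrow> store \<Rightarrow> bool" where
  "runs p s T s' \<longleftrightarrow> (\<exists>t \<le> T. exec p s t s')"

lemma runs_Assign:
  "s' = s(x := eval_expr e s) \<Longrightarrow> Suc (expr_cost e s) \<le> T \<Longrightarrow> runs (Assign x e) s T s'"
  unfolding runs_def using exec_Assign[of x e s] by auto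

lemma runs_Seq: "runs p s T s' \<Longrightarrow> runs q s' U s'' \<Longrightarrow> runs (Seq p q) s (T + U) s''"
  unfolding runs_def by (meson add_le_mono exec_Seq)

lemma runs_shift: "runs p s T s' \<Longrightarrow> runs (shift_prog K p) (merge K u s) T (merge K u s')"
  unfolding runs_def using exec_shift_prog by blast

lemma runs_mono: "runs p s T s' \<Longrightarrow> T \<le> U \<Longrightarrow> runs p s U s'"
  unfolding runs_def using order_trans by blast

definition inp :: "data \<Rightarrow> store" where
  "inp d = (\<lambda>_. Leaf)(0 := d)"

lemma inp_simps [simp]: "inp d 0 = d" "x > 0 \<Longrightarrow> inp d x = Leaf"
  by (auto simp: inp_def)

lemma dsize_inp: "dsize (inp d x) \<le> dsize d"
  using dsize_pos[of d] by (auto simp: inp_def)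

definition vst :: "data list \<Rightarrow> store" where
  "vst us = (\<lambda>x. if x < length us then us ! x else Leaf)"

lemma vst_simps [simp]:
  "vst (a # us) 0 = a"
  "vst (a # us) (Suc x) = vst us x"
  "vst (a # us) 1 = vst us 0"
  "vst (a # us) (numeral k) = vst us (pred_numeral k)"
  by (simp_all add: vst_def numeral_eq_Suc)

lemma inp_vst: "inp d = vst [d]"
  by (auto simp: inp_def vst_def fun_eq_iff)

lemma vst_Leaf: "vst (us @ [Leaf]) = vst us"
  by (auto simp: vst_def fun_eq_iff nth_append)

lemma runs_vAssign:
  assumes "x < length us" "us' = us[x := eval_expr e (vst us)]" "Suc (expr_cost e (vst us)) \<le> T"
  shows "runs (Assign x e) (vst us) T (vst us')"
  using assms by (intro runs_Assign) (auto simp: vst_def fun_eq_iff)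

text \<open>The callee finds its input at variable \<open>K\<close> and only \<open>Leaf\<close>
  above it, since \<open>vst\<close> is \<open>Leaf\<close> beyond its list.\<close>

lemma runs_vCall:
  assumes "runs p (inp d) T (inp d')" "length us = K"
  shows "runs (shift_prog K p) (vst (us @ [d])) T (vst (us @ [d']))"
proof -
  have "merge K (vst us) (inp e) = vst (us @ [e])" for e
    using assms(2) by (auto simp: merge_def vst_def inp_def fun_eq_iff nth_append)
  then show ?thesis using runs_shift[OF assms(1), of K "vst us"] by simp
qed

lemma exec_cleared:
  assumes "exec p (inp d) t s'"
  shows "exec (Seq p (clear_vars (assigned_bound p))) (inp d) (t + (2 * assigned_bound p + 1)) (inp (s' 0))"
proof -
  have "(\<lambda>x. if 1 \<le> x \<and> x \<le> assigned_bound p then Leaf else s' x) = inp (s' 0)"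
    using exec_unassigned[OF assms] by (force simp: inp_def fun_eq_iff)
  then show ?thesis using exec_Seq[OF assms exec_clear_vars] by metis
qed

subsection \<open>Polynomially bounded quantities\<close>

class encodable = fixes encode :: "'a \<Rightarrow> data"

definition pbd :: "('a::encodable \<Rightarrow> nat) \<Rightarrow> bool" where
  "pbd f \<longleftrightarrow> (\<exists>a d. \<forall>x. f x \<le> a * dsize (encode x) ^ d)"

named_theorems pbd_intros

lemma pbd_mono: "pbd g \<Longrightarrow> (\<And>x. f x \<le> g x) \<Longrightarrow> pbd f"
  unfolding pbd_def by (meson order_trans)

lemma dsize_power_mono: "d \<le> e \<Longrightarrow> dsize x ^ d \<le> dsize x ^ e"
  using dsize_pos[of x] by (intro power_increasing)

lemma pbd_const [pbd_intros]: "pbd (\<lambda>x. k)"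
  unfolding pbd_def by (rule exI[of _ k], rule exI[of _ 0]) simp

lemma pbd_size [pbd_intros]: "pbd (\<lambda>x. dsize (encode x))"
  unfolding pbd_def by (rule exI[of _ 1], rule exI[of _ 1]) simp

lemma pbd_add [pbd_intros]:
  assumes "pbd f" "pbd g"
  shows "pbd (\<lambda>x. f x + g x)"
proof -
  obtain a d b e where f: "\<And>x. f x \<le> a * dsize (encode x) ^ d" and g: "\<And>x. g x \<le> b * dsize (encode x) ^ e"
    using assms unfolding pbd_def by blast
  have "f x + g x \<le> (a + b) * dsize (encode x) ^ max d e" for x
  proof -
    have "f x \<le> a * dsize (encode x) ^ max d e" "g x \<le> b * dsize (encode x) ^ max d e"
      by (meson f g dsize_power_mono max.cobounded1 max.cobounded2 mult_le_mono2 order_trans)+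
    then show ?thesis by (simp add: algebra_simps)
  qed
  then show ?thesis unfolding pbd_def by blast
qed

lemma pbd_mult [pbd_intros]:
  assumes "pbd f" "pbd g"
  shows "pbd (\<lambda>x. f x * g x)"
proof -
  obtain a d b e where f: "\<And>x. f x \<le> a * dsize (encode x) ^ d" and g: "\<And>x. g x \<le> b * dsize (encode x) ^ e"
    using assms unfolding pbd_def by blast
  have "f x * g x \<le> (a * b) * dsize (encode x) ^ (d + e)" for x
    using mult_le_mono[OF f[of x] g[of x]] by (simp add: power_add algebra_simps)
  then show ?thesis unfolding pbd_def by blast
qed

lemma pbd_power [pbd_intros]: "pbd f \<Longrightarrow> pbd (\<lambda>x. f x ^ k)"
  by (induction k) (simp_all add: pbd_intros)

lemma pbd_comp:
  assumes "pbd T" "pbd (\<lambda>x. dsize (encode (f x)))"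
  shows "pbd (\<lambda>x. T (f x))"
proof -
  obtain a d where T: "\<And>y. T y \<le> a * dsize (encode y) ^ d" using assms(1) unfolding pbd_def by blast
  show ?thesis
    by (rule pbd_mono[OF pbd_mult[OF pbd_const[of a] pbd_power[OF assms(2), of d]]]) (rule T)
qed

subsection \<open>Closure properties\<close>

text \<open>The final store is again of the form \<open>inp\<close>, with all scratch variables
  reset, so such programs can be chained and called repeatedly.\<close>

definition pt :: "('a::encodable \<Rightarrow> 'b::encodable) \<Rightarrow> bool" where
  "pt f \<longleftrightarrow> (\<exists>p T. pbd T \<and> (\<forall>x. runs p (inp (encode x)) (T x) (inp (encode (f x)))))"

text \<open>Only variable 0 has to be right: clearing the others costs a constant that depends on
  the program alone.\<close>

lemma ptI:
  assumes "pbd T" "\<And>x. \<exists>s'. runs p (inp (encode x)) (T x) s' \<and> s' 0 = encode (f x)"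
  shows "pt f"
  unfolding pt_def
proof (intro exI conjI allI)
  let ?k = "2 * assigned_bound p + 1"
  show "pbd (\<lambda>x. T x + ?k)" by (intro pbd_intros assms)
  fix x
  obtain t s' where "exec p (inp (encode x)) t s'" "t \<le> T x" "s' 0 = encode (f x)"
    using assms(2) unfolding runs_def by blast
  then show "runs (Seq p (clear_vars (assigned_bound p))) (inp (encode x)) (T x + ?k) (inp (encode (f x)))"
    unfolding runs_def using exec_cleared by (metis add_le_mono1)
qed

lemma ptE:
  assumes "pt f"
  obtains p T where "pbd T" "\<And>x. runs p (inp (encode x)) (T x) (inp (encode (f x)))"
  using assms unfolding pt_def by blast

lemma pt_pbd:
  assumes "pt f"
  shows "pbd (\<lambda>x. dsize (encode (f x)))"
proof -
  obtain p T where T: "pbd T" and p: "\<And>x. runs p (inp (encode x)) (T x) (inp (encode (f x)))"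
    using ptE[OF assms] by blast
  show ?thesis
  proof (rule pbd_mono[OF pbd_add[OF pbd_size T]])
    fix x
    obtain t where "t \<le> T x" "exec p (inp (encode x)) t (inp (encode (f x)))" using p unfolding runs_def by blast
    then show "dsize (encode (f x)) \<le> dsize (encode x) + T x"
      using exec_dsize_le[of p "inp (encode x)" t _ 0] by fastforce
  qed
qed

lemma pt_expr:
  assumes "\<And>x. eval_expr e (inp (encode x)) = encode (f x)"
  shows "pt f"
proof -
  obtain k where k: "\<And>s m. (\<forall>x. dsize (s x) \<le> m) \<Longrightarrow> expr_cost e s \<le> k * m"
    using expr_cost_linear[of e] by blast
  show ?thesis
  proof (rule ptI[where p = "Assign 0 e"])
    show "pbd (\<lambda>x::'a. 1 + k * dsize (encode x))" by (intro pbd_intros)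
    fix x
    show "\<exists>s'. runs (Assign 0 e) (inp (encode x)) (1 + k * dsize (encode x)) s' \<and> s' 0 = encode (f x)"
      by (intro exI conjI, rule runs_Assign[OF HOL.refl])
        (use k[of "inp (encode x)" "dsize (encode x)"] assms dsize_inp in auto)
  qed
qed

lemma pt_comp:
  assumes "pt g" "pt f"
  shows "pt (\<lambda>x. g (f x))"
proof -
  obtain p T where T: "pbd T" and p: "\<And>x. runs p (inp (encode x)) (T x) (inp (encode (f x)))"
    using ptE[OF assms(2)] by blast
  obtain q U where U: "pbd U" and q: "\<And>x. runs q (inp (encode x)) (U x) (inp (encode (g x)))"
    using ptE[OF assms(1)] by blast
  show ?thesis
    unfolding pt_def
  proof (intro exI conjI allI)
    show "pbd (\<lambda>x. T x + U (f x))" by (intro pbd_add T pbd_comp[OF U] pt_pbd assms)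
    fix x show "runs (Seq p q) (inp (encode x)) (T x + U (f x)) (inp (encode (g (f x))))"
      by (rule runs_Seq[OF p q])
  qed
qed


section \<open>Tree encodings of the basic types, pairs, conditionals and loops\<close>

instantiation data :: encodable begin
definition encode_data :: "data \<Rightarrow> data" where "encode_data d = d"
instance ..
end

instantiation unit :: encodable begin
definition encode_unit :: "unit \<Rightarrow> data" where "encode_unit u = Leaf"
instance ..
end

instantiation bool :: encodable begin
definition encode_bool :: "bool \<Rightarrow> data" where "encode_bool b = (if b then Node Leaf Leaf else Leaf)"
instance ..
end

instantiation prod :: (encodable, encodable) encodable begin
definition encode_prod :: "'a \<times> 'b \<Rightarrow> data" where "encode_prod p = Node (encode (fst p)) (encode (snd p))"
instance ..
end

instantiation list :: (encodable) encodable begin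
definition encode_list :: "'a list \<Rightarrow> data" where "encode_list = enc_list encode"
instance ..
end

text \<open>Numbers are passed between functions in unary. This costs only polynomial factors here, since
  all quantities that occur are polynomially bounded in the size of the instance.\<close>

instantiation nat :: encodable begin
definition encode_nat :: "nat \<Rightarrow> data" where "encode_nat n = (Node Leaf ^^ n) Leaf"
instance ..
end

lemma encode_simps [simp]:
  "encode ([] :: 'a::encodable list) = Leaf"
  "encode (a # as) = Node (encode a) (encode as)"
  "encode (x, y) = Node (encode x) (encode y)"
  "encode (0 :: nat) = Leaf"
  "encode (Suc n) = Node Leaf (encode n)"
  "encode True = Node Leaf Leaf"
  "encode False = Leaf"
  "encode () = Leaf"
  by (simp_all add: encode_list_def encode_prod_def encode_nat_def encode_bool_def encode_unit_def)

text \<open>Variable 0 keeps the input, variable 1 saves the first result, and both calls run from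
  variable 2 upwards.\<close>

lemma pt_pair:
  assumes "pt f" "pt g"
  shows "pt (\<lambda>x. (f x, g x))"
proof -
  obtain p T where T: "pbd T" and p: "\<And>x. runs p (inp (encode x)) (T x) (inp (encode (f x)))"
    using ptE[OF assms(1)] by blast
  obtain q U where U: "pbd U" and q: "\<And>x. runs q (inp (encode x)) (U x) (inp (encode (g x)))"
    using ptE[OF assms(2)] by blast
  let ?P = "Seq (Assign 2 (Var 0)) (Seq (shift_prog 2 p) (Seq (Assign 1 (Var 2)) (Seq (Assign 2 (Var 0))
      (Seq (shift_prog 2 q) (Assign 0 (NodeE (Var 1) (Var 2)))))))"
  let ?T = "\<lambda>x. (1 + dsize (encode x)) + (T x + ((1 + dsize (encode (f x))) + ((1 + dsize (encode x)) +
      (U x + (2 + 2 * dsize (encode (f x)) + 2 * dsize (encode (g x)))))))"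
  show ?thesis
  proof (rule ptI[where p = ?P])
    show "pbd ?T" by (intro pbd_intros T U pt_pbd assms)
    fix x
    let ?x = "encode x" and ?f = "encode (f x)" and ?g = "encode (g x)"
    have "vst [?x] = vst [?x, Leaf, Leaf]"
      using vst_Leaf[of "[?x]"] vst_Leaf[of "[?x, Leaf]"] by simp
    then have 1: "runs (Assign 2 (Var 0)) (inp ?x) (1 + dsize ?x) (vst [?x, Leaf, ?x])"
      unfolding inp_vst by (metis runs_vAssign[of 2 "[?x, Leaf, Leaf]" "[?x, Leaf, ?x]" "Var 0" "1 + dsize ?x", simplified] One_nat_def plus_1_eq_Suc)
    have 2: "runs (shift_prog 2 p) (vst [?x, Leaf, ?x]) (T x) (vst [?x, Leaf, ?f])"
      using runs_vCall[OF p[of x], of "[?x, Leaf]" 2] by simp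
    have 3: "runs (Assign 1 (Var 2)) (vst [?x, Leaf, ?f]) (1 + dsize ?f) (vst [?x, ?f, ?f])"
      by (rule runs_vAssign) simp_all
    have 4: "runs (Assign 2 (Var 0)) (vst [?x, ?f, ?f]) (1 + dsize ?x) (vst [?x, ?f, ?x])"
      by (rule runs_vAssign) simp_all
    have 5: "runs (shift_prog 2 q) (vst [?x, ?f, ?x]) (U x) (vst [?x, ?f, ?g])"
      using runs_vCall[OF q[of x], of "[?x, ?f]" 2] by simp
    have 6: "runs (Assign 0 (NodeE (Var 1) (Var 2))) (vst [?x, ?f, ?g]) (2 + 2 * dsize ?f + 2 * dsize ?g)
        (vst [Node ?f ?g, ?f, ?g])"
      by (rule runs_vAssign) simp_all
    have "runs ?P (inp ?x) (?T x) (vst [Node ?f ?g, ?f, ?g])"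
      by (rule runs_Seq[OF 1 runs_Seq[OF 2 runs_Seq[OF 3 runs_Seq[OF 4 runs_Seq[OF 5 6]]]]])
    then show "\<exists>s'. runs ?P (inp ?x) (?T x) s' \<and> s' 0 = encode (f x, g x)"
      by (intro exI[of _ "vst [Node ?f ?g, ?f, ?g]"]) simp
  qed
qed

lemma pt_if:
  assumes "pt b" "pt f" "pt g"
  shows "pt (\<lambda>x. if b x then f x else g x)"
proof -
  obtain p T where T: "pbd T" and p: "\<And>x. runs p (inp (encode x)) (T x) (inp (encode (f x)))"
    using ptE[OF assms(2)] by blast
  obtain q U where U: "pbd U" and q: "\<And>x. runs q (inp (encode x)) (U x) (inp (encode (g x)))"
    using ptE[OF assms(3)] by blast
  obtain w W where W: "pbd W" and w: "\<And>x. runs w (inp (encode x)) (W x) (inp (encode (b x)))"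
    using ptE[OF assms(1)] by blast
  let ?P = "Seq (Assign 1 (Var 0)) (Seq (shift_prog 1 w)
      (If (Var 1) (Seq (Assign 1 LeafE) p) (Seq (Assign 1 LeafE) q)))"
  let ?T = "\<lambda>x. (1 + dsize (encode x)) + (W x + (4 + 2 + (T x + U x)))"
  show ?thesis
  proof (rule ptI[where p = ?P])
    show "pbd ?T" by (intro pbd_intros T U W)
    fix x
    let ?x = "encode x" and ?b = "encode (b x)"
    let ?y = "encode (if b x then f x else g x)"
    have x: "vst [?x] = vst [?x, Leaf]" using vst_Leaf[of "[?x]"] by simp
    \<comment> \<open>The guard is erased before branching, because \<open>p\<close> and
      \<open>q\<close> expect a store with \<open>Leaf\<close> outside variable 0.\<close>
    have c: "runs (Assign 1 LeafE) (vst [?x, ?b]) 2 (inp ?x)"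
      unfolding inp_vst x by (rule runs_vAssign) simp_all
    have i: "runs (If (Var 1) (Seq (Assign 1 LeafE) p) (Seq (Assign 1 LeafE) q)) (vst [?x, ?b]) (4 + 2 + (T x + U x)) (inp ?y)"
    proof (cases "b x")
      case True
      obtain t where t: "t \<le> 2 + T x" "exec (Seq (Assign 1 LeafE) p) (vst [?x, ?b]) t (inp ?y)"
        using runs_Seq[OF c p] True unfolding runs_def by auto
      then show ?thesis using exec_IfTrue[of "Var 1" "vst [?x, ?b]", OF _ t(2)] True unfolding runs_def
        by (intro exI[of _ "1 + expr_cost (Var 1) (vst [?x, ?b]) + t"]) (auto simp: vst_def)
    next
      case False
      obtain t where t: "t \<le> 2 + U x" "exec (Seq (Assign 1 LeafE) q) (vst [?x, ?b]) t (inp ?y)"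
        using runs_Seq[OF c q] False unfolding runs_def by auto
      then show ?thesis using exec_IfFalse[of "Var 1" "vst [?x, ?b]", OF _ t(2)] False unfolding runs_def
        by (intro exI[of _ "1 + expr_cost (Var 1) (vst [?x, ?b]) + t"]) (auto simp: vst_def)
    qed
    have 1: "runs (Assign 1 (Var 0)) (inp ?x) (1 + dsize ?x) (vst [?x, ?x])"
      unfolding inp_vst x by (rule runs_vAssign) simp_all
    have 2: "runs (shift_prog 1 w) (vst [?x, ?x]) (W x) (vst [?x, ?b])"
      using runs_vCall[OF w[of x], of "[?x]" 1] by simp
    have "runs ?P (inp ?x) (?T x) (inp ?y)"
      by (rule runs_Seq[OF 1 runs_Seq[OF 2 i]])
    then show "\<exists>s'. runs ?P (inp ?x) (?T x) s' \<and> s' 0 = ?y"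
      by (intro exI[of _ "inp ?y"]) simp
  qed
qed

lemma runs_WhileFalse: "eval_expr e s = Leaf \<Longrightarrow> runs (While e p) s (1 + expr_cost e s) s"
  unfolding runs_def using exec_WhileFalse by blast

lemma runs_WhileTrue:
  assumes "eval_expr e s \<noteq> Leaf" "runs p s T s'" "runs (While e p) s' U s''"
  shows "runs (While e p) s (1 + expr_cost e s + T + U) s''"
  using assms exec_WhileTrue[of e s p] unfolding runs_def by (meson add_le_mono le_refl)

lemma dsize_list_elem: "x \<in> set xs \<Longrightarrow> dsize (encode x) \<le> dsize (encode xs)"
  by (induction xs) auto

lemma dsize_list: "dsize (encode xs) = 1 + (\<Sum>x\<leftarrow>xs. dsize (encode x) + 1)"
  by (induction xs) auto

lemma length_le_dsize: "length xs \<le> dsize (encode xs)"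
  by (induction xs) auto

lemma dsize_drop: "dsize (encode (drop i xs)) \<le> dsize (encode xs)"
proof (induction xs arbitrary: i)
  case (Cons x xs)
  show ?case using Cons.IH[of "i - 1"] by (cases i) auto
qed simp

text \<open>A polynomial step may square its state each time, so \<open>S\<close> has to bound all
  intermediate states. Variables: 0 the input, 1 the state, 2 the rest of the list, 3 upwards the
  calls of the step.\<close>

lemma pt_foldl:
  assumes step: "pt (\<lambda>p. step (fst p) (fst (snd p)) (snd (snd p)))" and init: "pt init" and l: "pt l"
    and S: "pbd S" "\<And>x i. i \<le> length (l x) \<Longrightarrow> dsize (encode (foldl (step x) (init x) (take i (l x)))) \<le> S x"
  shows "pt (\<lambda>x. foldl (step x) (init x) (l x))"
proof -
  let ?step = "\<lambda>p. step (fst p) (fst (snd p)) (snd (snd p))"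
  obtain p T where T: "pbd T" and p: "\<And>x. runs p (inp (encode x)) (T x) (inp (encode (?step x)))"
    using ptE[OF step] by blast
  have "pt (\<lambda>x. (x, (init x, l x)))" by (intro pt_pair init l pt_expr[where e = "Var 0"]) simp
  then obtain q U where U: "pbd U" and q: "\<And>x. runs q (inp (encode x)) (U x) (inp (encode (x, (init x, l x))))"
    using ptE by blast
  obtain a d where ad: "\<And>y. T y \<le> a * dsize (encode y) ^ d" using T unfolding pbd_def by blast
  let ?B = "Seq (Assign 3 (NodeE (Var 0) (NodeE (Var 1) (LeftE (Var 2))))) (Seq (shift_prog 3 p)
      (Seq (Assign 1 (Var 3)) (Seq (Assign 3 LeafE) (Assign 2 (RightE (Var 2))))))"
  let ?P = "Seq q (Seq (Assign 1 (LeftE (RightE (Var 0)))) (Seq (Assign 2 (RightE (RightE (Var 0))))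
      (Seq (Assign 0 (LeftE (Var 0))) (Seq (While (Var 2) ?B) (Assign 0 (Var 1))))))"
  let ?n = "\<lambda>x. dsize (encode x)" and ?m = "\<lambda>x. dsize (encode (l x))"
  \<comment> \<open>Bounds the argument \<open>(x, (state, element))\<close> of each call; the 2
    counts the two pair nodes.\<close>
  let ?M = "\<lambda>x. 2 + ?n x + S x + ?m x"
  let ?C = "\<lambda>x. 5 * ?M x + (a * ?M x ^ d + ((1 + ?M x) + (2 + (1 + 2 * ?M x))))"
  let ?W = "\<lambda>x. ?m x * (1 + ?M x + ?C x) + 2"
  let ?T = "\<lambda>x. U x + ((5 * ?M x) + ((5 * ?M x) + ((5 * ?M x) + (?W x + (1 + ?M x)))))"
  have m: "pbd ?m" by (rule pt_pbd[OF l])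
  show ?thesis
  proof (rule ptI[where p = ?P])
    show "pbd ?T" by (intro pbd_intros S m U)
    fix x
    let ?s = "\<lambda>i. foldl (step x) (init x) (take i (l x))"
    let ?v = "\<lambda>i. vst [encode x, encode (?s i), encode (drop i (l x)), Leaf]"
    \<comment> \<open>Induction on the number of remaining elements. The leftovers
      \<open>d0\<close>, \<open>d2\<close>, \<open>d3\<close> do not matter, as \<open>ptI\<close>
      looks at variable 0 only.\<close>
    have loop: "\<exists>d0 d2 d3. runs (While (Var 2) ?B) (?v i) ((length (l x) - i) * (1 + ?M x + ?C x) + 2)
        (vst [d0, encode (?s (length (l x))), d2, d3])" if "i \<le> length (l x)" for i
      using that
    proof (induction "length (l x) - i" arbitrary: i)
      case 0
      then have "i = length (l x)" by simp
      then show ?case using runs_WhileFalse[of "Var 2" "?v i" ?B] by fastforce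
    next
      case (Suc k)
      let ?y = "l x ! i" and ?y' = "encode (drop (Suc i) (l x))"
      have i: "i < length (l x)" using Suc by simp
      then have d: "encode (drop i (l x)) = Node (encode ?y) ?y'"
        by (simp add: Cons_nth_drop_Suc[symmetric])
      have s: "step x (?s i) ?y = ?s (Suc i)" using i by (simp add: take_Suc_conv_app_nth)
      have le: "dsize (encode (?s i)) \<le> S x" "dsize (encode (?s (Suc i))) \<le> S x" using S(2) i by simp_all
      have dm: "dsize (Node (encode ?y) ?y') \<le> ?m x" using dsize_drop[of i "l x"] d by simp
      have "T (x, (?s i, ?y)) \<le> a * ?M x ^ d"
        by (rule order_trans[OF ad]) (use le dm in \<open>simp add: power_mono\<close>)
      then have call: "runs p (inp (encode (x, (?s i, ?y)))) (a * ?M x ^ d) (inp (encode (?s (Suc i))))"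
        using p[of "(x, (?s i, ?y))"] s by (auto intro: runs_mono)
      let ?t = "encode (x, (?s i, ?y))"
      have 1: "runs (Assign 3 (NodeE (Var 0) (NodeE (Var 1) (LeftE (Var 2)))))
          (vst [encode x, encode (?s i), Node (encode ?y) ?y', Leaf]) (5 * ?M x)
          (vst [encode x, encode (?s i), Node (encode ?y) ?y', ?t])"
        by (rule runs_vAssign) (use le dm in simp_all)
      have 2: "runs (shift_prog 3 p) (vst [encode x, encode (?s i), Node (encode ?y) ?y', ?t]) (a * ?M x ^ d)
          (vst [encode x, encode (?s i), Node (encode ?y) ?y', encode (?s (Suc i))])"
        using runs_vCall[OF call, of "[encode x, encode (?s i), Node (encode ?y) ?y']" 3] by simp
      have 3: "runs (Assign 1 (Var 3)) (vst [encode x, encode (?s i), Node (encode ?y) ?y', encode (?s (Suc i))])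
          (1 + ?M x) (vst [encode x, encode (?s (Suc i)), Node (encode ?y) ?y', encode (?s (Suc i))])"
        by (rule runs_vAssign) (use le dm in simp_all)
      have 4: "runs (Assign 3 LeafE) (vst [encode x, encode (?s (Suc i)), Node (encode ?y) ?y', encode (?s (Suc i))])
          2 (vst [encode x, encode (?s (Suc i)), Node (encode ?y) ?y', Leaf])"
        by (rule runs_vAssign) simp_all
      have 5: "runs (Assign 2 (RightE (Var 2))) (vst [encode x, encode (?s (Suc i)), Node (encode ?y) ?y', Leaf])
          (1 + 2 * ?M x) (vst [encode x, encode (?s (Suc i)), ?y', Leaf])"
        by (rule runs_vAssign) (use le dm in simp_all)
      have "runs ?B (vst [encode x, encode (?s i), Node (encode ?y) ?y', Leaf]) (?C x)
          (vst [encode x, encode (?s (Suc i)), ?y', Leaf])"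
        by (rule runs_Seq[OF 1 runs_Seq[OF 2 runs_Seq[OF 3 runs_Seq[OF 4 5]]]])
      then have body: "runs ?B (?v i) (?C x) (?v (Suc i))" unfolding d .
      have "k = length (l x) - Suc i" "Suc i \<le> length (l x)" using Suc i by auto
      from Suc(1)[OF this] obtain d0 d2 d3 where IH: "runs (While (Var 2) ?B) (?v (Suc i))
          ((length (l x) - Suc i) * (1 + ?M x + ?C x) + 2) (vst [d0, encode (?s (length (l x))), d2, d3])"
        by blast
      have ne: "eval_expr (Var 2) (?v i) \<noteq> Leaf" using d by simp
      have cost: "expr_cost (Var 2) (?v i) \<le> ?M x" using dm d by simp
      have "length (l x) - i = Suc (length (l x) - Suc i)" using i by simp
      then have "1 + expr_cost (Var 2) (?v i) + ?C x + ((length (l x) - Suc i) * (1 + ?M x + ?C x) + 2)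
          \<le> (length (l x) - i) * (1 + ?M x + ?C x) + 2" using cost by simp
      from runs_mono[OF runs_WhileTrue[OF ne body IH] this] show ?case by blast
    qed
    obtain d0 d2 d3 where loop0: "runs (While (Var 2) ?B) (?v 0) (length (l x) * (1 + ?M x + ?C x) + 2)
        (vst [d0, encode (?s (length (l x))), d2, d3])" using loop[of 0] by auto
    have loop1: "runs (While (Var 2) ?B) (vst [encode x, encode (init x), encode (l x), Leaf]) (?W x)
        (vst [d0, encode (?s (length (l x))), d2, d3])"
      using runs_mono[OF loop0, of "?W x"] length_le_dsize[of "l x"] by simp
    let ?t = "encode (x, (init x, l x))"
    have t: "vst [?t] = vst [?t, Leaf, Leaf, Leaf]"
      using vst_Leaf[of "[?t]"] vst_Leaf[of "[?t, Leaf]"] vst_Leaf[of "[?t, Leaf, Leaf]"] by simp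
    have le: "dsize (encode (init x)) \<le> S x" using S(2)[of 0 x] by simp
    have le': "dsize (encode (?s (length (l x)))) \<le> S x" using S(2)[of "length (l x)" x] by simp
    have 1: "runs (Assign 1 (LeftE (RightE (Var 0)))) (vst [?t, Leaf, Leaf, Leaf]) (5 * ?M x)
        (vst [?t, encode (init x), Leaf, Leaf])"
      by (rule runs_vAssign) (use le in simp_all)
    have 2: "runs (Assign 2 (RightE (RightE (Var 0)))) (vst [?t, encode (init x), Leaf, Leaf]) (5 * ?M x)
        (vst [?t, encode (init x), encode (l x), Leaf])"
      by (rule runs_vAssign) (use le in simp_all)
    have 3: "runs (Assign 0 (LeftE (Var 0))) (vst [?t, encode (init x), encode (l x), Leaf]) (5 * ?M x)
        (vst [encode x, encode (init x), encode (l x), Leaf])"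
      by (rule runs_vAssign) (use le in simp_all)
    have 4: "runs (Assign 0 (Var 1)) (vst [d0, encode (?s (length (l x))), d2, d3]) (1 + ?M x)
        (vst [encode (?s (length (l x))), encode (?s (length (l x))), d2, d3])"
      by (rule runs_vAssign) (use le' in simp_all)
    have "runs ?P (inp (encode x)) (?T x) (vst [encode (?s (length (l x))), encode (?s (length (l x))), d2, d3])"
      by (rule runs_Seq[OF q[of x, unfolded inp_vst[of ?t] t]
            runs_Seq[OF 1 runs_Seq[OF 2 runs_Seq[OF 3 runs_Seq[OF loop1 4]]]]])
    then show "\<exists>s'. runs ?P (inp (encode x)) (?T x) s' \<and> s' 0 = encode (foldl (step x) (init x) (l x))"
      by (intro exI[of _ "vst [encode (?s (length (l x))), encode (?s (length (l x))), d2, d3]"]) simp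
  qed
qed

subsection \<open>A library of polynomial-time functions\<close>

named_theorems pt_intros

text \<open>Programs see trees, not types: a function with the same output trees is computed by the
  same program.\<close>

lemma pt_cast: "pt f \<Longrightarrow> (\<And>x. encode (g x) = encode (f x)) \<Longrightarrow> pt g"
  unfolding pt_def by simp

lemma pt_eqI: "pt f \<Longrightarrow> (\<And>x. g x = f x) \<Longrightarrow> pt g"
  unfolding pt_def by simp

lemma pt_id [pt_intros]: "pt (\<lambda>x. x)"
  by (rule pt_expr[where e = "Var 0"]) simp

fun data_expr :: "data \<Rightarrow> expr" where
  "data_expr Leaf = LeafE"
| "data_expr (Node a b) = NodeE (data_expr a) (data_expr b)"

lemma eval_data_expr: "eval_expr (data_expr d) s = d"
  by (induction d) auto

lemma pt_const [pt_intros]: "pt (\<lambda>x. c)"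
  by (rule pt_expr[where e = "data_expr (encode c)"]) (rule eval_data_expr)

declare pt_pair [pt_intros] pt_if [pt_intros]

lemma pt_fst [pt_intros]: "pt f \<Longrightarrow> pt (\<lambda>x. fst (f x))"
  by (rule pt_comp[where g = fst], rule pt_expr[where e = "LeftE (Var 0)"]) (auto simp: encode_prod_def)

lemma pt_snd [pt_intros]: "pt f \<Longrightarrow> pt (\<lambda>x. snd (f x))"
  by (rule pt_comp[where g = snd], rule pt_expr[where e = "RightE (Var 0)"]) (auto simp: encode_prod_def)

lemma pt_Cons [pt_intros]: "pt f \<Longrightarrow> pt g \<Longrightarrow> pt (\<lambda>x. f x # g x)"
  by (rule pt_cast[OF pt_pair]) auto

lemma pt_tl [pt_intros]: "pt f \<Longrightarrow> pt (\<lambda>x. tl (f x))"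
proof (rule pt_comp[where g = tl], rule pt_expr[where e = "RightE (Var 0)"])
  fix xs :: "'b list"
  show "eval_expr (RightE (Var 0)) (inp (encode xs)) = encode (tl xs)" by (cases xs) auto
qed

lemma pt_Suc [pt_intros]: "pt f \<Longrightarrow> pt (\<lambda>x. Suc (f x))"
  by (rule pt_comp[where g = Suc], rule pt_expr[where e = "NodeE LeafE (Var 0)"]) auto

text \<open>\<open>right Leaf = Leaf\<close> agrees with \<open>0 - 1 = 0\<close>.\<close>

lemma pt_pred: "pt f \<Longrightarrow> pt (\<lambda>x. f x - (1::nat))"
proof (rule pt_comp[where g = "\<lambda>n. n - 1"], rule pt_expr[where e = "RightE (Var 0)"])
  fix n :: nat
  show "eval_expr (RightE (Var 0)) (inp (encode n)) = encode (n - 1)" by (cases n) auto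
qed

lemma pt_Not [pt_intros]:
  assumes "pt b"
  shows "pt (\<lambda>x. \<not> b x)"
proof -
  have "pt (\<lambda>x. if b x then False else True)" by (intro pt_intros assms)
  then show ?thesis by (rule pt_eqI) auto
qed

lemma pt_conj [pt_intros]:
  assumes "pt b" "pt c"
  shows "pt (\<lambda>x. b x \<and> c x)"
proof -
  have "pt (\<lambda>x. if b x then c x else False)" by (intro pt_intros assms)
  then show ?thesis by (rule pt_eqI) auto
qed

lemma pt_disj [pt_intros]:
  assumes "pt b" "pt c"
  shows "pt (\<lambda>x. b x \<or> c x)"
proof -
  have "pt (\<lambda>x. \<not> (\<not> b x \<and> \<not> c x))" by (intro pt_intros assms)
  then show ?thesis by (rule pt_eqI) auto
qed

lemma pt_null [pt_intros]:
  assumes "pt l"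
  shows "pt (\<lambda>x. l x = [])"
proof -
  have *: "foldl (\<lambda>s y. False) b xs \<longleftrightarrow> b \<and> xs = []" for b and xs :: "'b list"
    by (induction xs arbitrary: b) auto
  have "pt (\<lambda>x. foldl (\<lambda>s y. False) True (l x))"
    by (rule pt_foldl[where S = "\<lambda>x. 3"]) (auto intro!: pt_intros pbd_intros assms simp: encode_bool_def)
  then show ?thesis by (simp add: *)
qed

lemma dsize_take: "dsize (encode (take i xs)) \<le> dsize (encode xs)"
proof (induction xs arbitrary: i)
  case (Cons x xs)
  show ?case using Cons.IH[of "i - 1"] by (cases i) auto
qed simp

lemma dsize_append: "dsize (encode (xs @ ys)) + 1 = dsize (encode xs) + dsize (encode ys)"
  by (induction xs) auto

lemma dsize_rev: "dsize (encode (rev xs)) = dsize (encode xs)"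
  by (simp add: dsize_list rev_map[symmetric] sum_list_rev)

lemma pt_rev_append:
  assumes "pt f" "pt l"
  shows "pt (\<lambda>x. rev (l x) @ f x)"
proof -
  have *: "foldl (\<lambda>s y. y # s) ys xs = rev xs @ ys" for xs ys :: "'b list"
    by (induction xs arbitrary: ys) auto
  have "pt (\<lambda>x. foldl (\<lambda>s y. y # s) (f x) (l x))"
  proof (rule pt_foldl[where S = "\<lambda>x. dsize (encode (f x)) + dsize (encode (l x))"])
    fix x i
    show "dsize (encode (foldl (\<lambda>s y. y # s) (f x) (take i (l x)))) \<le> dsize (encode (f x)) + dsize (encode (l x))"
      using dsize_append[of "rev (take i (l x))" "f x"] dsize_take[of i "l x"]
      by (simp add: * dsize_rev)
  qed (intro pt_intros pbd_intros pt_pbd assms)+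
  then show ?thesis by (simp add: *)
qed

lemma pt_rev [pt_intros]: "pt l \<Longrightarrow> pt (\<lambda>x. rev (l x))"
  using pt_rev_append[OF pt_const[of "[]"]] by simp

lemma pt_append [pt_intros]: "pt f \<Longrightarrow> pt g \<Longrightarrow> pt (\<lambda>x. f x @ g x)"
  using pt_rev_append[OF _ pt_rev, of g f] by simp

text \<open>A fold that conses the images in reverse order. The state stays small because it has at
  most as many entries as the list, each of polynomial size.\<close>

lemma pt_map [pt_intros]:
  assumes "pt (\<lambda>p. f (fst p) (snd p))" "pt l"
  shows "pt (\<lambda>x. map (f x) (l x))"
proof -
  obtain a d where ad: "\<And>p. dsize (encode (f (fst p) (snd p))) \<le> a * dsize (encode p) ^ d"
    using pt_pbd[OF assms(1)] unfolding pbd_def by blast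
  let ?F = "\<lambda>x. a * (1 + dsize (encode x) + dsize (encode (l x))) ^ d"
  have *: "foldl (\<lambda>s y. f x y # s) ys xs = rev (map (f x) xs) @ ys" for x xs ys
    by (induction xs arbitrary: ys) auto
  have "pt (\<lambda>x. foldl (\<lambda>s y. f x y # s) [] (l x))"
  proof (rule pt_foldl[where S = "\<lambda>x. 1 + dsize (encode (l x)) * (?F x + 1)"])
    fix x i
    have "dsize (encode (f x y)) + 1 \<le> ?F x + 1" if "y \<in> set (l x)" for y
    proof -
      have "dsize (encode (x, y)) \<le> 1 + dsize (encode x) + dsize (encode (l x))"
        using dsize_list_elem[OF that] by simp
      then have "a * dsize (encode (x, y)) ^ d \<le> ?F x" by (intro mult_le_mono2 power_mono) auto
      then show ?thesis using ad[of "(x, y)"] unfolding fst_conv snd_conv by (meson add_le_mono1 order_trans)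
    qed
    then have "(\<Sum>y\<leftarrow>take i (l x). dsize (encode (f x y)) + 1) \<le> (\<Sum>y\<leftarrow>take i (l x). ?F x + 1)"
      by (intro sum_list_mono) (meson in_set_takeD)
    also have "\<dots> = length (take i (l x)) * (?F x + 1)" by (simp only: sum_list_const_mult[symmetric] sum_list_triv of_nat_id)
    also have "\<dots> \<le> dsize (encode (l x)) * (?F x + 1)"
      by (rule mult_le_mono1) (use length_le_dsize[of "l x"] in simp)
    finally show "dsize (encode (foldl (\<lambda>s y. f x y # s) [] (take i (l x)))) \<le> 1 + dsize (encode (l x)) * (?F x + 1)"
      by (simp add: * dsize_rev) (simp add: dsize_list comp_def)
  \<comment> \<open>The fold step receives \<open>(x, (state, y))\<close>, whereas \<open>f\<close>
    expects \<open>(x, y)\<close>.\<close>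
  qed (intro pt_intros pbd_intros pt_pbd assms pt_comp[OF assms(1), where f = "\<lambda>p. (fst p, snd (snd p))", simplified])+
  then have "pt (\<lambda>x. rev (foldl (\<lambda>s y. f x y # s) [] (l x)))" by (rule pt_rev)
  then show ?thesis by (simp add: *)
qed

lemma pt_concat [pt_intros]:
  assumes "pt l"
  shows "pt (\<lambda>x. concat (l x))"
proof -
  have *: "foldl (@) ys xs = ys @ concat xs" for xs and ys :: "'b list"
    by (induction xs arbitrary: ys) auto
  have "pt (\<lambda>x. foldl (@) [] (l x))"
  proof (rule pt_foldl[where S = "\<lambda>x. dsize (encode (l x))"])
    fix x i
    have "dsize (encode (concat xs)) \<le> dsize (encode xs)" for xs :: "'b list list"
    proof (induction xs)
      case (Cons ys xs)
      then show ?case using dsize_append[of ys "concat xs"] by simp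
    qed simp
    then have "dsize (encode (concat (take i (l x)))) \<le> dsize (encode (take i (l x)))" .
    also have "\<dots> \<le> dsize (encode (l x))" by (rule dsize_take)
    finally show "dsize (encode (foldl (@) [] (take i (l x)))) \<le> dsize (encode (l x))" by (simp add: *)
  qed (intro pt_intros pbd_intros pt_pbd assms)+
  then show ?thesis by (simp add: *)
qed

lemma pt_filter [pt_intros]:
  assumes "pt (\<lambda>p. P (fst p) (snd p))" "pt l"
  shows "pt (\<lambda>x. filter (P x) (l x))"
proof -
  have *: "filter Q xs = concat (map (\<lambda>y. if Q y then [y] else []) xs)" for Q and xs :: "'b list"
    by (induction xs) auto
  show ?thesis unfolding * by (intro pt_intros assms)
qed

lemma pt_list_ex [pt_intros]:
  assumes "pt (\<lambda>p. P (fst p) (snd p))" "pt l"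
  shows "pt (\<lambda>x. list_ex (P x) (l x))"
proof -
  have *: "list_ex Q xs \<longleftrightarrow> filter Q xs \<noteq> []" for Q and xs :: "'b list"
    by (induction xs) auto
  show ?thesis unfolding * by (intro pt_intros assms)
qed

lemma pt_list_all [pt_intros]:
  assumes "pt (\<lambda>p. P (fst p) (snd p))" "pt l"
  shows "pt (\<lambda>x. list_all (P x) (l x))"
proof -
  have *: "list_all Q xs \<longleftrightarrow> filter (\<lambda>x. \<not> Q x) xs = []" for Q and xs :: "'b list"
    by (induction xs) auto
  show ?thesis unfolding * by (intro pt_intros assms)
qed

text \<open>Has a known value on the empty list too, which a program can produce;
  \<open>nth_or\<close> serves the same purpose for indexing.\<close>

definition hd_or :: "'a \<Rightarrow> 'a list \<Rightarrow> 'a" where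
  "hd_or d xs = (case xs of [] \<Rightarrow> d | x # _ \<Rightarrow> x)"

lemma pt_hd_or [pt_intros]:
  assumes "pt d" "pt l"
  shows "pt (\<lambda>x. hd_or (d x) (l x))"
proof -
  have *: "foldl (\<lambda>s y. y) a xs = (if xs = [] then a else last xs)" for a and xs :: "'b list"
    by (induction xs arbitrary: a) auto
  have "pt (\<lambda>x. foldl (\<lambda>s y. y) (d x) (rev (l x)))"
  proof (rule pt_foldl[where S = "\<lambda>x. dsize (encode (d x)) + dsize (encode (l x))"])
    fix x i
    let ?y = "foldl (\<lambda>s y. y) (d x) (take i (rev (l x)))"
    have "?y = d x \<or> ?y \<in> set (l x)"
      unfolding * by (metis in_set_takeD last_in_set set_rev)
    then show "dsize (encode ?y) \<le> dsize (encode (d x)) + dsize (encode (l x))"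
      using dsize_list_elem by fastforce
  qed (intro pt_intros pbd_intros pt_pbd assms)+
  moreover have "foldl (\<lambda>s y. y) a (rev xs) = hd_or a xs" for a and xs :: "'b list"
    by (cases xs) (simp_all add: * hd_or_def)
  ultimately show ?thesis by simp
qed

text \<open>A unary number and a list of units are the same tree, so arithmetic reduces to list
  operations and counted loops to folds.\<close>

lemma encode_replicate_unit: "encode (replicate n ()) = encode n"
  by (induction n) auto

lemma dsize_nat: "dsize (encode (n::nat)) = 2 * n + 1"
  by (induction n) auto

lemma pbd_nat: "pt f \<Longrightarrow> pbd (\<lambda>x. f x :: nat)"
  by (rule pbd_mono[where g = "\<lambda>x. dsize (encode (f x))"]) (simp_all add: pt_pbd, simp add: dsize_nat)

lemma pt_replicate_unit [pt_intros]: "pt f \<Longrightarrow> pt (\<lambda>x. replicate (f x) ())"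
  by (erule pt_cast) (rule encode_replicate_unit)

lemma pt_length [pt_intros]:
  assumes "pt l"
  shows "pt (\<lambda>x. length (l x))"
proof (rule pt_cast)
  show "pt (\<lambda>x. map (\<lambda>_. ()) (l x))" by (intro pt_intros assms)
  show "encode (length (l x)) = encode (map (\<lambda>_. ()) (l x))" for x
    by (simp add: map_replicate_const encode_replicate_unit)
qed

lemma pt_funpow:
  fixes f :: "'a::encodable \<Rightarrow> 'b::encodable \<Rightarrow> 'b"
  assumes "pt (\<lambda>p. f (fst p) (snd p))" "pt a" "pt n"
    and "pbd S" "\<And>x i. i \<le> n x \<Longrightarrow> dsize (encode ((f x ^^ i) (a x))) \<le> S x"
  shows "pt (\<lambda>x. (f x ^^ n x) (a x))"
proof -
  have *: "foldl (\<lambda>s _. f x s) b (replicate k ()) = (f x ^^ k) b" for x k and b :: 'b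
    by (induction k arbitrary: b) (auto simp: funpow_swap1)
  have "pt (\<lambda>x. foldl (\<lambda>s _. f x s) (a x) (replicate (n x) ()))"
    by (rule pt_foldl[where S = S])
      (auto intro!: pt_intros assms pt_comp[OF assms(1), where f = "\<lambda>p. (fst p, fst (snd p))", simplified] simp: * min_def)
  then show ?thesis by (simp add: *)
qed

lemma pt_diff [pt_intros]:
  assumes "pt f" "pt g"
  shows "pt (\<lambda>x. f x - g x :: nat)"
proof -
  have *: "((\<lambda>m. m - 1) ^^ k) n = n - k" for n k :: nat
    by (induction k arbitrary: n) (auto simp: funpow_swap1)
  have "pt (\<lambda>x. ((\<lambda>m. m - 1) ^^ g x) (f x))"
    by (rule pt_funpow[where S = "\<lambda>x. dsize (encode (f x))"])
      ((intro pt_pred pt_intros pt_pbd assms)+, unfold *, simp add: dsize_nat)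
  then show ?thesis by (simp only: *)
qed

lemma pt_le [pt_intros]:
  assumes "pt f" "pt g"
  shows "pt (\<lambda>x. f x \<le> (g x :: nat))"
proof -
  have "pt (\<lambda>x. replicate (f x - g x) () = [])" by (intro pt_intros assms)
  then show ?thesis by simp
qed

lemma pt_less [pt_intros]: "pt f \<Longrightarrow> pt g \<Longrightarrow> pt (\<lambda>x. f x < (g x :: nat))"
  unfolding less_eq_Suc_le by (intro pt_intros)

lemma pt_eq_nat [pt_intros]: "pt f \<Longrightarrow> pt g \<Longrightarrow> pt (\<lambda>x. f x = (g x :: nat))"
  unfolding eq_iff[where 'a = nat] by (intro pt_intros)

lemma pt_eq_bool [pt_intros]:
  assumes "pt f" "pt g"
  shows "pt (\<lambda>x. f x = (g x :: bool))"
proof -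
  have "pt (\<lambda>x. if f x then g x else \<not> g x)" by (intro pt_intros assms)
  moreover have "(if f x then g x else \<not> g x) \<longleftrightarrow> f x = g x" for x by auto
  ultimately show ?thesis by simp
qed

lemma pt_add [pt_intros]:
  assumes "pt f" "pt g"
  shows "pt (\<lambda>x. f x + g x :: nat)"
proof -
  have "pt (\<lambda>x. length (replicate (f x) () @ replicate (g x) ()))" by (intro pt_intros assms)
  then show ?thesis by simp
qed

lemma pt_sum_list [pt_intros]:
  assumes "pt l"
  shows "pt (\<lambda>x. sum_list (l x) :: nat)"
proof -
  have "pt (\<lambda>x. length (concat (map (\<lambda>n. replicate n ()) (l x))))" by (intro pt_intros assms)
  then show ?thesis by (simp add: length_concat comp_def)
qed

lemma pt_mult [pt_intros]:
  assumes "pt f" "pt g"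
  shows "pt (\<lambda>x. f x * g x :: nat)"
proof -
  have "pt (\<lambda>x. sum_list (map (\<lambda>_. g x) (replicate (f x) ())))"
    by (intro pt_intros assms pt_comp[OF assms(2)])
  then show ?thesis by (simp add: sum_list_replicate)
qed

lemma pt_min [pt_intros]: "pt f \<Longrightarrow> pt g \<Longrightarrow> pt (\<lambda>x. min (f x) (g x :: nat))"
  unfolding min_def by (intro pt_intros)

lemma pt_upt [pt_intros]:
  assumes "pt f"
  shows "pt (\<lambda>x. [0..<f x])"
proof -
  \<comment> \<open>The list is its own counter.\<close>
  have *: "((\<lambda>xs. xs @ [length xs]) ^^ k) [] = [0..<k]" for k
    by (induction k) auto
  have "pt (\<lambda>x. ((\<lambda>xs. xs @ [length xs]) ^^ f x) [])"
  proof (rule pt_funpow[where S = "\<lambda>x. 1 + f x * (2 * f x + 2)"])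
    fix x i assume i: "i \<le> f x"
    have "(\<Sum>k\<leftarrow>[0..<i]. 2 * k + 2) \<le> (\<Sum>k\<leftarrow>[0..<i]. 2 * i + 2)" by (intro sum_list_mono) auto
    also have "\<dots> = i * (2 * i + 2)" by (simp only: sum_list_triv length_upt of_nat_id) simp
    also have "\<dots> \<le> f x * (2 * f x + 2)" using i by (intro mult_le_mono) auto
    finally show "dsize (encode (((\<lambda>xs. xs @ [length xs]) ^^ i) [])) \<le> 1 + f x * (2 * f x + 2)"
      unfolding * dsize_list by (simp add: dsize_nat)
  qed (intro pt_intros pbd_intros pbd_nat assms)+
  then show ?thesis by (simp only: *)
qed

definition nth_or :: "'a \<Rightarrow> 'a list \<Rightarrow> nat \<Rightarrow> 'a" where
  "nth_or d xs n = (if n < length xs then xs ! n else d)"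

lemma pt_nth_or [pt_intros]:
  assumes "pt d" "pt l" "pt n"
  shows "pt (\<lambda>x. nth_or (d x) (l x) (n x))"
proof -
  have *: "(tl ^^ k) xs = drop k xs" for k and xs :: "'b list"
    by (induction k) (auto simp: drop_Suc tl_drop)
  have "pt (\<lambda>x. (tl ^^ n x) (l x))"
    by (rule pt_funpow[where S = "\<lambda>x. dsize (encode (l x))"])
      (unfold *, auto intro!: pt_intros pt_pbd assms dsize_drop)
  then have "pt (\<lambda>x. hd_or (d x) (drop (n x) (l x)))" unfolding * by (intro pt_intros assms)
  moreover have "hd_or a (drop k xs) = nth_or a xs k" for a k and xs :: "'b list"
    by (auto simp: hd_or_def nth_or_def Cons_nth_drop_Suc[symmetric])
  ultimately show ?thesis by simp
qed

text \<open>The quotient counts the positive multiples of \<open>d\<close> up to \<open>n\<close>;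
  on unary numbers this search is polynomial.\<close>

lemma div_eq_length_filter:
  "(n::nat) div d = (if d = 0 then 0 else length (filter (\<lambda>k. Suc k * d \<le> n) [0..<n]))"
proof (cases "d = 0")
  case False
  then have "{k. k < n \<and> Suc k * d \<le> n} = {..<n div d}"
    by (auto simp: less_eq_div_iff_mult_less_eq Suc_le_eq[symmetric])
      (metis False Suc_le_eq bot_nat_0.not_eq_extremum div_le_dividend dual_order.trans less_eq_div_iff_mult_less_eq mult_Suc)
  then show ?thesis using False by (simp add: length_filter_conv_card cong: conj_cong)
qed simp

lemma pt_div [pt_intros]:
  assumes "pt f" "pt g"
  shows "pt (\<lambda>x. f x div g x :: nat)"
  unfolding div_eq_length_filter by (intro pt_intros assms pt_comp[OF assms(1)] pt_comp[OF assms(2)])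

lemma pt_mod [pt_intros]: "pt f \<Longrightarrow> pt g \<Longrightarrow> pt (\<lambda>x. f x mod g x :: nat)"
  unfolding minus_div_mult_eq_mod[symmetric] by (intro pt_intros)

text \<open>A power of two in unary has exponential size. The cap keeps it, and each intermediate
  doubling, below \<open>B\<close>.\<close>

definition bpow :: "nat \<Rightarrow> nat \<Rightarrow> nat" where
  "bpow B k = min B (2 ^ k)"

lemma pt_bpow [pt_intros]:
  assumes "pt f" "pt g"
  shows "pt (\<lambda>x. bpow (f x) (g x))"
proof -
  have *: "((\<lambda>s. min B (2 * s)) ^^ k) (min B 1) = min B (2 ^ k)" for B k :: nat
    by (induction k) (auto simp: min_def)
  have "pt (\<lambda>x. ((\<lambda>s. min (f x) (2 * s)) ^^ g x) (min (f x) 1))"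
    by (rule pt_funpow[where S = "\<lambda>x. dsize (encode (f x))"])
      ((intro pt_intros pt_pbd assms pt_comp[OF assms(1)])+, unfold *, simp add: dsize_nat)
  then show ?thesis by (simp only: * bpow_def)
qed

section \<open>Binary numerals as lists of bits\<close>

fun bin :: "nat \<Rightarrow> bool list" where
  "bin n = (if n = 0 then [] else odd n # bin (n div 2))"

declare bin.simps [simp del]

lemma encode_bin: "encode (bin n) = enc_nat n"
proof (induction n rule: bin.induct)
  case (1 n)
  then show ?case by (subst bin.simps, subst enc_nat.simps) (simp add: encode_bool_def)
qed

text \<open>The bit length plays the role of the rounded binary logarithm throughout.\<close>

lemma length_bin_le_iff: "k < length (bin n) \<longleftrightarrow> 2 ^ k \<le> n"
proof (induction n arbitrary: k rule: bin.induct)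
  case (1 n)
  show ?case
  proof (cases "n = 0")
    case False
    then show ?thesis
      using 1[OF False] by (subst bin.simps) (cases k; auto simp: less_eq_div_iff_mult_less_eq mult.commute)
  qed (simp add: bin.simps)
qed

lemma bin_nth: "k < length (bin n) \<Longrightarrow> bin n ! k = odd (n div 2 ^ k)"
proof (induction n arbitrary: k rule: bin.induct)
  case (1 n)
  show ?case
  proof (cases "n = 0")
    case False
    then have *: "bin n = odd n # bin (n div 2)" by (simp add: bin.simps)
    then show ?thesis
      using 1 False by (cases k) (auto simp: div_mult2_eq)
  qed (use 1 in \<open>simp add: bin.simps\<close>)
qed

lemma bin_inject: "bin m = bin n \<longleftrightarrow> m = n"
proof (induction m arbitrary: n rule: bin.induct)
  case (1 m)
  show ?case
  proof
    assume eq: "bin m = bin n"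
    show "m = n"
    proof (cases "m = 0")
      case True
      then have "bin n = []" using eq by (simp add: bin.simps)
      then show ?thesis using True by (auto simp: bin.simps[of n] split: if_splits)
    next
      case False
      then have "n \<noteq> 0" "odd m = odd n" "bin (m div 2) = bin (n div 2)"
        using eq by (auto simp: bin.simps[of m] bin.simps[of n] split: if_splits)
      then have "m div 2 = n div 2" "m mod 2 = n mod 2" using 1 False by (auto simp: odd_iff_mod_2_eq_one)
      then show ?thesis by (metis div_mult_mod_eq)
    qed
  qed simp
qed

text \<open>Expresses the bits through operations on unary numbers. The cap \<open>Suc n\<close> is
  harmless: a capped power is at most \<open>n\<close> exactly if the true power is, and then they
  agree.\<close>

lemma bin_eq_map: "bin n = map (\<lambda>k. n div bpow (Suc n) k mod 2 = 1) (filter (\<lambda>k. bpow (Suc n) k \<le> n) [0..<n])"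
proof -
  have le: "bpow (Suc n) k \<le> n \<longleftrightarrow> 2 ^ k \<le> n" for k by (auto simp: bpow_def min_def)
  have lt: "length (bin n) \<le> n"
    using length_bin_le_iff[of n n] less_exp[of n] by (meson leD leI)
  have "filter (\<lambda>k. k < length (bin n)) [0..<n] = [0..<length (bin n)]"
  proof -
    have "[0..<n] = [0..<length (bin n)] @ [length (bin n)..<n]" using lt by (metis le0 le_add_diff_inverse upt_add_eq_append)
    then show ?thesis by (simp add: filter_id_conv)
  qed
  then have f: "filter (\<lambda>k. bpow (Suc n) k \<le> n) [0..<n] = [0..<length (bin n)]"
    by (simp add: le length_bin_le_iff)
  show ?thesis unfolding f
    by (rule nth_equalityI) (auto simp: bin_nth odd_iff_mod_2_eq_one bpow_def min_def length_bin_le_iff)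
qed

lemma pt_bin [pt_intros]:
  assumes "pt f"
  shows "pt (\<lambda>x. bin (f x))"
  unfolding bin_eq_map by (intro pt_intros assms pt_comp[OF assms])

lemma pt_eq_bits [pt_intros]:
  assumes "pt f" "pt g"
  shows "pt (\<lambda>x. f x = (g x :: bool list))"
proof -
  have "pt (\<lambda>x. length (f x) = length (g x) \<and>
      list_all (\<lambda>i. nth_or False (f x) i = nth_or False (g x) i) [0..<length (f x)])"
    by (intro pt_intros assms pt_comp[OF assms(1)] pt_comp[OF assms(2)])
  moreover have "(length xs = length ys \<and> list_all (\<lambda>i. nth_or False xs i = nth_or False ys i) [0..<length xs])
      = (xs = ys)" for xs ys :: "bool list"
    unfolding list_eq_iff_nth_eq list_all_iff by (auto simp: nth_or_def)
  ultimately show ?thesis by (simp only:)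
qed

text \<open>Reads the right spine of any tree whatsoever, so decoding never fails on output without
  a guarantee.\<close>

fun dlist :: "data \<Rightarrow> data list" where
  "dlist Leaf = []"
| "dlist (Node a b) = a # dlist b"

lemma encode_dlist: "encode (dlist d) = d"
  by (induction d) (auto simp: encode_data_def)

lemma pt_dlist [pt_intros]: "pt f \<Longrightarrow> pt (\<lambda>x. dlist (f x))"
  by (rule pt_cast) (auto simp: encode_dlist encode_data_def)

lemma pt_right [pt_intros]: "pt f \<Longrightarrow> pt (\<lambda>x. right (f x))"
  by (rule pt_comp[where g = right], rule pt_expr[where e = "RightE (Var 0)"]) (auto simp: encode_data_def)

definition bits :: "data \<Rightarrow> bool list" where
  "bits d = map (\<lambda>x. dlist x \<noteq> []) (dlist d)"

lemma bits_enc_nat: "bits (enc_nat n) = bin n"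
proof -
  have "map (\<lambda>x. dlist x \<noteq> []) (dlist (encode bs)) = bs" for bs :: "bool list"
    by (induction bs) (auto simp: encode_bool_def)
  then show ?thesis unfolding bits_def encode_bin[symmetric] .
qed

lemma pt_bits [pt_intros]: "pt f \<Longrightarrow> pt (\<lambda>x. bits (f x))"
  unfolding bits_def by (intro pt_intros)

section \<open>The gadget hypergraph\<close>

lemma distinct_map_set_concat:
  assumes "distinct xs" "\<And>v. v \<in> set xs \<Longrightarrow> distinct (map set (F v))"
    and "\<And>v w e f. v \<in> set xs \<Longrightarrow> w \<in> set xs \<Longrightarrow> e \<in> set (F v) \<Longrightarrow> f \<in> set (F w) \<Longrightarrow> set e = set f \<Longrightarrow> v = w"
  shows "distinct (map set (concat (map F xs)))"
  using assms
proof (induction xs)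
  case (Cons x xs)
  have "set e \<noteq> set f" if "e \<in> set (F x)" "f \<in> set (F v)" "v \<in> set xs" for e f v
    using Cons.prems(3)[of x v e f] that Cons.prems(1) by auto
  then have "set (map set (F x)) \<inter> set (map set (concat (map F xs))) = {}" by fastforce
  moreover have "distinct (map set (concat (map F xs)))"
    by (rule Cons.IH) (use Cons.prems in \<open>auto intro: Cons.prems(3)\<close>)
  ultimately show ?case using Cons.prems(2)[of x] by simp
qed simp

text \<open>
  Santa Claus players \<open>i < m\<close> and resources \<open>j < r\<close>, where \<open>j\<close> is worth \<open>2 ^ lv i j\<close> to \<open>i\<close>, or
  nothing if \<open>lv i j = 0\<close>. The target value is \<open>2 ^ s\<close>, and a resource is of class \<open>k\<close> if it is worth
  at least \<open>2 ^ s / 2 ^ k\<close>. Every player selects some \<open>a \<le> M\<close> and asks for \<open>2 ^ a / 2 ^ g\<close> blocks of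
  value \<open>2 ^ s / 2 ^ a\<close>. Every block selects a class \<open>k \<ge> a\<close> and asks for \<open>2 ^ (k - a)\<close> slots,
  each to be filled by a resource of class \<open>k\<close>. Blocks and slots are vertices on both sides: a block
  or slot that is not asked for is matched to its own copy among the resources.

  Block \<open>(i, a, b)\<close> has index \<open>mk i a b\<close> and slot \<open>(x, k, l)\<close> of block \<open>x\<close> has index \<open>mk x k l\<close>.
\<close>

locale gadget =
  fixes m r :: nat and lv :: "nat \<Rightarrow> nat \<Rightarrow> nat" and s g :: nat
begin

text \<open>Since \<open>r < 2 ^ M\<close>, resources worth less than \<open>2 ^ s / 2 ^ M\<close>
  contribute at most half of the target; since \<open>2 ^ M \<le> 2 * r + 1\<close>, counting up to
  \<open>2 ^ M\<close> in unary is affordable. The cap in \<open>B\<close> is therefore never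
  reached and \<open>B = 2 ^ M\<close>.\<close>

definition M :: nat where "M = length (bin r)"
definition B :: nat where "B = bpow (2 * r + 1) M"
definition nb :: nat where "nb = m * Suc M * B"
definition ns :: nat where "ns = nb * Suc M * B"
text \<open>The players are the original players, then blocks from \<open>m\<close>, then slots from
  \<open>m + nb\<close>. The resources follow from \<open>np\<close>: the original resources, block
  copies from \<open>np + r\<close>, slot copies from \<open>np + r + nb\<close>.\<close>

definition np :: nat where "np = m + nb + ns"
definition nr :: nat where "nr = r + nb + ns"
definition hi :: "nat \<Rightarrow> nat" where "hi z = z div (Suc M * B)"
definition mid :: "nat \<Rightarrow> nat" where "mid z = z div B mod Suc M"
definition lo :: "nat \<Rightarrow> nat" where "lo z = z mod B"
definition mk :: "nat \<Rightarrow> nat \<Rightarrow> nat \<Rightarrow> nat" where "mk h a b = (h * Suc M + a) * B + b"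

definition ok :: "nat \<Rightarrow> nat \<Rightarrow> nat \<Rightarrow> bool" where
  "ok i k j \<longleftrightarrow> 0 < lv i j \<and> s \<le> lv i j + k"

text \<open>The subtraction is truncated, so for \<open>a \<le> g\<close> exactly one block is
  demanded, never none.\<close>

definition top_edges :: "nat \<Rightarrow> nat list list" where
  "top_edges i = map (\<lambda>a. i # map (\<lambda>b. np + r + mk i a b) [0..<bpow B (a - g)]) [0..<Suc M]"

definition block_edges :: "nat \<Rightarrow> nat list list" where
  "block_edges x = [m + x, np + r + x] #
     map (\<lambda>k. (m + x) # map (\<lambda>l. np + r + nb + mk x k l) [0..<bpow B (k - mid x)])
       (filter (\<lambda>k. mid x \<le> k) [0..<Suc M])"

definition slot_edges :: "nat \<Rightarrow> nat list list" where
  "slot_edges y = [m + nb + y, np + r + nb + y] #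
     map (\<lambda>j. [m + nb + y, np + j]) (filter (\<lambda>j. ok (hi (hi y)) (mid y) j) [0..<r])"

definition edges_of :: "nat \<Rightarrow> nat list list" where
  "edges_of v = (if v < m then top_edges v else if v < m + nb then block_edges (v - m)
     else slot_edges (v - m - nb))"

definition hg :: hypergraph where
  "hg = (np, nr, concat (map edges_of [0..<np]))"

section \<open>Sizes and index arithmetic of the gadget\<close>

lemma r_less: "r < 2 ^ M"
  using length_bin_le_iff[of M r] by (simp add: M_def)

lemma pow_M_le: "2 ^ M \<le> 2 * r + 1"
proof (cases "M = 0")
  case False
  then have "2 ^ (M - 1) \<le> r" using length_bin_le_iff[of "M - 1" r] by (simp add: M_def)
  then show ?thesis using False by (cases M) auto
qed simp

lemma B_eq: "B = 2 ^ M"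
  using pow_M_le by (simp add: B_def bpow_def)

lemma B_pos: "0 < B"
  by (simp add: B_eq)

lemma bpow_B: "k \<le> M \<Longrightarrow> bpow B k = 2 ^ k"
  by (simp add: B_eq bpow_def)

lemma pow_le_B: "k \<le> M \<Longrightarrow> 2 ^ k \<le> B"
  by (simp add: B_eq)

lemma mk_decode:
  assumes "a \<le> M" "b < B"
  shows "hi (mk h a b) = h" "mid (mk h a b) = a" "lo (mk h a b) = b"
proof -
  have 1: "mk h a b div B = h * Suc M + a" using assms by (simp add: mk_def)
  have "mk h a b div (Suc M * B) = mk h a b div B div Suc M" by (metis div_mult2_eq mult.commute)
  also have "\<dots> = h" unfolding 1 using assms(1) by (simp del: mult_Suc_right)
  finally show "hi (mk h a b) = h" by (simp add: hi_def)
  show "mid (mk h a b) = a" unfolding mid_def 1 using assms(1) by (simp del: mult_Suc_right)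
  show "lo (mk h a b) = b" using assms by (simp add: lo_def mk_def)
qed

lemma mk_hi_mid_lo: "mk (hi z) (mid z) (lo z) = z"
proof -
  have "z div (Suc M * B) = z div B div Suc M" by (metis div_mult2_eq mult.commute)
  then show ?thesis unfolding mk_def hi_def mid_def lo_def
    by (simp del: mult_Suc mult_Suc_right add: mult.commute[of _ "Suc M"])
qed

lemma mk_less:
  assumes "h < n" "a \<le> M" "b < B"
  shows "mk h a b < n * Suc M * B"
proof -
  have "h * Suc M + a < Suc h * Suc M" using assms by simp
  also have "\<dots> \<le> n * Suc M" using assms by (intro mult_le_mono1) simp
  finally have "Suc (h * Suc M + a) * B \<le> n * Suc M * B" by (intro mult_le_mono1) simp
  moreover have "mk h a b < Suc (h * Suc M + a) * B" using assms by (simp add: mk_def)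
  ultimately show ?thesis by simp
qed

lemma mk_less_nb: "i < m \<Longrightarrow> a \<le> M \<Longrightarrow> b < B \<Longrightarrow> mk i a b < nb"
  unfolding nb_def by (rule mk_less)

lemma mk_less_ns: "x < nb \<Longrightarrow> k \<le> M \<Longrightarrow> l < B \<Longrightarrow> mk x k l < ns"
  unfolding ns_def by (rule mk_less)

lemma hi_less: "z < n * Suc M * B \<Longrightarrow> hi z < n"
  unfolding hi_def mult.assoc by (rule less_mult_imp_div_less)

lemma hi_less_m: "x < nb \<Longrightarrow> hi x < m"
  unfolding nb_def by (rule hi_less)

lemma hi_less_nb: "y < ns \<Longrightarrow> hi y < nb"
  unfolding ns_def by (rule hi_less)

lemma mk_inject:
  assumes "a \<le> M" "b < B" "a' \<le> M" "b' < B" "mk h a b = mk h' a' b'"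
  shows "h = h' \<and> a = a' \<and> b = b'"
  using mk_decode[OF assms(1,2), of h] mk_decode[OF assms(3,4), of h'] assms(5) by simp

lemma inj_on_mk: "a \<le> M \<Longrightarrow> L \<le> B \<Longrightarrow> inj_on (\<lambda>b. c + mk h a b) {..<L}"
  by (rule inj_onI) (use mk_inject in fastforce)

lemma player_cases:
  assumes "v < np"
  obtains (top) "v < m" | (block) x where "v = m + x" "x < nb" | (slot) y where "v = m + nb + y" "y < ns"
proof (cases "v < m + nb")
  case True
  then show ?thesis using that(1) that(2)[of "v - m"] by fastforce
next
  case False
  then show ?thesis using that(3)[of "v - m - nb"] assms unfolding np_def by fastforce
qed

lemma edges_of_simps:
  "i < m \<Longrightarrow> edges_of i = top_edges i"
  "x < nb \<Longrightarrow> edges_of (m + x) = block_edges x"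
  "edges_of (m + nb + y) = slot_edges y"
  by (auto simp: edges_of_def)

lemma top_edgesE:
  assumes "e \<in> set (top_edges i)"
  obtains a where "a \<le> M" "e = i # map (\<lambda>b. np + r + mk i a b) [0..<2 ^ (a - g)]"
proof -
  from assms obtain a where a: "a < Suc M" "e = i # map (\<lambda>b. np + r + mk i a b) [0..<bpow B (a - g)]"
    unfolding top_edges_def by (auto simp del: upt_Suc)
  then have "a - g \<le> M" by simp
  then show ?thesis using a that[of a] by (simp add: bpow_B)
qed

lemma block_edgesE:
  assumes "e \<in> set (block_edges x)"
  obtains "e = [m + x, np + r + x]"
  | k where "k \<le> M" "mid x \<le> k" "e = (m + x) # map (\<lambda>l. np + r + nb + mk x k l) [0..<2 ^ (k - mid x)]"
proof -
  from assms consider "e = [m + x, np + r + x]"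
    | k where "k < Suc M" "mid x \<le> k" "e = (m + x) # map (\<lambda>l. np + r + nb + mk x k l) [0..<bpow B (k - mid x)]"
    unfolding block_edges_def by (auto simp del: upt_Suc)
  then show ?thesis
  proof cases
    case (2 k)
    then have "k - mid x \<le> M" by simp
    then show ?thesis using 2 that(2)[of k] by (simp add: bpow_B)
  qed (rule that(1))
qed

lemma slot_edgesE:
  assumes "e \<in> set (slot_edges y)"
  obtains "e = [m + nb + y, np + r + nb + y]"
  | j where "j < r" "ok (hi (hi y)) (mid y) j" "e = [m + nb + y, np + j]"
  using assms unfolding slot_edges_def by auto

lemma pow_diff_le_B: "k \<le> M \<Longrightarrow> 2 ^ (k - a) \<le> B"
  by (rule pow_le_B) simp

text \<open>An edge has its own vertex as its only player vertex, so the edge determines the vertex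
  it belongs to.\<close>

lemma edges_of_shape:
  assumes "v < np" "e \<in> set (edges_of v)"
  shows "\<exists>rs. e = v # rs \<and> distinct rs \<and> set rs \<subseteq> {np..<np + nr}"
  using assms(1)
proof (cases rule: player_cases)
  case top
  then obtain a where a: "a \<le> M" "e = v # map (\<lambda>b. np + r + mk v a b) [0..<2 ^ (a - g)]"
    using assms(2) top_edgesE by (auto simp: edges_of_simps)
  have "mk v a b < nb" if "b < 2 ^ (a - g)" for b
    using mk_less_nb[OF top a(1)] that pow_diff_le_B[OF a(1), of g] by simp
  moreover have "distinct (map (\<lambda>b. np + r + mk v a b) [0..<2 ^ (a - g)])"
    using inj_on_mk[OF a(1) pow_diff_le_B[OF a(1)]] by (simp add: distinct_map atLeast0LessThan)
  ultimately show ?thesis using a(2) by (auto simp: nr_def) (meson trans_less_add1)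
next
  case (block x)
  then have "e \<in> set (block_edges x)" using assms(2) by (simp add: edges_of_simps)
  then show ?thesis
  proof (cases rule: block_edgesE)
    case 1
    then show ?thesis using block by (auto simp: nr_def)
  next
    case (2 k)
    have "mk x k l < ns" if "l < 2 ^ (k - mid x)" for l
      using mk_less_ns[OF block(2) 2(1)] that pow_diff_le_B[OF 2(1), of "mid x"] by simp
    moreover have "distinct (map (\<lambda>l. np + r + nb + mk x k l) [0..<2 ^ (k - mid x)])"
      using inj_on_mk[OF 2(1) pow_diff_le_B[OF 2(1)]] by (simp add: distinct_map atLeast0LessThan)
    ultimately show ?thesis using 2 block by (auto simp: nr_def)
  qed
next
  case (slot y)
  then have "e \<in> set (slot_edges y)" using assms(2) by (simp add: edges_of_simps)
  then show ?thesis using slot by (cases rule: slot_edgesE) (auto simp: nr_def)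
qed

text \<open>A demanding edge contains the copy with offset 0, whose index reveals the selected
  \<open>a\<close> or class. An idle edge contains the own copy of its vertex, which no other edge
  of that vertex does.\<close>

lemma distinct_edges_of:
  assumes "v < np"
  shows "distinct (map set (edges_of v))"
  using assms
proof (cases rule: player_cases)
  case top
  have "inj_on (\<lambda>a. set (v # map (\<lambda>b. np + r + mk v a b) [0..<bpow B (a - g)])) {0..<Suc M}"
  proof (rule inj_onI)
    fix a a' assume a: "a \<in> {0..<Suc M}" "a' \<in> {0..<Suc M}"
      and eq: "set (v # map (\<lambda>b. np + r + mk v a b) [0..<bpow B (a - g)]) =
        set (v # map (\<lambda>b. np + r + mk v a' b) [0..<bpow B (a' - g)])"
    have "np + r + mk v a 0 \<in> set (v # map (\<lambda>b. np + r + mk v a b) [0..<bpow B (a - g)])"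
      using B_pos by (auto simp: bpow_def)
    then obtain b where "b < B" "mk v a 0 = mk v a' b"
      unfolding eq using assms by (auto simp: bpow_def)
    then show "a = a'" using a B_pos mk_inject[of a 0 a' b v v] by auto
  qed
  then show ?thesis
    using top by (simp add: edges_of_simps top_edges_def distinct_map comp_def del: upt_Suc set_simps)
next
  case (block x)
  let ?e = "\<lambda>k. (m + x) # map (\<lambda>l. np + r + nb + mk x k l) [0..<bpow B (k - mid x)]"
  have "inj_on (\<lambda>k. set (?e k)) {0..<Suc M}"
  proof (rule inj_onI)
    fix k k' assume k: "k \<in> {0..<Suc M}" "k' \<in> {0..<Suc M}" and eq: "set (?e k) = set (?e k')"
    have "np + r + nb + mk x k 0 \<in> set (?e k)" using B_pos by (auto simp: bpow_def)
    then obtain l where "l < B" "mk x k 0 = mk x k' l"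
      unfolding eq using block assms by (auto simp: bpow_def)
    then show "k = k'" using k B_pos mk_inject[of k 0 k' l x x] by auto
  qed
  then have "inj_on (\<lambda>k. set (?e k)) {k \<in> {0..<Suc M}. mid x \<le> k}" by (rule inj_on_subset) auto
  moreover have "np + r + x \<notin> set (?e k)" for k using block assms by (auto simp: np_def)
  then have "set [m + x, np + r + x] \<noteq> set (?e k)" for k by (metis list.set_intros)
  ultimately show ?thesis
    using block by (auto simp: edges_of_simps block_edges_def distinct_map comp_def simp del: upt_Suc set_simps)
next
  case (slot y)
  have "inj_on (\<lambda>j. set [m + nb + y, np + j]) A" for A
    by (rule inj_onI) (use slot assms in \<open>auto simp: doubleton_eq_iff\<close>)
  moreover have "set [m + nb + y, np + r + nb + y] \<noteq> set [m + nb + y, np + j]" if "j < r" for j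
    using slot assms that by (auto simp: doubleton_eq_iff)
  ultimately show ?thesis
    using slot by (auto simp: edges_of_simps slot_edges_def distinct_map comp_def simp del: set_simps)
qed

lemma hg_edges_at:
  assumes "E \<in> hg_edges hg" "v \<in> E" "v < np"
  shows "\<exists>e \<in> set (edges_of v). E = set e"
proof -
  obtain w e where w: "w < np" "e \<in> set (edges_of w)" "E = set e"
    using assms(1) by (auto simp: hg_def)
  then obtain rs where "e = w # rs" "set rs \<subseteq> {np..<np + nr}" using edges_of_shape by blast
  then have "v = w" using assms(2,3) w by auto
  then show ?thesis using w by blast
qed

lemma hg_edges_of: "v < np \<Longrightarrow> e \<in> set (edges_of v) \<Longrightarrow> set e \<in> hg_edges hg"
  unfolding hg_def hg_edges.simps set_map set_concat by (intro imageI UN_I[of v]) auto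

lemma hg_instance: "hg_instance hg"
proof -
  have "distinct (map set (concat (map edges_of [0..<np])))"
  proof (rule distinct_map_set_concat)
    fix v w e f assume vw: "v \<in> set [0..<np]" "w \<in> set [0..<np]"
      and ef: "e \<in> set (edges_of v)" "f \<in> set (edges_of w)" "set e = set f"
    obtain rs ts where "e = v # rs" "f = w # ts" "set rs \<subseteq> {np..<np + nr}" "set ts \<subseteq> {np..<np + nr}"
      using edges_of_shape ef vw by (metis atLeastLessThan_iff set_upt)
    then show "v = w" using ef(3) vw by auto
  qed (auto intro: distinct_edges_of)
  moreover have "distinct e \<and> set e \<subseteq> {..<np} \<union> {np..<np + nr} \<and> card (set e \<inter> {..<np}) = 1"
    if ev: "e \<in> set (edges_of v)" "v < np" for e v
  proof -
    obtain rs where rs: "e = v # rs" "distinct rs" "set rs \<subseteq> {np..<np + nr}"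
      using edges_of_shape[OF ev(2,1)] by blast
    then have "set e \<inter> {..<np} = {v}" using ev(2) by auto
    then have "card (set e \<inter> {..<np}) = 1" by simp
    then show ?thesis using rs ev(2) by fastforce
  qed
  ultimately show ?thesis unfolding hg_def hg_instance.simps by auto
qed

end

definition utility :: "(nat \<Rightarrow> nat \<Rightarrow> nat) \<Rightarrow> nat \<Rightarrow> nat \<Rightarrow> real" where
  "utility lv i j = (if lv i j = 0 then 0 else 2 ^ lv i j)"

context gadget
begin

subsection \<open>From matchings to allocations\<close>

text \<open>At least \<open>2 ^ (a - g) / \<alpha>\<close> blocks are received, each receives at
  least \<open>2 ^ (k - a) / \<alpha>\<close> slots, and every received slot holds its own resource
  worth at least \<open>2 ^ s / 2 ^ k\<close>. The set \<open>S\<close> only has to contain the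
  resources held by slots that belong to \<open>i\<close>.\<close>

lemma matching_utility:
  assumes "relaxed_perfect_matching (hg_players hg) (hg_resources hg) (hg_edges hg) \<alpha> C A" and i: "i < m"
    and own: "\<And>j y. j < r \<Longrightarrow> y < ns \<Longrightarrow> np + j \<in> A (m + nb + y) \<Longrightarrow> hi (hi y) = i \<Longrightarrow> j \<in> S"
    and S: "finite S"
  shows "2 ^ s / (2 ^ g * \<alpha>\<^sup>2) \<le> (\<Sum>j\<in>S. utility lv i j)"
proof -
  have P: "hg_players hg = {..<np}" and R: "hg_resources hg = {np..<np + nr}" by (simp_all add: hg_def)
  have \<alpha>: "\<alpha> \<ge> 1" and C: "\<And>v. v < np \<Longrightarrow> C v \<in> hg_edges hg" "\<And>v. v < np \<Longrightarrow> v \<in> C v"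
    and A: "\<And>v. v < np \<Longrightarrow> A v \<subseteq> C v \<inter> {np..<np + nr}"
      "\<And>v. v < np \<Longrightarrow> real (card (C v \<inter> {np..<np + nr})) / \<alpha> \<le> real (card (A v))"
    and disj: "disjoint_family_on A {..<np}"
    using assms(1) unfolding relaxed_perfect_matching_def P R by auto
  have disjA: "v = w" if "z \<in> A v" "z \<in> A w" "v < np" "w < np" for v w z
    using disj that unfolding disjoint_family_on_def by (metis disjoint_iff lessThan_iff)
  have edge: "\<exists>e \<in> set (edges_of v). C v = set e" if "v < np" for v
    using hg_edges_at[OF C(1)[OF that] C(2)[OF that] that] .
  \<comment> \<open>A vertex matched along an edge with a single resource gets that resource, whatever \<open>\<alpha>\<close> is.\<close>
  have single: "A v = {z}" if "C v = {v, z}" "v < np" "np \<le> z" "z < np + nr" for v z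
  proof -
    have e: "C v \<inter> {np..<np + nr} = {z}" using that by auto
    then have "real (card (A v)) > 0" using A(2)[OF that(2)] \<alpha> by (smt (verit) card_1_singleton_iff divide_pos_pos is_singletonI is_singleton_altdef of_nat_1)
    then have "A v \<noteq> {}" by auto
    then show ?thesis using A(1)[OF that(2)] e by auto
  qed
  have i_np: "i < np" using i by (simp add: np_def)
  obtain a where a: "a \<le> M" and Ci: "C i = set (i # map (\<lambda>b. np + r + mk i a b) [0..<2 ^ (a - g)])"
    using edge[OF i_np] i by (auto simp: edges_of_simps elim!: top_edgesE)
  let ?bd = "\<lambda>b. np + r + mk i a b"
  have La: "2 ^ (a - g) \<le> B" by (rule pow_diff_le_B[OF a])
  have x_less: "mk i a b < nb" if "b < 2 ^ (a - g)" for b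
    using mk_less_nb[OF i a, of b] that La by simp
  have CiR: "C i \<inter> {np..<np + nr} = ?bd ` {..<2 ^ (a - g)}"
    unfolding Ci using i_np x_less by (fastforce simp: nr_def)
  define Bs where "Bs = {b. b < 2 ^ (a - g) \<and> ?bd b \<in> A i}"
  have "A i = ?bd ` Bs" using A(1)[OF i_np] unfolding CiR Bs_def by auto
  moreover have inj: "inj_on ?bd {..<2 ^ (a - g)}" by (rule inj_on_mk[OF a La])
  then have "inj_on ?bd Bs" by (rule inj_on_subset) (auto simp: Bs_def)
  ultimately have "card (A i) = card Bs" by (simp add: card_image)
  then have card_Bs: "2 ^ (a - g) / \<alpha> \<le> real (card Bs)"
    using A(2)[OF i_np] unfolding CiR card_image[OF inj] by simp
  have block: "\<exists>k. k \<le> M \<and> a \<le> k \<and> C (m + mk i a b) =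
      set ((m + mk i a b) # map (\<lambda>l. np + r + nb + mk (mk i a b) k l) [0..<2 ^ (k - a)])"
    if b: "b \<in> Bs" for b
  proof -
    let ?x = "mk i a b"
    have x: "?x < nb" "b < B" using x_less b La unfolding Bs_def by auto
    then have v: "m + ?x < np" by (simp add: np_def)
    have mid: "mid ?x = a" using mk_decode(2)[OF a x(2)] .
    obtain e where e: "e \<in> set (block_edges ?x)" "C (m + ?x) = set e"
      using edge[OF v] x by (auto simp: edges_of_simps)
    from e(1) show ?thesis
    proof (cases rule: block_edgesE)
      case 1
      then have "A (m + ?x) = {np + r + ?x}" using single[of "m + ?x" "np + r + ?x"] e v x by (auto simp: nr_def)
      \<comment> \<open>Staying idle would use the copy that \<open>i\<close> already holds, so the
        received block has to select a class. The same argument works for slots below.\<close>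
      then have "i = m + ?x" using disjA[of "np + r + ?x" i "m + ?x"] b i_np v by (auto simp: Bs_def)
      then show ?thesis using i by simp
    qed (use e mid in auto)
  qed
  then obtain \<kappa> where \<kappa>: "\<And>b. b \<in> Bs \<Longrightarrow> \<kappa> b \<le> M" "\<And>b. b \<in> Bs \<Longrightarrow> a \<le> \<kappa> b"
    "\<And>b. b \<in> Bs \<Longrightarrow> C (m + mk i a b) =
      set ((m + mk i a b) # map (\<lambda>l. np + r + nb + mk (mk i a b) (\<kappa> b) l) [0..<2 ^ (\<kappa> b - a)])"
    by metis
  define Ls where "Ls b = {l. l < 2 ^ (\<kappa> b - a) \<and> np + r + nb + mk (mk i a b) (\<kappa> b) l \<in> A (m + mk i a b)}" for b
  let ?y = "\<lambda>b l. mk (mk i a b) (\<kappa> b) l"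
  have Bs: "mk i a b < nb" "b < B" "m + mk i a b < np" if "b \<in> Bs" for b
    using x_less that La unfolding Bs_def np_def by fastforce+
  have y_less: "?y b l < ns" "l < B" if "b \<in> Bs" "l < 2 ^ (\<kappa> b - a)" for b l
    using mk_less_ns[OF Bs(1)[OF that(1)] \<kappa>(1)[OF that(1)], of l] that(2) pow_diff_le_B[OF \<kappa>(1)[OF that(1)], of a]
    by auto
  have card_Ls: "2 ^ (\<kappa> b - a) / \<alpha> \<le> real (card (Ls b))" if b: "b \<in> Bs" for b
  proof -
    let ?sd = "\<lambda>l. np + r + nb + ?y b l"
    have CR: "C (m + mk i a b) \<inter> {np..<np + nr} = ?sd ` {..<2 ^ (\<kappa> b - a)}"
      unfolding \<kappa>(3)[OF b] using Bs(3)[OF b] y_less(1)[OF b] by (fastforce simp: nr_def)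
    have "A (m + mk i a b) = ?sd ` Ls b" using A(1)[OF Bs(3)[OF b]] unfolding CR Ls_def by auto
    moreover have inj: "inj_on ?sd {..<2 ^ (\<kappa> b - a)}"
      by (rule inj_on_mk[OF \<kappa>(1)[OF b] pow_diff_le_B[OF \<kappa>(1)[OF b]]])
    then have "inj_on ?sd (Ls b)" by (rule inj_on_subset) (auto simp: Ls_def)
    ultimately have "card (A (m + mk i a b)) = card (Ls b)" by (simp add: card_image)
    then show ?thesis using A(2)[OF Bs(3)[OF b]] unfolding CR card_image[OF inj] by simp
  qed
  have slot: "\<exists>j. j < r \<and> ok i (\<kappa> b) j \<and> A (m + nb + ?y b l) = {np + j}" if b: "b \<in> Bs" and l: "l \<in> Ls b" for b l
  proof -
    have y: "?y b l < ns" "l < B" using y_less[OF b] l by (auto simp: Ls_def)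
    then have v: "m + nb + ?y b l < np" by (simp add: np_def)
    have dec: "mid (?y b l) = \<kappa> b" "hi (hi (?y b l)) = i"
      using mk_decode[OF \<kappa>(1)[OF b] y(2)] mk_decode[OF a Bs(2)[OF b]] by auto
    obtain e where e: "e \<in> set (slot_edges (?y b l))" "C (m + nb + ?y b l) = set e"
      using edge[OF v] by (auto simp: edges_of_simps)
    from e(1) show ?thesis
    proof (cases rule: slot_edgesE)
      case 1
      then have "A (m + nb + ?y b l) = {np + r + nb + ?y b l}"
        using single[of "m + nb + ?y b l" "np + r + nb + ?y b l"] e v y by (auto simp: nr_def)
      then have "m + mk i a b = m + nb + ?y b l"
        using disjA[of "np + r + nb + ?y b l" "m + mk i a b" "m + nb + ?y b l"] l Bs(3)[OF b] v by (auto simp: Ls_def)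
      then show ?thesis using Bs(1)[OF b] by simp
    next
      case (2 j)
      then have "A (m + nb + ?y b l) = {np + j}" using single[of "m + nb + ?y b l" "np + j"] e v by (auto simp: nr_def)
      then show ?thesis using 2 dec by auto
    qed
  qed
  then have "\<exists>J. \<forall>b\<in>Bs. \<forall>l\<in>Ls b. J b l < r \<and> ok i (\<kappa> b) (J b l) \<and> A (m + nb + ?y b l) = {np + J b l}"
    by (intro exI[of _ "\<lambda>b l. SOME j. j < r \<and> ok i (\<kappa> b) j \<and> A (m + nb + ?y b l) = {np + j}"] ballI) (rule someI_ex)
  then obtain J where J: "\<And>b l. b \<in> Bs \<Longrightarrow> l \<in> Ls b \<Longrightarrow> J b l < r"
    "\<And>b l. b \<in> Bs \<Longrightarrow> l \<in> Ls b \<Longrightarrow> ok i (\<kappa> b) (J b l)"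
    "\<And>b l. b \<in> Bs \<Longrightarrow> l \<in> Ls b \<Longrightarrow> A (m + nb + ?y b l) = {np + J b l}"
    by metis
  have Ls: "?y b l < ns" "l < B" "m + nb + ?y b l < np" if "b \<in> Bs" "l \<in> Ls b" for b l
    using y_less[of b l] that unfolding Ls_def np_def by auto
  have fin: "finite Bs" "\<And>b. finite (Ls b)" by (auto simp: Bs_def Ls_def)
  \<comment> \<open>Equal resources force equal slot vertices by disjointness of \<open>A\<close>;
    decoding the index gives back block and offset.\<close>
  have injJ: "inj_on (\<lambda>(b, l). J b l) (Sigma Bs Ls)"
  proof (rule inj_onI, clarsimp)
    fix b l b' l' assume *: "b \<in> Bs" "l \<in> Ls b" "b' \<in> Bs" "l' \<in> Ls b'" and eq: "J b l = J b' l'"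
    have "m + nb + ?y b l = m + nb + ?y b' l'"
      by (rule disjA[of "np + J b l"]) (use * eq J(3) Ls(3) in auto)
    then have "mk i a b = mk i a b' \<and> l = l'"
      using mk_inject[of "\<kappa> b" l "\<kappa> b'" l'] * \<kappa>(1) Ls(2) by auto
    then show "b = b' \<and> l = l'" using mk_inject[of a b a b'] a Bs(2) * by auto
  qed
  have imJ: "(\<lambda>(b, l). J b l) ` Sigma Bs Ls \<subseteq> S"
  proof clarsimp
    fix b l assume *: "b \<in> Bs" "l \<in> Ls b"
    have "hi (hi (?y b l)) = i"
      using mk_decode(1)[OF \<kappa>(1)[OF *(1)] Ls(2)[OF *]] mk_decode(1)[OF a Bs(2)[OF *(1)]] by simp
    then show "J b l \<in> S" using own[OF J(1)[OF *] Ls(1)[OF *]] J(3)[OF *] by simp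
  qed
  have u: "2 ^ s / 2 ^ \<kappa> b \<le> utility lv i (J b l)" if "b \<in> Bs" "l \<in> Ls b" for b l
  proof -
    have "0 < lv i (J b l)" "s \<le> lv i (J b l) + \<kappa> b" using J(2)[OF that] by (auto simp: ok_def)
    then have "(2::real) ^ s \<le> 2 ^ lv i (J b l) * 2 ^ \<kappa> b"
      unfolding power_add[symmetric] by (intro power_increasing) auto
    then show ?thesis using \<open>0 < lv i (J b l)\<close> by (simp add: utility_def divide_le_eq)
  qed
  have "2 ^ s / (2 ^ g * \<alpha>\<^sup>2) \<le> (2 ^ (a - g) / \<alpha>) * (2 ^ s / (2 ^ a * \<alpha>))"
  proof -
    \<comment> \<open>Only an inequality, because for \<open>a < g\<close> the truncated subtraction
      leaves one block.\<close>
    have "(2::real) ^ a \<le> 2 ^ (a - g) * 2 ^ g" unfolding power_add[symmetric] by (intro power_increasing) auto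
    then have "2 ^ a * (2 ^ s / (2 ^ g * 2 ^ a * \<alpha>\<^sup>2)) \<le> (2 ^ (a - g) * 2 ^ g) * (2 ^ s / (2 ^ g * 2 ^ a * \<alpha>\<^sup>2))"
      using \<alpha> by (intro mult_right_mono) auto
    then show ?thesis using \<alpha> by (simp add: field_simps power2_eq_square)
  qed
  also have "\<dots> \<le> real (card Bs) * (2 ^ s / (2 ^ a * \<alpha>))"
    using card_Bs \<alpha> by (intro mult_right_mono) auto
  also have "\<dots> = (\<Sum>b\<in>Bs. 2 ^ s / (2 ^ a * \<alpha>))" by simp
  also have "\<dots> \<le> (\<Sum>b\<in>Bs. \<Sum>l\<in>Ls b. utility lv i (J b l))"
  proof (rule sum_mono)
    fix b assume b: "b \<in> Bs"
    have "(2::real) ^ \<kappa> b = 2 ^ (\<kappa> b - a) * 2 ^ a" unfolding power_add[symmetric] using \<kappa>(2)[OF b] by simp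
    then have "2 ^ s / (2 ^ a * \<alpha>) = (2 ^ (\<kappa> b - a) / \<alpha>) * (2 ^ s / 2 ^ \<kappa> b)" using \<alpha> by (simp add: field_simps)
    also have "\<dots> \<le> real (card (Ls b)) * (2 ^ s / 2 ^ \<kappa> b)" using card_Ls[OF b] by (intro mult_right_mono) auto
    also have "\<dots> = (\<Sum>l\<in>Ls b. 2 ^ s / 2 ^ \<kappa> b)" by simp
    also have "\<dots> \<le> (\<Sum>l\<in>Ls b. utility lv i (J b l))" using u[OF b] by (intro sum_mono) auto
    finally show "2 ^ s / (2 ^ a * \<alpha>) \<le> (\<Sum>l\<in>Ls b. utility lv i (J b l))" .
  qed
  also have "\<dots> = (\<Sum>p\<in>Sigma Bs Ls. utility lv i ((\<lambda>(b, l). J b l) p))"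
    using fin by (subst sum.Sigma) (auto intro!: sum.cong)
  also have "\<dots> = (\<Sum>j\<in>(\<lambda>(b, l). J b l) ` Sigma Bs Ls. utility lv i j)"
    by (simp add: sum.reindex[OF injJ])
  also have "\<dots> \<le> (\<Sum>j\<in>S. utility lv i j)"
    using imJ S by (intro sum_mono2) (auto simp: utility_def)
  finally show ?thesis .
qed

end

subsection \<open>From allocations to matchings\<close>

text \<open>Greedy: cut a block from any class that still holds a full one. This lowers the quotient
  of that class by exactly one and changes no other.\<close>

lemma disjoint_blocks_exist:
  fixes X :: "nat \<Rightarrow> 'a set"
  assumes "\<And>k. k \<in> {a..M} \<Longrightarrow> finite (X k)" "disjoint_family_on X {a..M}"
    and "L \<le> (\<Sum>k=a..M. card (X k) div 2 ^ (k - a))"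
  shows "\<exists>\<kappa> Y. (\<forall>b<L. \<kappa> b \<in> {a..M} \<and> Y b \<subseteq> X (\<kappa> b) \<and> card (Y b) = 2 ^ (\<kappa> b - a)) \<and>
    disjoint_family_on Y {..<L}"
  using assms
proof (induction L arbitrary: X)
  case 0
  show ?case by (simp add: disjoint_family_on_def)
next
  case (Suc L)
  obtain k where k: "k \<in> {a..M}" "card (X k) div 2 ^ (k - a) \<noteq> 0"
  proof -
    have "(\<Sum>k=a..M. card (X k) div 2 ^ (k - a)) \<noteq> 0" using Suc.prems(3) by linarith
    then show ?thesis using that by (meson sum.neutral)
  qed
  then have "2 ^ (k - a) \<le> card (X k)" by (meson div_less leI)
  then obtain Z where Z: "Z \<subseteq> X k" "card Z = 2 ^ (k - a)" by (meson obtain_subset_with_card_n)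
  let ?X = "X(k := X k - Z)"
  have finZ: "finite Z" using Z Suc.prems(1)[OF k(1)] finite_subset by blast
  have "card (X k - Z) = card (X k) - 2 ^ (k - a)" using Z finZ by (simp add: card_Diff_subset)
  then have "card (X k - Z) div 2 ^ (k - a) + 1 = card (X k) div 2 ^ (k - a)"
    using \<open>2 ^ (k - a) \<le> card (X k)\<close> by (simp add: le_div_geq)
  moreover have "(\<Sum>j=a..M. card (?X j) div 2 ^ (j - a)) =
      card (X k - Z) div 2 ^ (k - a) + (\<Sum>j\<in>{a..M} - {k}. card (X j) div 2 ^ (j - a))"
    using k(1) by (subst sum.remove[of _ k]) auto
  moreover have "(\<Sum>j=a..M. card (X j) div 2 ^ (j - a)) =
      card (X k) div 2 ^ (k - a) + (\<Sum>j\<in>{a..M} - {k}. card (X j) div 2 ^ (j - a))"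
    using k(1) by (subst sum.remove[of _ k]) auto
  ultimately have "L \<le> (\<Sum>j=a..M. card (?X j) div 2 ^ (j - a))" using Suc.prems(3) by linarith
  moreover have "\<And>j. j \<in> {a..M} \<Longrightarrow> finite (?X j)" using Suc.prems(1) by auto
  moreover have sub: "?X j \<subseteq> X j" for j by auto
  have "?X i \<inter> ?X j = {}" if "i \<in> {a..M}" "j \<in> {a..M}" "i \<noteq> j" for i j
    using Suc.prems(2) that sub[of i] sub[of j] unfolding disjoint_family_on_def by blast
  then have "disjoint_family_on ?X {a..M}" unfolding disjoint_family_on_def by blast
  ultimately obtain \<kappa> Y where Y: "\<And>b. b < L \<Longrightarrow> \<kappa> b \<in> {a..M} \<and> Y b \<subseteq> ?X (\<kappa> b) \<and> card (Y b) = 2 ^ (\<kappa> b - a)"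
    and disj: "disjoint_family_on Y {..<L}" using Suc.IH[of ?X] by blast
  have "Y b \<inter> Z = {}" if "b < L" for b
  proof (cases "\<kappa> b = k")
    case True
    then show ?thesis using Y[OF that] by auto
  next
    case False
    then have "X (\<kappa> b) \<inter> X k = {}" using Suc.prems(2) Y[OF that] k(1) unfolding disjoint_family_on_def by blast
    moreover have "Y b \<subseteq> X (\<kappa> b)" using Y[OF that] sub by blast
    ultimately show ?thesis using Z(1) by blast
  qed
  then have YZ: "\<And>b. b < L \<Longrightarrow> Y b \<inter> Z = {}" "\<And>b. b < L \<Longrightarrow> Z \<inter> Y b = {}" by blast+
  have "(Y(L := Z)) i \<inter> (Y(L := Z)) j = {}" if ij: "i \<in> {..<Suc L}" "j \<in> {..<Suc L}" "i \<noteq> j" for i j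
  proof -
    consider "i = L" "j < L" | "j = L" "i < L" | "i < L" "j < L" using ij by (auto simp: less_Suc_eq)
    then show ?thesis
      using YZ disj ij(3) unfolding disjoint_family_on_def by cases auto
  qed
  then have "disjoint_family_on (Y(L := Z)) {..<Suc L}" unfolding disjoint_family_on_def by blast
  moreover have "(\<kappa>(L := k)) b \<in> {a..M} \<and> (Y(L := Z)) b \<subseteq> X ((\<kappa>(L := k)) b) \<and>
      card ((Y(L := Z)) b) = 2 ^ ((\<kappa>(L := k)) b - a)" if "b < Suc L" for b
  proof (cases "b = L")
    case False
    then have "b < L" using that by simp
    then show ?thesis using Y[of b] sub[of "\<kappa> b"] False unfolding fun_upd_other[OF False] by blast
  qed (use Z k(1) in simp)
  ultimately show ?case by blast
qed

lemma real_le_power2: "n \<le> 2 ^ k \<Longrightarrow> real n \<le> 2 ^ k"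
  by (metis of_nat_le_iff of_nat_numeral of_nat_power)

text \<open>At \<open>a = g + tow t\<close> the number of demanded blocks is
  \<open>2 ^ tow t\<close>. A window with that many classes ends just before
  \<open>g + tow (Suc t)\<close>, so consecutive windows tile all classes from \<open>g\<close>
  on.\<close>

fun tow :: "nat \<Rightarrow> nat" where
  "tow 0 = 0"
| "tow (Suc t) = tow t + 2 ^ tow t"

text \<open>If no \<open>a\<close> works, then the classes in the window \<open>[a, a + 2 ^ (a - g))\<close> have total weight at
  most \<open>2 / 2 ^ g\<close>: full blocks of value \<open>1 / 2 ^ a\<close> contribute at most \<open>1 / 2 ^ g\<close>, and
  so do the leftovers of the at most \<open>2 ^ (a - g)\<close> classes. The windows grow like a tower, so
  about log-star many of them cover all classes.\<close>

lemma heavy_window_exists: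
  fixes w :: "nat \<Rightarrow> nat"
  assumes sum: "1 / 2 \<le> (\<Sum>k\<le>M. real (w k) / 2 ^ k)" and G: "4 * G < 2 ^ g" "M < g + tow G"
  shows "\<exists>a\<le>M. 2 ^ (a - g) \<le> (\<Sum>k=a..M. w k div 2 ^ (k - a))"
proof (rule ccontr)
  assume "\<not> ?thesis"
  then have small: "(\<Sum>k=a..M. w k div 2 ^ (k - a)) < 2 ^ (a - g)" if "a \<le> M" for a
    using that by (meson not_le)
  have "(\<Sum>k | k \<le> M \<and> k < g + tow t. real (w k) / 2 ^ k) \<le> real t * (2 / 2 ^ g)" for t
  proof (induction t)
    case 0
    \<comment> \<open>For \<open>a = k < g\<close> a single block is demanded, and one resource of
      class \<open>k\<close> would already be such a block.\<close>
    have "w k = 0" if "k \<le> M" "k < g" for k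
    proof -
      have "w k \<le> (\<Sum>j=k..M. w j div 2 ^ (j - k))"
        using member_le_sum[of k "{k..M}" "\<lambda>j. w j div 2 ^ (j - k)"] that by simp
      then show ?thesis using small[OF that(1)] that(2) by simp
    qed
    then show ?case by simp
  next
    case (Suc t)
    let ?a = "g + tow t"
    let ?K = "{k. k \<le> M \<and> ?a \<le> k \<and> k < g + tow (Suc t)}"
    have finK: "finite ?K" by (rule finite_subset[of _ "{..M}"]) auto
    have "(\<Sum>k\<in>?K. real (w k) / 2 ^ k) \<le> 2 / 2 ^ g"
    proof (cases "?a \<le> M")
      case True
      have "(\<Sum>k\<in>?K. real (w k) / 2 ^ k) \<le> (\<Sum>k\<in>?K. (real (w k div 2 ^ (k - ?a)) + 1) / 2 ^ ?a)"
      proof (rule sum_mono)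
        fix k assume k: "k \<in> ?K"
        \<comment> \<open>Full blocks plus less than one leftover block for this class.\<close>
        have "w k < (w k div 2 ^ (k - ?a) + 1) * 2 ^ (k - ?a)"
          using dividend_less_div_times[of "2 ^ (k - ?a)" "w k"] by simp
        then have "real (w k) \<le> real ((w k div 2 ^ (k - ?a) + 1) * 2 ^ (k - ?a))" by linarith
        then have "real (w k) \<le> (real (w k div 2 ^ (k - ?a)) + 1) * 2 ^ (k - ?a)" by (simp add: algebra_simps)
        moreover have "(2::real) ^ k = 2 ^ ?a * 2 ^ (k - ?a)" unfolding power_add[symmetric] using k by simp
        ultimately show "real (w k) / 2 ^ k \<le> (real (w k div 2 ^ (k - ?a)) + 1) / 2 ^ ?a"
          by (simp add: field_simps)
      qed
      also have "\<dots> = (real (\<Sum>k\<in>?K. w k div 2 ^ (k - ?a)) + real (card ?K)) / 2 ^ ?a"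
        by (simp add: sum_divide_distrib[symmetric] sum.distrib)
      also have "\<dots> \<le> (2 ^ tow t + 2 ^ tow t) / 2 ^ ?a"
      proof (intro divide_right_mono add_mono)
        have "(\<Sum>k\<in>?K. w k div 2 ^ (k - ?a)) \<le> (\<Sum>k=?a..M. w k div 2 ^ (k - ?a))"
          by (rule sum_mono2) auto
        also have "\<dots> \<le> 2 ^ tow t" using small[OF True] by simp
        finally show "real (\<Sum>k\<in>?K. w k div 2 ^ (k - ?a)) \<le> 2 ^ tow t"
          by (rule real_le_power2)
        have "card ?K \<le> card {?a..<g + tow (Suc t)}" by (rule card_mono) auto
        then have "card ?K \<le> 2 ^ tow t" by simp
        then show "real (card ?K) \<le> 2 ^ tow t" by (rule real_le_power2)
      qed simp
      also have "\<dots> = 2 / 2 ^ g" by (simp add: power_add field_simps)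
      finally show ?thesis .
    next
      case False
      then have "?K = {}" by auto
      then have "(\<Sum>k\<in>?K. real (w k) / 2 ^ k) = 0" by (simp only: sum.empty)
      then show ?thesis by simp
    qed
    moreover have "{k. k \<le> M \<and> k < g + tow (Suc t)} = {k. k \<le> M \<and> k < ?a} \<union> ?K" by auto
    then have "(\<Sum>k | k \<le> M \<and> k < g + tow (Suc t). real (w k) / 2 ^ k) =
        (\<Sum>k\<in>{k. k \<le> M \<and> k < ?a} \<union> ?K. real (w k) / 2 ^ k)" by (rule arg_cong)
    moreover have "(\<Sum>k\<in>{k. k \<le> M \<and> k < ?a} \<union> ?K. real (w k) / 2 ^ k) =
        (\<Sum>k | k \<le> M \<and> k < ?a. real (w k) / 2 ^ k) + (\<Sum>k\<in>?K. real (w k) / 2 ^ k)"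
      by (rule sum.union_disjoint) (use finK in auto)
    moreover have "real (Suc t) * (2 / 2 ^ g) = real t * (2 / 2 ^ g) + 2 / 2 ^ g" by (simp only: of_nat_Suc distrib_right mult_1)
    ultimately show ?case using Suc.IH by linarith
  qed
  note windows = this[of G]
  have all: "{k. k \<le> M \<and> k < g + tow G} = {..M}" using G(2) by auto
  \<comment> \<open>Each of the \<open>G\<close> windows holds at most \<open>2 / 2 ^ g\<close>,
    which is less than \<open>1 / 2\<close> in total because \<open>4 * G < 2 ^ g\<close>.\<close>
  have "1 / 2 \<le> real G * (2 / 2 ^ g)" using sum windows unfolding all by linarith
  moreover have "4 * real G < 2 ^ g"
    using G(1) by (metis of_nat_less_iff of_nat_mult of_nat_numeral of_nat_power)
  ultimately show False by (simp add: field_simps)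
qed

context gadget
begin

text \<open>Fewer than \<open>2 ^ M\<close> resources can lie beyond class \<open>M\<close>, each
  worth at most half of \<open>2 ^ s / 2 ^ M\<close>, so at least half of the target remains.
  Truncated subtraction puts any resource worth \<open>2 ^ s\<close> or more into class 0, where it
  alone has weight 1.\<close>

lemma class_weight:
  assumes "T \<subseteq> {..<r}" and val: "2 ^ s \<le> (\<Sum>j\<in>T. utility lv i j)"
  shows "1 / 2 \<le> (\<Sum>k\<le>M. real (card {j \<in> T. 0 < lv i j \<and> s - lv i j = k}) / 2 ^ k)"
proof -
  let ?X = "\<lambda>k. {j \<in> T. 0 < lv i j \<and> s - lv i j = k}"
  have fin: "finite T" using assms(1) finite_subset by blast
  show ?thesis
  proof (cases "\<exists>j\<in>T. 0 < lv i j \<and> s \<le> lv i j")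
    case True
    then have "?X 0 \<noteq> {}" by auto
    then have "1 \<le> real (card (?X 0)) / 2 ^ 0" using fin by (simp add: Suc_le_eq card_gt_0_iff)
    also have "\<dots> \<le> (\<Sum>k\<le>M. real (card (?X k)) / 2 ^ k)"
      by (rule member_le_sum[of 0 "{..M}" "\<lambda>k. real (card (?X k)) / 2 ^ k"]) auto
    finally show ?thesis by simp
  next
    case False
    let ?T = "{j \<in> T. 0 < lv i j}"
    let ?c = "\<lambda>j. s - lv i j"
    let ?V = "\<lambda>j. (2::real) ^ s / 2 ^ ?c j"
    let ?low = "{j \<in> ?T. ?c j \<le> M}" and ?high = "{j \<in> ?T. M < ?c j}"
    have 1: "(\<Sum>j\<in>T. utility lv i j) = (\<Sum>j\<in>?T. ?V j)"
    proof (rule sum.mono_neutral_cong_right)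
      fix j assume "j \<in> ?T"
      then have "lv i j < s" "0 < lv i j" using False by auto
      then show "utility lv i j = ?V j"
        by (simp add: utility_def power_diff)
    qed (use fin in \<open>auto simp: utility_def\<close>)
    have "?T = ?low \<union> ?high" by auto
    then have "(\<Sum>j\<in>?T. ?V j) = (\<Sum>j\<in>?low \<union> ?high. ?V j)" by (rule arg_cong)
    also have "\<dots> = (\<Sum>j\<in>?low. ?V j) + (\<Sum>j\<in>?high. ?V j)"
      by (rule sum.union_disjoint) (use fin in auto)
    finally have 2: "(\<Sum>j\<in>?T. ?V j) = (\<Sum>j\<in>?low. ?V j) + (\<Sum>j\<in>?high. ?V j)" .
    have "(\<Sum>j\<in>?high. ?V j) \<le> (\<Sum>j\<in>?high. 2 ^ s / 2 ^ Suc M)"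
      by (intro sum_mono divide_left_mono power_increasing) auto
    also have "\<dots> = real (card ?high) * (2 ^ s / 2 ^ Suc M)" by simp
    also have "\<dots> \<le> 2 ^ M * (2 ^ s / 2 ^ Suc M)"
    proof (rule mult_right_mono)
      have "card ?high \<le> card {..<r}" using assms(1) by (intro card_mono) auto
      then have "card ?high \<le> 2 ^ M" using r_less by simp
      then show "real (card ?high) \<le> 2 ^ M" by (rule real_le_power2)
    qed simp
    finally have 3: "(\<Sum>j\<in>?high. ?V j) \<le> 2 ^ s * (1 / 2)" by simp
    have "(\<Sum>j\<in>?low. ?V j) = (\<Sum>k\<le>M. \<Sum>j\<in>{j \<in> ?low. ?c j = k}. ?V j)"
      using fin by (intro sum.group[symmetric]) auto
    also have "\<dots> = (\<Sum>k\<le>M. 2 ^ s * (real (card (?X k)) / 2 ^ k))"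
    proof (rule sum.cong)
      fix k assume "k \<in> {..M}"
      then have X: "{j \<in> ?low. ?c j = k} = ?X k" by auto
      have "(\<Sum>j\<in>{j \<in> ?low. ?c j = k}. ?V j) = (\<Sum>j\<in>?X k. 2 ^ s / 2 ^ k)"
        unfolding X by (rule sum.cong) auto
      then show "(\<Sum>j\<in>{j \<in> ?low. ?c j = k}. ?V j) = 2 ^ s * (real (card (?X k)) / 2 ^ k)" by simp
    qed simp
    finally have 4: "(\<Sum>j\<in>?low. ?V j) = 2 ^ s * (\<Sum>k\<le>M. real (card (?X k)) / 2 ^ k)"
      by (simp add: sum_distrib_left)
    have "2 ^ s * (1 / 2) \<le> 2 ^ s * (\<Sum>k\<le>M. real (card (?X k)) / 2 ^ k)"
      using val 1 2 3 4 by linarith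
    then show ?thesis by (simp only: mult_le_cancel_left_pos zero_less_power zero_less_numeral)
  qed
qed

text \<open>A heavy window supplies \<open>a\<close>, the greedy cutting supplies the blocks, and
  \<open>\<psi>\<close> numbers the resources of every block so that they can be handed to its
  slots.\<close>

lemma player_blocks:
  assumes T: "T \<subseteq> {..<r}" and val: "2 ^ s \<le> (\<Sum>j\<in>T. utility lv i j)" and G: "4 * G < 2 ^ g" "M < g + tow G"
  shows "\<exists>a (\<kappa> :: nat \<Rightarrow> nat) (\<psi> :: nat \<Rightarrow> nat \<Rightarrow> nat). a \<le> M \<and>
    (\<forall>b<2 ^ (a - g). a \<le> \<kappa> b \<and> \<kappa> b \<le> M \<and> (\<forall>l<2 ^ (\<kappa> b - a). \<psi> b l \<in> T \<and> ok i (\<kappa> b) (\<psi> b l))) \<and>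
    (\<forall>b<2 ^ (a - g). \<forall>b'<2 ^ (a - g). \<forall>l<2 ^ (\<kappa> b - a). \<forall>l'<2 ^ (\<kappa> b' - a).
      \<psi> b l = \<psi> b' l' \<longrightarrow> b = b' \<and> l = l')"
proof -
  let ?X = "\<lambda>k. {j \<in> T. 0 < lv i j \<and> s - lv i j = k}"
  obtain a where a: "a \<le> M" "2 ^ (a - g) \<le> (\<Sum>k=a..M. card (?X k) div 2 ^ (k - a))"
    using heavy_window_exists[OF class_weight[OF T val] G] by blast
  have "finite T" using T finite_subset by blast
  then have "finite (?X k)" for k by simp
  moreover have "disjoint_family_on ?X {a..M}" by (auto simp: disjoint_family_on_def)
  ultimately have "\<exists>\<kappa> Y. (\<forall>b<(2::nat) ^ (a - g). \<kappa> b \<in> {a..M} \<and> Y b \<subseteq> ?X (\<kappa> b) \<and> card (Y b) = 2 ^ (\<kappa> b - a)) \<and>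
      disjoint_family_on Y {..<2 ^ (a - g)}"
    using a(2) by (intro disjoint_blocks_exist)
  then obtain \<kappa> and Y :: "nat \<Rightarrow> nat set"
    where Y': "\<forall>b<2 ^ (a - g). \<kappa> b \<in> {a..M} \<and> Y b \<subseteq> ?X (\<kappa> b) \<and> card (Y b) = 2 ^ (\<kappa> b - a)"
      and disj: "disjoint_family_on Y {..<2 ^ (a - g)}" by (elim exE conjE)
  from Y' have Y: "\<And>b. b < 2 ^ (a - g) \<Longrightarrow> \<kappa> b \<in> {a..M}"
      "\<And>b. b < 2 ^ (a - g) \<Longrightarrow> Y b \<subseteq> ?X (\<kappa> b)" "\<And>b. b < 2 ^ (a - g) \<Longrightarrow> card (Y b) = 2 ^ (\<kappa> b - a)"
    by simp_all
  have "\<exists>h. bij_betw h {..<(2::nat) ^ (\<kappa> b - a)} (Y b)" if "b < 2 ^ (a - g)" for b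
  proof -
    have "finite (?X (\<kappa> b))" using \<open>finite T\<close> by simp
    then have "finite (Y b)" using Y(2)[OF that] finite_subset by blast
    from ex_bij_betw_nat_finite[OF this] show ?thesis unfolding Y(3)[OF that] atLeast0LessThan .
  qed
  then obtain \<psi> where \<psi>: "\<And>b. b < 2 ^ (a - g) \<Longrightarrow> bij_betw (\<psi> b) {..<(2::nat) ^ (\<kappa> b - a)} (Y b)" by metis
  have mem: "\<psi> b l \<in> Y b" if "b < 2 ^ (a - g)" "l < 2 ^ (\<kappa> b - a)" for b l
    using \<psi>[OF that(1)] that(2) by (auto simp: bij_betw_def)
  have "\<psi> b l \<in> T \<and> ok i (\<kappa> b) (\<psi> b l)" if "b < 2 ^ (a - g)" "l < 2 ^ (\<kappa> b - a)" for b l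
    using mem[OF that] Y(2)[OF that(1)] by (auto simp: ok_def)
  moreover have "b = b' \<and> l = l'" if "b < 2 ^ (a - g)" "b' < 2 ^ (a - g)" "l < 2 ^ (\<kappa> b - a)" "l' < 2 ^ (\<kappa> b' - a)"
    "\<psi> b l = \<psi> b' l'" for b b' l l'
  proof -
    have "b = b'" using mem[OF that(1,3)] mem[OF that(2,4)] disj that(1,2,5)
      unfolding disjoint_family_on_def by (metis IntI empty_iff lessThan_iff)
    then show ?thesis using \<psi>[OF that(1)] that by (auto simp: bij_betw_def inj_on_def)
  qed
  ultimately show ?thesis using a(1) Y(1)
    by (intro exI[of _ a] exI[of _ \<kappa>] exI[of _ \<psi>] conjI allI impI) (auto simp only: atLeastAtMost_iff)
qed

text \<open>Blocks and slots that are asked for become active, all others stay idle. A copy then has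
  one possible taker, its parent if active and its own vertex otherwise; an original resource goes
  to a single slot because the bundles are disjoint and \<open>\<psi>\<close> is injective.\<close>

lemma allocation_matching:
  assumes S: "\<And>i. i < m \<Longrightarrow> S i \<subseteq> {..<r}" "disjoint_family_on S {..<m}"
    and val: "\<And>i. i < m \<Longrightarrow> 2 ^ s \<le> (\<Sum>j\<in>S i. utility lv i j)" and G: "4 * G < 2 ^ g" "M < g + tow G"
  shows "\<exists>C A. relaxed_perfect_matching (hg_players hg) (hg_resources hg) (hg_edges hg) 1 C A"
proof -
  define Q where "Q i a \<kappa> \<psi> \<longleftrightarrow> a \<le> M \<and>
    (\<forall>b<2 ^ (a - g). a \<le> \<kappa> b \<and> \<kappa> b \<le> M \<and> (\<forall>l<2 ^ (\<kappa> b - a). \<psi> b l \<in> S i \<and> ok i (\<kappa> b) (\<psi> b l))) \<and>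
    (\<forall>b<2 ^ (a - g). \<forall>b'<2 ^ (a - g). \<forall>l<2 ^ (\<kappa> b - a). \<forall>l'<2 ^ (\<kappa> b' - a).
      \<psi> b l = \<psi> b' l' \<longrightarrow> b = b' \<and> l = l')" for i a and \<kappa> :: "nat \<Rightarrow> nat" and \<psi> :: "nat \<Rightarrow> nat \<Rightarrow> nat"
  have "\<exists>a \<kappa> \<psi>. Q i a \<kappa> \<psi>" if "i < m" for i
    unfolding Q_def by (rule player_blocks[OF S(1)[OF that] val[OF that] G])
  then obtain a \<kappa> \<psi> where "\<And>i. i < m \<Longrightarrow> Q i (a i) (\<kappa> i) (\<psi> i)" by metis
  then have a: "\<And>i. i < m \<Longrightarrow> a i \<le> M"
    and \<kappa>: "\<And>i b. i < m \<Longrightarrow> b < 2 ^ (a i - g) \<Longrightarrow> a i \<le> \<kappa> i b \<and> \<kappa> i b \<le> M"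
    and \<psi>: "\<And>i b l. i < m \<Longrightarrow> b < 2 ^ (a i - g) \<Longrightarrow> l < 2 ^ (\<kappa> i b - a i) \<Longrightarrow> \<psi> i b l \<in> S i \<and> ok i (\<kappa> i b) (\<psi> i b l)"
    and inj: "\<And>i b b' l l'. i < m \<Longrightarrow> b < 2 ^ (a i - g) \<Longrightarrow> b' < 2 ^ (a i - g) \<Longrightarrow> l < 2 ^ (\<kappa> i b - a i) \<Longrightarrow>
      l' < 2 ^ (\<kappa> i b' - a i) \<Longrightarrow> \<psi> i b l = \<psi> i b' l' \<Longrightarrow> b = b' \<and> l = l'"
    unfolding Q_def by simp_all
  \<comment> \<open>Active blocks carry the \<open>a\<close> selected by their player and an offset
    within its demand; \<open>sact\<close> says the same of slots below active blocks.\<close>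
  define act where "act x \<longleftrightarrow> mid x = a (hi x) \<and> lo x < 2 ^ (a (hi x) - g)" for x
  define kx where "kx x = \<kappa> (hi x) (lo x)" for x
  define sact where "sact y \<longleftrightarrow> act (hi y) \<and> mid y = kx (hi y) \<and> lo y < 2 ^ (kx (hi y) - mid (hi y))" for y
  define item where "item y = \<psi> (hi (hi y)) (lo (hi y)) (lo y)" for y
  define Ed where "Ed v = (if v < m then v # map (\<lambda>b. np + r + mk v (a v) b) [0..<2 ^ (a v - g)]
    else if v < m + nb then
      (if act (v - m) then v # map (\<lambda>l. np + r + nb + mk (v - m) (kx (v - m)) l) [0..<2 ^ (kx (v - m) - mid (v - m))]
       else [v, np + r + (v - m)])
    else (if sact (v - m - nb) then [v, np + item (v - m - nb)] else [v, np + r + nb + (v - m - nb)]))" for v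
  have Ed_top: "Ed i = i # map (\<lambda>b. np + r + mk i (a i) b) [0..<2 ^ (a i - g)]" if "i < m" for i
    using that by (simp add: Ed_def)
  have Ed_block: "Ed (m + x) = (if act x then (m + x) # map (\<lambda>l. np + r + nb + mk x (kx x) l) [0..<2 ^ (kx x - mid x)]
      else [m + x, np + r + x])" if "x < nb" for x
    using that by (simp add: Ed_def)
  have Ed_slot: "Ed (m + nb + y) = (if sact y then [m + nb + y, np + item y] else [m + nb + y, np + r + nb + y])" for y
    by (simp add: Ed_def)
  have kx: "mid x \<le> kx x" "kx x \<le> M" if "x < nb" "act x" for x
    using \<kappa>[of "hi x" "lo x"] hi_less_m[OF that(1)] that(2) by (auto simp: act_def kx_def)
  have item: "item y \<in> S (hi (hi y))" "ok (hi (hi y)) (mid y) (item y)" "item y < r" if "y < ns" "sact y" for y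
  proof -
    have i: "hi (hi y) < m" using hi_less_m[OF hi_less_nb[OF that(1)]] .
    have "item y \<in> S (hi (hi y)) \<and> ok (hi (hi y)) (mid y) (item y)"
      using \<psi>[OF i, of "lo (hi y)" "lo y"] that(2) unfolding sact_def act_def kx_def item_def by auto
    then show "item y \<in> S (hi (hi y))" "ok (hi (hi y)) (mid y) (item y)" "item y < r" using S(1)[OF i] by auto
  qed
  have Ed: "Ed v \<in> set (edges_of v)" if v: "v < np" for v
    using v
  proof (cases rule: player_cases)
    case top
    then show ?thesis using a[OF top] bpow_B[of "a v - g"]
      by (auto simp: Ed_top edges_of_simps top_edges_def simp del: upt_Suc intro!: image_eqI[of _ _ "a v"])
  next
    case (block x)
    show ?thesis
    proof (cases "act x")
      case True
      have "bpow B (kx x - mid x) = 2 ^ (kx x - mid x)" using kx[OF block(2) True] by (simp add: bpow_B)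
      then show ?thesis using block True kx[OF block(2) True]
        by (auto simp: Ed_block edges_of_simps block_edges_def simp del: upt_Suc intro!: image_eqI[of _ _ "kx x"])
    qed (use block in \<open>simp add: Ed_block edges_of_simps block_edges_def\<close>)
  next
    case (slot y)
    then show ?thesis using item[OF slot(2)] by (auto simp: Ed_slot edges_of_simps slot_edges_def)
  qed
  define C where "C v = set (Ed v)" for v
  define A where "A v = set (tl (Ed v))" for v
  have CA: "C v \<in> hg_edges hg" "v \<in> C v" "A v = C v \<inter> {np..<np + nr}" if v: "v < np" for v
  proof -
    obtain rs where rs: "Ed v = v # rs" "set rs \<subseteq> {np..<np + nr}" using edges_of_shape[OF v Ed[OF v]] by blast
    then show "v \<in> C v" "A v = C v \<inter> {np..<np + nr}" using v by (auto simp: C_def A_def)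
    show "C v \<in> hg_edges hg" unfolding C_def using hg_edges_of[OF v Ed[OF v]] .
  qed
  \<comment> \<open>Lists who can hold \<open>z\<close>. The three index ranges are disjoint, so
    comparing two holders reduces to one range at a time.\<close>
  have char: "(\<exists>y<ns. v = m + nb + y \<and> sact y \<and> z = np + item y) \<or>
      (\<exists>x<nb. z = np + r + x \<and> v = (if act x then hi x else m + x)) \<or>
      (\<exists>y<ns. z = np + r + nb + y \<and> v = (if sact y then m + hi y else m + nb + y))"
    if v: "v < np" and z: "z \<in> A v" for v z
    using v
  proof (cases rule: player_cases)
    case top
    then obtain b where b: "b < 2 ^ (a v - g)" "z = np + r + mk v (a v) b"
      using z by (auto simp: A_def Ed_top)
    have "b < B" using b(1) pow_diff_le_B[OF a[OF top], of g] by simp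
    note d = mk_decode[OF a[OF top] this, of v] mk_less_nb[OF top a[OF top] this]
    have "act (mk v (a v) b)" unfolding act_def using d b by simp
    then show ?thesis using d b(2) by auto
  next
    case (block x)
    show ?thesis
    proof (cases "act x")
      case True
      then obtain l where l: "l < 2 ^ (kx x - mid x)" "z = np + r + nb + mk x (kx x) l"
        using z block by (auto simp: A_def Ed_block)
      note k = kx[OF block(2) True]
      have "l < B" using l(1) pow_diff_le_B[OF k(2), of "mid x"] by simp
      note d = mk_decode[OF k(2) this, of x] mk_less_ns[OF block(2) k(2) this]
      have "sact (mk x (kx x) l)" unfolding sact_def using d l True by simp
      then show ?thesis using d l(2) block(1) by auto
    next
      case False
      then show ?thesis using z block by (auto simp: A_def Ed_block)
    qed
  next
    case (slot y)
    then show ?thesis using z by (cases "sact y") (auto simp: A_def Ed_slot)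
  qed
  \<comment> \<open>Disjoint bundles force the same player, \<open>inj\<close> forces the same
    offsets, and being active fixes both middle digits.\<close>
  have inj_item: "y = y'" if "y < ns" "y' < ns" "sact y" "sact y'" "item y = item y'" for y y'
  proof -
    have i: "hi (hi y) < m" "hi (hi y') < m" using hi_less_m[OF hi_less_nb] that by auto
    have "item y \<in> S (hi (hi y)) \<inter> S (hi (hi y'))" using item(1)[OF that(1,3)] item(1)[OF that(2,4)] that(5) by simp
    then have ii: "hi (hi y) = hi (hi y')" using S(2) i unfolding disjoint_family_on_def by blast
    have lo: "lo (hi y) = lo (hi y') \<and> lo y = lo y'"
    proof (rule inj[OF i(1)])
      show "lo (hi y) < 2 ^ (a (hi (hi y)) - g)" "lo y < 2 ^ (\<kappa> (hi (hi y)) (lo (hi y)) - a (hi (hi y)))"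
        using that(3) unfolding sact_def act_def kx_def by auto
      show "lo (hi y') < 2 ^ (a (hi (hi y)) - g)" "lo y' < 2 ^ (\<kappa> (hi (hi y)) (lo (hi y')) - a (hi (hi y)))"
        using that(4) unfolding sact_def act_def kx_def ii by auto
      show "\<psi> (hi (hi y)) (lo (hi y)) (lo y) = \<psi> (hi (hi y)) (lo (hi y')) (lo y')"
        using that(5) unfolding item_def ii .
    qed
    have "mid (hi y) = a (hi (hi y))" "mid (hi y') = a (hi (hi y'))"
      using that(3,4) unfolding sact_def act_def by blast+
    then have "mid (hi y) = mid (hi y')" by (simp only: ii)
    then have hi: "hi y = hi y'" using ii lo by (metis mk_hi_mid_lo)
    have "mid y = kx (hi y)" "mid y' = kx (hi y')" using that(3,4) unfolding sact_def by blast+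
    then have "mid y = mid y'" by (simp only: hi)
    then show ?thesis using hi lo by (metis mk_hi_mid_lo)
  qed
  have "v = w" if vw: "v < np" "w < np" and z: "z \<in> A v" "z \<in> A w" for v w z
    using char[OF vw(1) z(1)]
  proof (elim disjE exE conjE)
    fix y assume y: "y < ns" "v = m + nb + y" "sact y" "z = np + item y"
    have "item y < r" using item(3)[OF y(1,3)] .
    from char[OF vw(2) z(2)] show "v = w"
    proof (elim disjE exE conjE)
      fix y' assume "y' < ns" "w = m + nb + y'" "sact y'" "z = np + item y'"
      then show "v = w" using y inj_item[of y y'] by simp
    qed (use y \<open>item y < r\<close> in linarith)+
  next
    fix x assume x: "x < nb" "z = np + r + x" "v = (if act x then hi x else m + x)"
    from char[OF vw(2) z(2)] show "v = w"
    proof (elim disjE exE conjE)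
      fix y' assume "y' < ns" "w = m + nb + y'" "sact y'" "z = np + item y'"
      then show "v = w" using x item(3)[of y'] by linarith
    next
      fix x' assume "x' < nb" "z = np + r + x'" "w = (if act x' then hi x' else m + x')"
      moreover from this have "x' = x" using x by linarith
      ultimately show "v = w" using x by simp
    qed (use x in linarith)
  next
    fix y assume y: "y < ns" "z = np + r + nb + y" "v = (if sact y then m + hi y else m + nb + y)"
    from char[OF vw(2) z(2)] show "v = w"
    proof (elim disjE exE conjE)
      fix y' assume "y' < ns" "w = m + nb + y'" "sact y'" "z = np + item y'"
      then show "v = w" using y item(3)[of y'] by linarith
    next
      fix y' assume "y' < ns" "z = np + r + nb + y'" "w = (if sact y' then m + hi y' else m + nb + y')"
      moreover from this have "y' = y" using y by linarith
      ultimately show "v = w" using y by simp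
    qed (use y in linarith)
  qed
  then have "disjoint_family_on A {..<np}" unfolding disjoint_family_on_def by blast
  then have "relaxed_perfect_matching (hg_players hg) (hg_resources hg) (hg_edges hg) 1 C A"
    using CA unfolding relaxed_perfect_matching_def by (auto simp: hg_def)
  then show ?thesis by blast
qed

end

subsection \<open>The iterated logarithm\<close>

text \<open>Undoing one logarithm costs one tower step, as
  \<open>2 ^ tow t \<le> tow (Suc t)\<close>. For \<open>x \<le> 0\<close> the logarithm says
  nothing, but the bound is trivial.\<close>

lemma log_star_tower:
  assumes "(log 2 ^^ k) x \<le> 1"
  shows "x \<le> real (tow (Suc k))"
  using assms
proof (induction k arbitrary: x)
  case (Suc k)
  then have IH: "log 2 x \<le> real (tow (Suc k))" by (simp add: funpow_swap1)
  show ?case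
  proof (cases "x > 0")
    case True
    then have "x = 2 powr (log 2 x)" by simp
    also have "\<dots> \<le> 2 powr real (tow (Suc k))" using IH by simp
    also have "\<dots> = 2 ^ tow (Suc k)" by (simp add: powr_realpow del: tow.simps)
    also have "\<dots> \<le> real (tow (Suc (Suc k)))" unfolding tow.simps(2)[of "Suc k"] by (simp del: tow.simps)
    finally show ?thesis .
  next
    case False
    then show ?thesis using of_nat_0_le_iff[of "tow (Suc (Suc k))", where 'a = real] by linarith
  qed
qed simp

text \<open>A logarithm reduces the bound on \<open>x\<close> by at least one, since
  \<open>k + 2 \<le> 2 ^ (k + 1)\<close>. This makes the \<open>LEAST\<close> in
  \<open>log_star\<close> meaningful.\<close>

lemma funpow_log_le_1_exists: "x \<le> real k + 1 \<Longrightarrow> \<exists>j\<le>k. (log 2 ^^ j) x \<le> 1"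
proof (induction k arbitrary: x)
  case 0
  then show ?case by auto
next
  case (Suc k)
  show ?case
  proof (cases "x \<le> 1")
    case False
    have "Suc k < 2 ^ Suc k" by (rule less_exp)
    then have "real k + 2 \<le> 2 ^ Suc k" by (metis Suc_leI add_2_eq_Suc' of_nat_Suc of_nat_add of_nat_le_iff of_nat_numeral of_nat_power)
    then have "x \<le> 2 ^ Suc k" using Suc.prems by simp
    then have "log 2 x \<le> real k + 1" using False by (simp add: log_le_iff powr_realpow[symmetric] powr_add add.commute)
    then obtain j where "j \<le> k" "(log 2 ^^ j) (log 2 x) \<le> 1" using Suc.IH by blast
    then show ?thesis by (intro exI[of _ "Suc j"]) (simp add: funpow_swap1)
  qed (auto intro: exI[of _ 0])
qed

lemma le_tow_log_star: "n \<le> tow (Suc (log_star n))" and log_star_le: "log_star n \<le> n"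
proof -
  obtain k where k: "k \<le> n" "(log 2 ^^ k) (real n) \<le> 1" using funpow_log_le_1_exists[of "real n" n] by auto
  then have "(log 2 ^^ log_star n) (real n) \<le> 1" unfolding log_star_def using LeastI[of "\<lambda>k. (log 2 ^^ k) (real n) \<le> 1" k] by simp
  then show "n \<le> tow (Suc (log_star n))" using log_star_tower by (metis of_nat_le_iff)
  show "log_star n \<le> n" unfolding log_star_def using Least_le[of "\<lambda>k. (log 2 ^^ k) (real n) \<le> 1" k] k by simp
qed

lemma log_star_pos:
  assumes "2 \<le> n"
  shows "1 \<le> log_star n"
proof (rule ccontr)
  assume "\<not> 1 \<le> log_star n"
  then have "log_star n = 0" by simp
  then show False using le_tow_log_star[of n] assms by simp
qed

section \<open>The algorithm\<close>

definition lvl :: "nat list list \<Rightarrow> nat \<Rightarrow> nat \<Rightarrow> nat" where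
  "lvl Lv i j = nth_or 0 (nth_or [] Lv i) j"

text \<open>An element of the input matrix is a pair of a numerator and a denominator. Up to the common factor
  \<open>2 ^ denom_bits X\<close> and a further factor of at most 2, its value is 2 to the power of its level;
  level 0 stands for the value 0.\<close>

definition denom_bits :: "(bool list \<times> bool list) list list \<Rightarrow> nat" where
  "denom_bits X = sum_list (map (\<lambda>row. sum_list (map (\<lambda>e. length (snd e)) row)) X)"

definition levels :: "(bool list \<times> bool list) list list \<Rightarrow> nat list list" where
  "levels X = map (map (\<lambda>e. if fst e = [] then 0 else length (fst e) + denom_bits X - length (snd e))) X"

text \<open>Gives \<open>j\<close> to the player above the first slot whose list contains
  \<open>np + j\<close>, and to player 0 if there is none. Any tree, even a meaningless one, yields
  an assignment of all resources.\<close>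

definition owner_list :: "nat \<Rightarrow> nat \<Rightarrow> data \<Rightarrow> nat list" where
  "owner_list m r out = map (\<lambda>j. hd_or 0 (map (\<lambda>y. gadget.hi r (gadget.hi r y))
     (filter (\<lambda>y. list_ex (\<lambda>d. bits d = bin (gadget.np m r + j))
         (dlist (right (nth_or Leaf (dlist out) (m + gadget.nb m r + y)))))
       [0..<gadget.ns m r]))) [0..<r]"

text \<open>The value in units of \<open>2 ^ s / 2 ^ M\<close>, rounded down and capped at the
  target \<open>B\<close>, so that it can be added in unary.\<close>

definition weight :: "nat \<Rightarrow> nat \<Rightarrow> nat \<Rightarrow> nat" where
  "weight r s v = (if v = 0 \<or> v + gadget.M r < s then 0 else bpow (gadget.B r) (v + gadget.M r - s))"

text \<open>A test whether all bundles reach \<open>2 ^ s\<close>: correct when it accepts, and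
  certain to accept at twice that value.\<close>

definition passes :: "nat list list \<Rightarrow> nat \<Rightarrow> nat \<Rightarrow> nat list \<Rightarrow> bool" where
  "passes Lv r s own \<longleftrightarrow> list_all (\<lambda>i. gadget.B r \<le>
     sum_list (map (\<lambda>j. if nth_or 0 own j = i then weight r s (lvl Lv i j) else 0) [0..<r])) [0..<length Lv]"

text \<open>The sum of all levels bounds each exponent and \<open>2 ^ M\<close> exceeds the number
  of resources, so no bundle reaches \<open>2 ^ (scales Lv r - 1)\<close>.\<close>

definition scales :: "nat list list \<Rightarrow> nat \<Rightarrow> nat" where
  "scales Lv r = Suc (gadget.M r + sum_list (map sum_list Lv))"

text \<open>The range of \<open>g\<close> suffices because the proper \<open>g\<close> satisfies
  \<open>g < 2 ^ g \<le> 8 * (log_star n + 2)\<close> and \<open>log_star n \<le> n\<close>.\<close>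

definition candidates :: "(nat list list \<times> nat \<times> nat \<times> nat \<Rightarrow> data) \<Rightarrow> nat list list \<Rightarrow> nat \<Rightarrow> nat list list" where
  "candidates F Lv r = concat (map (\<lambda>s. map (\<lambda>g. owner_list (length Lv) r (F (Lv, (r, (s, g)))))
     [0..<8 * (length Lv + r + 3)]) [0..<scales Lv r])"

text \<open>Thresholds are tried in descending order, so the head passes the largest threshold that
  any candidate passes; exact values are never compared.\<close>

definition best_owner :: "(nat list list \<times> nat \<times> nat \<times> nat \<Rightarrow> data) \<Rightarrow> nat list list \<Rightarrow> nat \<Rightarrow> nat list" where
  "best_owner F Lv r = hd_or (map (\<lambda>_. 0) [0..<r])
     (concat (map (\<lambda>s. filter (passes Lv r s) (candidates F Lv r)) (rev [0..<scales Lv r])))"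

definition santa_bundles :: "(nat list list \<times> nat \<times> nat \<times> nat \<Rightarrow> data) \<Rightarrow> (bool list \<times> bool list) list list \<Rightarrow> bool list list list" where
  "santa_bundles F X = map (\<lambda>i. map bin (filter (\<lambda>j.
     nth_or 0 (best_owner F (levels X) (length (hd_or [] X))) j = i) [0..<length (hd_or [] X)])) [0..<length X]"

definition hg_of :: "nat list list \<times> nat \<times> nat \<times> nat \<Rightarrow> hypergraph" where
  "hg_of q = gadget.hg (length (fst q)) (fst (snd q)) (lvl (fst q)) (fst (snd (snd q))) (snd (snd (snd q)))"

definition hg_bits :: "nat list list \<times> nat \<times> nat \<times> nat \<Rightarrow> bool list list \<times> bool list list \<times> bool list list list" where
  "hg_bits q = (let m = length (fst q); r = fst (snd q); np = gadget.np m r in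
     (map bin [0..<np], (map (\<lambda>i. bin (np + i)) [0..<gadget.nr m r],
      map (map bin) (concat (map (\<lambda>v. gadget.edges_of m r (lvl (fst q)) (fst (snd (snd q))) (snd (snd (snd q))) v) [0..<np])))))"

subsection \<open>Running time\<close>

lemma pt_lvl [pt_intros]: "pt Lv \<Longrightarrow> pt i \<Longrightarrow> pt j \<Longrightarrow> pt (\<lambda>x. lvl (Lv x) (i x) (j x))"
  unfolding lvl_def by (intro pt_intros)

lemma pt_M [pt_intros]: "pt r \<Longrightarrow> pt (\<lambda>x. gadget.M (r x))"
  unfolding gadget.M_def by (intro pt_intros)

lemma pt_B [pt_intros]: "pt r \<Longrightarrow> pt (\<lambda>x. gadget.B (r x))"
  unfolding gadget.B_def by (intro pt_intros)

lemma pt_nb [pt_intros]: "pt m \<Longrightarrow> pt r \<Longrightarrow> pt (\<lambda>x. gadget.nb (m x) (r x))"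
  unfolding gadget.nb_def by (intro pt_intros)

lemma pt_ns [pt_intros]: "pt m \<Longrightarrow> pt r \<Longrightarrow> pt (\<lambda>x. gadget.ns (m x) (r x))"
  unfolding gadget.ns_def by (intro pt_intros)

lemma pt_np [pt_intros]: "pt m \<Longrightarrow> pt r \<Longrightarrow> pt (\<lambda>x. gadget.np (m x) (r x))"
  unfolding gadget.np_def by (intro pt_intros)

lemma pt_nr [pt_intros]: "pt m \<Longrightarrow> pt r \<Longrightarrow> pt (\<lambda>x. gadget.nr (m x) (r x))"
  unfolding gadget.nr_def by (intro pt_intros)

lemma pt_hi [pt_intros]: "pt r \<Longrightarrow> pt z \<Longrightarrow> pt (\<lambda>x. gadget.hi (r x) (z x))"
  unfolding gadget.hi_def by (intro pt_intros)

lemma pt_mid [pt_intros]: "pt r \<Longrightarrow> pt z \<Longrightarrow> pt (\<lambda>x. gadget.mid (r x) (z x))"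
  unfolding gadget.mid_def by (intro pt_intros)

lemma pt_mk [pt_intros]: "pt r \<Longrightarrow> pt h \<Longrightarrow> pt a \<Longrightarrow> pt b \<Longrightarrow> pt (\<lambda>x. gadget.mk (r x) (h x) (a x) (b x))"
  unfolding gadget.mk_def by (intro pt_intros)

lemma pt_ok [pt_intros]:
  "pt Lv \<Longrightarrow> pt s \<Longrightarrow> pt i \<Longrightarrow> pt k \<Longrightarrow> pt j \<Longrightarrow> pt (\<lambda>x. gadget.ok (lvl (Lv x)) (s x) (i x) (k x) (j x))"
  unfolding gadget.ok_def by (intro pt_intros)

lemma pt_top_edges [pt_intros]:
  assumes "pt m" "pt r" "pt g" "pt i"
  shows "pt (\<lambda>x. gadget.top_edges (m x) (r x) (g x) (i x))"
  unfolding gadget.top_edges_def by (intro pt_intros assms[THEN pt_comp])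

lemma pt_block_edges [pt_intros]:
  assumes "pt m" "pt r" "pt i"
  shows "pt (\<lambda>x. gadget.block_edges (m x) (r x) (i x))"
  unfolding gadget.block_edges_def by (intro pt_intros assms[THEN pt_comp])

lemma pt_slot_edges [pt_intros]:
  assumes "pt m" "pt r" "pt Lv" "pt s" "pt i"
  shows "pt (\<lambda>x. gadget.slot_edges (m x) (r x) (lvl (Lv x)) (s x) (i x))"
  unfolding gadget.slot_edges_def by (intro pt_intros assms[THEN pt_comp])

lemma pt_edges_of [pt_intros]:
  assumes "pt m" "pt r" "pt Lv" "pt s" "pt g" "pt i"
  shows "pt (\<lambda>x. gadget.edges_of (m x) (r x) (lvl (Lv x)) (s x) (g x) (i x))"
  unfolding gadget.edges_of_def by (intro pt_intros assms[THEN pt_comp])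

lemma pt_hg_bits: "pt hg_bits"
  unfolding hg_bits_def Let_def by (intro pt_intros)

lemma pt_owner_list [pt_intros]:
  assumes "pt m" "pt r" "pt out"
  shows "pt (\<lambda>x. owner_list (m x) (r x) (out x))"
  unfolding owner_list_def by (intro pt_intros assms[THEN pt_comp])

lemma pt_weight [pt_intros]: "pt r \<Longrightarrow> pt s \<Longrightarrow> pt v \<Longrightarrow> pt (\<lambda>x. weight (r x) (s x) (v x))"
  unfolding weight_def by (intro pt_intros)

lemma pt_passes [pt_intros]:
  assumes "pt Lv" "pt r" "pt s" "pt own"
  shows "pt (\<lambda>x. passes (Lv x) (r x) (s x) (own x))"
  unfolding passes_def by (intro pt_intros assms[THEN pt_comp])

lemma pt_scales [pt_intros]: "pt Lv \<Longrightarrow> pt r \<Longrightarrow> pt (\<lambda>x. scales (Lv x) (r x))"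
  unfolding scales_def by (intro pt_intros)

lemma pt_candidates [pt_intros]:
  assumes "pt Lv" "pt r" "pt F"
  shows "pt (\<lambda>x. candidates F (Lv x) (r x))"
  unfolding candidates_def by (intro pt_intros assms[THEN pt_comp])

lemma pt_best_owner [pt_intros]:
  assumes "pt Lv" "pt r" "pt F"
  shows "pt (\<lambda>x. best_owner F (Lv x) (r x))"
  unfolding best_owner_def by (intro pt_intros assms[THEN pt_comp] assms(3))

lemma pt_levels [pt_intros]:
  assumes "pt X"
  shows "pt (\<lambda>x. levels (X x))"
  unfolding levels_def denom_bits_def by (intro pt_intros assms[THEN pt_comp])

lemma pt_santa_bundles:
  assumes "pt F"
  shows "pt (santa_bundles F)"
  unfolding santa_bundles_def by (intro pt_intros assms)

text \<open>A solver only satisfies a relation and may leave scratch data behind. \<open>F\<close>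
  is the function of its actual outputs, and \<open>ptI\<close> supplies the clean-up.\<close>

lemma pt_solver:
  fixes h :: "'a::encodable \<Rightarrow> 'b::encodable"
  assumes p: "poly_time_solves p valid enc sol" and h: "pt h"
    and H: "\<And>x. encode (h x) = enc (H x)" "\<And>x. valid (H x)"
  shows "\<exists>F :: 'a \<Rightarrow> data. pt F \<and> (\<forall>x. sol (H x) (F x))"
proof -
  obtain a d where ad: "\<And>y. valid y \<Longrightarrow>
      \<exists>t s'. exec p (inp (enc y)) t s' \<and> t \<le> a * dsize (enc y) ^ d \<and> sol y (s' 0)"
    using p unfolding poly_time_solves_def inp_def by blast
  obtain q T where T: "pbd T" and q: "\<And>x. runs q (inp (encode x)) (T x) (inp (encode (h x)))"
    using ptE[OF h] by blast
  have "\<forall>x. \<exists>s'. runs p (inp (encode (h x))) (a * dsize (encode (h x)) ^ d) s' \<and> sol (H x) (s' 0)"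
    unfolding runs_def H(1) using ad[OF H(2)] by metis
  then obtain s' where s': "\<And>x. runs p (inp (encode (h x))) (a * dsize (encode (h x)) ^ d) (s' x)"
    "\<And>x. sol (H x) (s' x 0)" by metis
  have "pt (\<lambda>x. s' x 0)"
  proof (rule ptI)
    show "pbd (\<lambda>x. T x + a * dsize (encode (h x)) ^ d)" by (intro pbd_intros T pt_pbd h)
    show "\<exists>s''. runs (Seq q p) (inp (encode x)) (T x + a * dsize (encode (h x)) ^ d) s'' \<and> s'' 0 = encode (s' x 0)" for x
      using runs_Seq[OF q s'(1)] by (auto simp: encode_data_def)
  qed
  then show ?thesis using s'(2) by blast
qed

lemma poly_time_solves_pt:
  assumes "pt G" and h: "\<And>x. encode (h x) = enc x" and sol: "\<And>x. valid x \<Longrightarrow> sol x (encode (G (h x)))"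
  shows "\<exists>q. poly_time_solves q valid enc sol"
proof -
  obtain q T where T: "pbd T" and q: "\<And>x. runs q (inp (encode x)) (T x) (inp (encode (G x)))"
    using ptE[OF assms(1)] by blast
  obtain a d where ad: "\<And>x. T x \<le> a * dsize (encode x) ^ d" using T unfolding pbd_def by blast
  have "\<exists>t s'. exec q ((\<lambda>_. Leaf)(0 := enc x)) t s' \<and> t \<le> a * dsize (enc x) ^ d \<and> sol x (s' 0)" if x: "valid x" for x
  proof -
    obtain t where "t \<le> T (h x)" "exec q (inp (encode (h x))) t (inp (encode (G (h x))))"
      using q unfolding runs_def by blast
    moreover have "T (h x) \<le> a * dsize (enc x) ^ d" using ad[of "h x"] h by simp
    moreover have "sol x (inp (encode (G (h x))) 0)" using sol[OF x] by simp
    ultimately show ?thesis unfolding h inp_def by (meson order_trans)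
  qed
  then show ?thesis unfolding poly_time_solves_def by blast
qed

lemma encode_map_bin: "encode (map bin xs) = enc_list enc_nat xs"
  by (induction xs) (simp_all add: encode_bin)

lemma encode_map_map_bin: "encode (map (map bin) xs) = enc_list (enc_list enc_nat) xs"
  by (induction xs) (simp_all add: encode_map_bin)

lemma encode_hg_bits: "encode (hg_bits q) = enc_hypergraph (hg_of q)"
proof -
  have "map (\<lambda>i. bin (n + i)) [0..<k] = map bin [n..<n + k]" for n k
    by (rule nth_equalityI) auto
  then show ?thesis
    by (simp add: hg_bits_def hg_of_def gadget.hg_def Let_def encode_map_bin encode_map_map_bin)
qed

lemma matching_oracle:
  assumes "poly_time_matching_approx c p"
  shows "\<exists>F. pt F \<and> (\<forall>q. matching_solution c (hg_of q) (F q))"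
  using assms unfolding poly_time_matching_approx_def
  by (rule pt_solver[where H = hg_of, OF _ pt_hg_bits encode_hg_bits]) (simp add: hg_of_def gadget.hg_instance)

subsection \<open>Approximation guarantee\<close>

lemma dlist_enc_list: "dlist (enc_list f xs) = map f xs"
  by (induction xs) auto

lemma right_enc_pair: "right (enc_pair f g p) = g (snd p)"
  by (cases p) simp

lemma min_relaxation_eq_1:
  assumes "relaxed_perfect_matching P R E 1 C A"
  shows "min_relaxation P R E = 1"
  unfolding min_relaxation_def
proof (rule cInf_eq_minimum)
  show "1 \<in> {\<alpha>. \<exists>C A. relaxed_perfect_matching P R E \<alpha> C A}" using assms by blast
qed (auto simp: relaxed_perfect_matching_def)

context gadget
begin

lemma length_owner_list: "length (owner_list m r out) = r"
  by (simp add: owner_list_def)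

lemma owner_list_less:
  assumes "0 < m" "j < r"
  shows "owner_list m r out ! j < m"
proof -
  let ?ys = "filter (\<lambda>y. list_ex (\<lambda>d. bits d = bin (np + j)) (dlist (right (nth_or Leaf (dlist out) (m + nb + y))))) [0..<ns]"
  have "owner_list m r out ! j = hd_or 0 (map (\<lambda>y. hi (hi y)) ?ys)"
    using assms(2) by (simp add: owner_list_def)
  moreover have "hi (hi y) < m" if "y \<in> set ?ys" for y
    using that hi_less_m[OF hi_less_nb] by auto
  ultimately show ?thesis using assms(1)
    by (cases ?ys) (auto simp: hd_or_def simp del: filter_eq_Cons_iff)
qed

text \<open>Feasibility with relaxation 1 makes the minimum 1, so the output is a
  \<open>c\<close>-relaxed matching. Its disjointness makes the first slot listing a resource the
  only one.\<close>

lemma owner_list_utility: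
  assumes sol: "matching_solution c hg out" and feas: "relaxed_perfect_matching (hg_players hg) (hg_resources hg) (hg_edges hg) 1 C\<^sub>0 A\<^sub>0"
    and i: "i < m"
  shows "2 ^ s / (2 ^ g * c\<^sup>2) \<le> (\<Sum>j | j < r \<and> owner_list m r out ! j = i. utility lv i j)"
proof -
  obtain L :: "(nat list \<times> nat list) list" where
    out: "out = enc_list (enc_pair (enc_list enc_nat) (enc_list enc_nat)) L" and len: "length L = np"
    and rpm: "relaxed_perfect_matching (hg_players hg) (hg_resources hg) (hg_edges hg) c
        (\<lambda>i. set (fst (L ! i))) (\<lambda>i. set (snd (L ! i)))"
    using sol feas unfolding matching_solution_def min_relaxation_eq_1[OF feas] by (auto simp: hg_def)
  have unique: "y = y'" if "y < ns" "y' < ns" "z \<in> set (snd (L ! (m + nb + y)))" "z \<in> set (snd (L ! (m + nb + y')))" for y y' z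
  proof (rule ccontr)
    assume "y \<noteq> y'"
    moreover have "m + nb + y \<in> {..<np}" "m + nb + y' \<in> {..<np}" using that by (auto simp: np_def)
    moreover have "disjoint_family_on (\<lambda>i. set (snd (L ! i))) {..<np}"
      using rpm unfolding relaxed_perfect_matching_def by (simp add: hg_def)
    ultimately show False using that(3,4) unfolding disjoint_family_on_def by (metis IntI add_left_cancel empty_iff)
  qed
  show ?thesis
  proof (rule matching_utility[OF rpm i])
    fix j y assume j: "j < r" and y: "y < ns" "np + j \<in> set (snd (L ! (m + nb + y)))" "hi (hi y) = i"
    let ?P = "\<lambda>y. list_ex (\<lambda>d. bits d = bin (np + j)) (dlist (right (nth_or Leaf (dlist out) (m + nb + y))))"
    have P: "?P y' \<longleftrightarrow> np + j \<in> set (snd (L ! (m + nb + y')))" if "y' < ns" for y'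
    proof -
      have "m + nb + y' < length L" using that len by (simp add: np_def)
      then have "dlist (right (nth_or Leaf (dlist out) (m + nb + y'))) = map enc_nat (snd (L ! (m + nb + y')))"
        by (simp add: out dlist_enc_list nth_or_def right_enc_pair)
      then show ?thesis by (auto simp: list_ex_iff bits_enc_nat bin_inject)
    qed
    have "set (filter ?P [0..<ns]) = {y}" using P y unique[of _ y] by auto
    then have "filter ?P [0..<ns] \<noteq> []" "hd (filter ?P [0..<ns]) = y"
      by (metis empty_iff list.set(1) singletonI) (metis \<open>set (filter ?P [0..<ns]) = {y}\<close> hd_in_set insert_not_empty list.set(1) singletonD)
    then have "hd_or 0 (map (\<lambda>y. hi (hi y)) (filter ?P [0..<ns])) = i"
      using y(3) unfolding hd_or_def by (metis (no_types, lifting) list.case(2) list.collapse list.simps(9))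
    then show "j \<in> {j. j < r \<and> owner_list m r out ! j = i}" using j by (simp add: owner_list_def)
  qed simp
qed

end

lemma utility_nonneg: "0 \<le> utility lv i j"
  by (simp add: utility_def)

text \<open>Positive levels start at 1. This gap lets natural exponents suffice when values are
  bracketed by powers of two.\<close>

lemma sum_utility_ge_2:
  assumes "0 < (\<Sum>j\<in>T. utility lv i j)"
  shows "2 \<le> (\<Sum>j\<in>T. utility lv i j)"
proof -
  have fin: "finite T" using assms by (metis less_irrefl sum.infinite)
  obtain j where j: "j \<in> T" "utility lv i j \<noteq> 0" using assms by (metis less_irrefl sum.neutral)
  then have "0 < lv i j" by (simp add: utility_def split: if_splits)
  then have "(2::real) ^ 1 \<le> 2 ^ lv i j" by (intro power_increasing) auto
  then have "2 \<le> utility lv i j" using \<open>0 < lv i j\<close> by (simp add: utility_def)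
  also have "\<dots> \<le> (\<Sum>j\<in>T. utility lv i j)" using j(1) fin utility_nonneg by (intro member_le_sum) auto
  finally show ?thesis .
qed

lemma power_bracket:
  assumes "1 \<le> (x::real)"
  obtains k where "2 ^ k \<le> x" "x < 2 ^ Suc k"
proof -
  obtain n where n: "x < 2 ^ n" using real_arch_pow[of 2 x] by auto
  let ?n = "LEAST n. x < 2 ^ n"
  have "x < 2 ^ ?n" using n by (rule LeastI)
  moreover from this have "?n \<noteq> 0" using assms by (metis not_le power_0)
  then obtain k where k: "?n = Suc k" using not0_implies_Suc by blast
  moreover have "\<not> x < 2 ^ k" using not_less_Least[of k "\<lambda>n. x < 2 ^ n"] k by simp
  ultimately show ?thesis using that[of k] by simp
qed

section \<open>Testing candidates against thresholds\<close>

lemma weight_le_utility: "real (weight r s (lv i j)) * 2 ^ s \<le> utility lv i j * 2 ^ gadget.M r"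
proof (cases "lv i j = 0 \<or> lv i j + gadget.M r < s")
  case True
  then show ?thesis by (simp add: weight_def utility_nonneg)
next
  case False
  have "weight r s (lv i j) \<le> 2 ^ (lv i j + gadget.M r - s)" using False by (simp add: weight_def bpow_def)
  then have "real (weight r s (lv i j)) \<le> 2 ^ (lv i j + gadget.M r - s)" by (rule real_le_power2)
  then have "real (weight r s (lv i j)) * 2 ^ s \<le> 2 ^ (lv i j + gadget.M r - s) * 2 ^ s" by simp
  also have "\<dots> = 2 ^ lv i j * 2 ^ gadget.M r" unfolding power_add[symmetric] using False by simp
  finally show ?thesis using False by (simp add: utility_def)
qed

lemma passes_iff:
  assumes "length own = r"
  shows "passes Lv r s own \<longleftrightarrow>
    (\<forall>i<length Lv. gadget.B r \<le> (\<Sum>j | j < r \<and> own ! j = i. weight r s (lvl Lv i j)))"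
proof -
  have "sum_list (map (\<lambda>j. if nth_or 0 own j = i then weight r s (lvl Lv i j) else 0) [0..<r]) =
      (\<Sum>j | j < r \<and> own ! j = i. weight r s (lvl Lv i j))" for i
  proof -
    have "sum_list (map (\<lambda>j. if nth_or 0 own j = i then weight r s (lvl Lv i j) else 0) [0..<r]) =
        (\<Sum>j\<in>{..<r}. if own ! j = i then weight r s (lvl Lv i j) else 0)"
      using assms by (auto simp: interv_sum_list_conv_sum_set_nat nth_or_def atLeast0LessThan intro!: sum.cong)
    also have "\<dots> = (\<Sum>j\<in>{j\<in>{..<r}. own ! j = i}. weight r s (lvl Lv i j))" by (rule sum.inter_filter[symmetric]) simp
    finally show ?thesis by simp
  qed
  then show ?thesis by (auto simp: passes_def list_all_iff)
qed

lemma passes_utility: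
  assumes "passes Lv r s own" "length own = r" "i < length Lv"
  shows "2 ^ s \<le> (\<Sum>j | j < r \<and> own ! j = i. utility (lvl Lv) i j)"
proof -
  let ?S = "{j. j < r \<and> own ! j = i}"
  have "2 ^ gadget.M r \<le> (\<Sum>j\<in>?S. weight r s (lvl Lv i j))"
    using assms passes_iff by (simp add: gadget.B_eq)
  then have "real (2 ^ gadget.M r) \<le> real (\<Sum>j\<in>?S. weight r s (lvl Lv i j))" by (rule of_nat_mono)
  then have "(2::real) ^ gadget.M r \<le> (\<Sum>j\<in>?S. real (weight r s (lvl Lv i j)))" by simp
  then have "2 ^ gadget.M r * 2 ^ s \<le> (\<Sum>j\<in>?S. real (weight r s (lvl Lv i j))) * 2 ^ s" by simp
  also have "\<dots> = (\<Sum>j\<in>?S. real (weight r s (lvl Lv i j)) * 2 ^ s)" by (rule sum_distrib_right)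
  also have "\<dots> \<le> (\<Sum>j\<in>?S. utility (lvl Lv) i j * 2 ^ gadget.M r)" by (intro sum_mono weight_le_utility)
  also have "\<dots> = 2 ^ gadget.M r * (\<Sum>j\<in>?S. utility (lvl Lv) i j)" by (simp add: sum_distrib_right[symmetric])
  finally show ?thesis by simp
qed

text \<open>Rounding down loses at most \<open>2 ^ s / 2 ^ M\<close> per resource, hence at most
  \<open>2 ^ s\<close> in total, half of the assumed value. The cap matters only if some resource is
  worth \<open>2 ^ s\<close> or more, and that one alone passes the test.\<close>

lemma utility_passes:
  assumes val: "\<And>i. i < length Lv \<Longrightarrow> 2 ^ Suc s \<le> (\<Sum>j | j < r \<and> own ! j = i. utility (lvl Lv) i j)"
    and len: "length own = r"
  shows "passes Lv r s own"
  unfolding passes_iff[OF len]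
proof (intro allI impI)
  fix i assume i: "i < length Lv"
  let ?S = "{j. j < r \<and> own ! j = i}" and ?M = "gadget.M r" and ?w = "\<lambda>j. weight r s (lvl Lv i j)"
  show "gadget.B r \<le> (\<Sum>j\<in>?S. ?w j)"
  proof (cases "\<exists>j\<in>?S. lvl Lv i j \<noteq> 0 \<and> s \<le> lvl Lv i j")
    case True
    then obtain j where j: "j \<in> ?S" "lvl Lv i j \<noteq> 0" "s \<le> lvl Lv i j" by blast
    have "(2::nat) ^ ?M \<le> 2 ^ (lvl Lv i j + ?M - s)" using j(3) by (intro power_increasing) auto
    then have "gadget.B r \<le> ?w j" using j by (simp add: weight_def bpow_def gadget.B_eq)
    also have "\<dots> \<le> (\<Sum>j\<in>?S. ?w j)" using j(1) by (intro member_le_sum) auto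
    finally show ?thesis .
  next
    case False
    have "utility (lvl Lv) i j * 2 ^ ?M \<le> real (?w j) * 2 ^ s + 2 ^ s" if j: "j \<in> ?S" for j
    proof -
      consider "lvl Lv i j = 0" | "lvl Lv i j \<noteq> 0" "lvl Lv i j + ?M < s" | "lvl Lv i j \<noteq> 0" "s \<le> lvl Lv i j + ?M" "lvl Lv i j < s"
        using False j by fastforce
      then show ?thesis
      proof cases
        case 2
        then have "(2::real) ^ (lvl Lv i j + ?M) \<le> 2 ^ s" by (intro power_increasing) auto
        then show ?thesis using 2 by (simp add: utility_def weight_def power_add)
      next
        case 3
        have "(2::nat) ^ (lvl Lv i j + ?M - s) \<le> 2 ^ ?M" using 3 by (intro power_increasing) auto
        then have "?w j = 2 ^ (lvl Lv i j + ?M - s)" using 3 by (simp add: weight_def bpow_def gadget.B_eq)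
        then have "real (?w j) * 2 ^ s = 2 ^ (lvl Lv i j + ?M)" using 3 by (simp add: power_add[symmetric])
        then show ?thesis using 3 by (simp add: utility_def power_add)
      qed (simp add: utility_def)
    qed
    then have "(\<Sum>j\<in>?S. utility (lvl Lv) i j * 2 ^ ?M) \<le> (\<Sum>j\<in>?S. real (?w j) * 2 ^ s + 2 ^ s)" by (rule sum_mono)
    also have "\<dots> = (\<Sum>j\<in>?S. real (?w j)) * 2 ^ s + real (card ?S) * 2 ^ s"
      by (simp add: sum.distrib sum_distrib_right)
    also have "real (card ?S) \<le> 2 ^ ?M"
    proof (rule real_le_power2)
      have "card ?S \<le> card {..<r}" by (intro card_mono) auto
      then show "card ?S \<le> 2 ^ ?M" using gadget.r_less[of r] by simp
    qed
    finally have "(\<Sum>j\<in>?S. utility (lvl Lv) i j) * 2 ^ ?M \<le> (\<Sum>j\<in>?S. real (?w j)) * 2 ^ s + 2 ^ ?M * 2 ^ s"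
      by (simp add: sum_distrib_right)
    moreover have "2 ^ Suc s * 2 ^ ?M \<le> (\<Sum>j\<in>?S. utility (lvl Lv) i j) * 2 ^ ?M" using val[OF i] by simp
    moreover have "(2::real) ^ Suc s * 2 ^ ?M = 2 ^ ?M * 2 ^ s + 2 ^ ?M * 2 ^ s" by simp
    ultimately have "2 ^ ?M * 2 ^ s \<le> (\<Sum>j\<in>?S. real (?w j)) * 2 ^ s" by linarith
    then have "real (2 ^ ?M) \<le> real (\<Sum>j\<in>?S. ?w j)" by simp
    then have "2 ^ ?M \<le> (\<Sum>j\<in>?S. ?w j)" unfolding of_nat_le_iff .
    then show ?thesis by (simp add: gadget.B_eq)
  qed
qed

lemma hd_or_cases: "hd_or d xs = d \<or> hd_or d xs \<in> set xs"
  by (cases xs) (auto simp: hd_or_def)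

lemma hd_or_concat_rev:
  assumes "f k \<noteq> []" "k < n"
  shows "\<exists>k'\<ge>k. hd_or d (concat (map f (rev [0..<n]))) \<in> set (f k')"
  using assms
proof (induction n)
  case (Suc n)
  show ?case
  proof (cases "f n = []")
    case True
    then have "k < n" using Suc.prems by (metis less_antisym)
    then show ?thesis using Suc.IH Suc.prems(1) True by simp
  next
    case False
    then have "hd_or d (concat (map f (rev [0..<Suc n]))) = hd (f n)" by (auto simp: hd_or_def neq_Nil_conv)
    then show ?thesis using False Suc.prems(2) by (intro exI[of _ n]) simp
  qed
qed simp

lemma lvl_le: "lvl Lv i j \<le> sum_list (map sum_list Lv)"
proof (cases "i < length Lv \<and> j < length (Lv ! i)")
  case True
  then have "lvl Lv i j = Lv ! i ! j" by (simp add: lvl_def nth_or_def)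
  also have "\<dots> \<le> sum_list (Lv ! i)" using True by (intro member_le_sum_list) auto
  also have "\<dots> \<le> sum_list (map sum_list Lv)" using True by (intro member_le_sum_list) auto
  finally show ?thesis .
qed (auto simp: lvl_def nth_or_def)

lemma sum_utility_less:
  "(\<Sum>j | j < r \<and> P j. utility (lvl Lv) i j) < 2 ^ (scales Lv r - 1) \<or> r = 0"
proof (cases "r = 0")
  case False
  let ?Z = "sum_list (map sum_list Lv)"
  have "utility (lvl Lv) i j \<le> 2 ^ ?Z" for j using lvl_le[of Lv i j] by (simp add: utility_def)
  then have "(\<Sum>j | j < r \<and> P j. utility (lvl Lv) i j) \<le> real (card {j. j < r \<and> P j}) * 2 ^ ?Z"
    by (intro sum_bounded_above) auto
  also have "\<dots> \<le> real r * 2 ^ ?Z"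
  proof (intro mult_right_mono)
    have "card {j. j < r \<and> P j} \<le> card {..<r}" by (intro card_mono) auto
    then show "real (card {j. j < r \<and> P j}) \<le> real r" by simp
  qed simp
  also have "\<dots> < 2 ^ gadget.M r * 2 ^ ?Z"
  proof (intro mult_strict_right_mono)
    show "real r < 2 ^ gadget.M r" using gadget.r_less[of r] by (metis of_nat_less_iff of_nat_numeral of_nat_power)
  qed simp
  finally show ?thesis by (simp add: scales_def power_add)
qed simp

lemma best_owner_valid:
  assumes "0 < length Lv"
  shows "length (best_owner F Lv r) = r" "\<And>j. j < r \<Longrightarrow> best_owner F Lv r ! j < length Lv"
proof -
  have 1: "length own = r \<and> (\<forall>j<r. own ! j < length Lv)" if "own \<in> set (candidates F Lv r)" for own
    using that assms gadget.owner_list_less[of "length Lv" _ r] by (auto simp: candidates_def gadget.length_owner_list)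
  let ?l = "concat (map (\<lambda>s. filter (passes Lv r s) (candidates F Lv r)) (rev [0..<scales Lv r]))"
  have "best_owner F Lv r = map (\<lambda>_. 0) [0..<r] \<or> best_owner F Lv r \<in> set ?l"
    unfolding best_owner_def by (rule hd_or_cases)
  then have "best_owner F Lv r = map (\<lambda>_. 0) [0..<r] \<or> best_owner F Lv r \<in> set (candidates F Lv r)" by auto
  then have "length (best_owner F Lv r) = r \<and> (\<forall>j<r. best_owner F Lv r ! j < length Lv)"
    using 1 assms by auto
  then show "length (best_owner F Lv r) = r" "\<And>j. j < r \<Longrightarrow> best_owner F Lv r ! j < length Lv" by auto
qed

text \<open>The constant is \<open>64 = 2 * 8 * 4\<close>: rounding the target to
  \<open>2 ^ s\<close> costs 2, \<open>2 ^ g \<le> 8 * G\<close> costs 8, and the threshold that the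
  good candidate is certain to pass costs 4.\<close>

lemma best_owner_utility:
  fixes c z :: real
  assumes F: "\<And>q. matching_solution c (hg_of q) (F q)" and c: "c \<ge> 1" and m: "0 < length Lv" and r: "0 < r"
    and S: "\<And>i. i < length Lv \<Longrightarrow> S i \<subseteq> {..<r}" "disjoint_family_on S {..<length Lv}"
    and z: "0 < z" "\<And>i. i < length Lv \<Longrightarrow> z \<le> (\<Sum>j\<in>S i. utility (lvl Lv) i j)"
    and i: "i < length Lv"
  shows "z / (64 * (real (log_star (length Lv + r)) + 2) * c\<^sup>2) \<le>
    (\<Sum>j | j < r \<and> best_owner F Lv r ! j = i. utility (lvl Lv) i j)"
proof -
  let ?m = "length Lv" and ?M = "gadget.M r" and ?u = "utility (lvl Lv)"
  define G where "G = log_star (?m + r) + 2"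
  \<comment> \<open>The minimum actually achieved is at least 2, whereas \<open>z\<close> itself may
    be too small to bracket with a natural exponent.\<close>
  define z' where "z' = Min ((\<lambda>i. \<Sum>j\<in>S i. ?u i j) ` {..<?m})"
  have fin: "finite ((\<lambda>i. \<Sum>j\<in>S i. ?u i j) ` {..<?m})" "(\<lambda>i. \<Sum>j\<in>S i. ?u i j) ` {..<?m} \<noteq> {}" using m by auto
  have z': "z \<le> z'" "\<And>i. i < ?m \<Longrightarrow> z' \<le> (\<Sum>j\<in>S i. ?u i j)" "2 \<le> z'"
  proof -
    show "z \<le> z'" unfolding z'_def using z(2) fin by auto
    show "z' \<le> (\<Sum>j\<in>S i. ?u i j)" if "i < ?m" for i unfolding z'_def using fin(1) that by simp
    have "2 \<le> (\<Sum>j\<in>S i. ?u i j)" if "i < ?m" for i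
      using sum_utility_ge_2[OF less_le_trans[OF z(1) z(2)[OF that]]] .
    then show "2 \<le> z'" unfolding z'_def using fin by auto
  qed
  obtain s where s: "2 ^ s \<le> z'" "z' < 2 ^ Suc s" using power_bracket[of z'] z'(3) by auto
  \<comment> \<open>Bracketing \<open>8 * G\<close> gives both \<open>4 * G < 2 ^ g\<close> for the
    window argument and the upper bound for the loss.\<close>
  obtain g where g': "2 ^ g \<le> real (8 * G)" "real (8 * G) < 2 ^ Suc g" using power_bracket[of "real (8 * G)"] by (auto simp: G_def)
  have "real (2 ^ g) \<le> real (8 * G)" "real (4 * G) < real (2 ^ g)" using g' by simp_all
  then have g: "2 ^ g \<le> 8 * G" "4 * G < 2 ^ g" unfolding of_nat_le_iff of_nat_less_iff .
  have "?M \<le> r"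
    using length_bin_le_iff[of r r] less_exp[of r] unfolding gadget.M_def by (meson leD leI)
  also have "r < tow G"
    using le_tow_log_star[of "?m + r"] m unfolding G_def add_2_eq_Suc' tow.simps(2)[of "Suc _"] by linarith
  finally have G: "?M < g + tow G" by simp
  have s_less: "s < scales Lv r"
  proof -
    have S0: "S i \<subseteq> {..<r}" using S(1)[OF i] .
    then have eq: "{j. j < r \<and> j \<in> S i} = S i" by auto
    have "2 ^ s \<le> (\<Sum>j\<in>S i. ?u i j)" using s(1) z'(2)[OF i] by simp
    also have "\<dots> < 2 ^ (scales Lv r - 1)" using sum_utility_less[of Lv i r "\<lambda>j. j \<in> S i"] r unfolding eq by simp
    finally have "s < scales Lv r - 1" by simp
    then show ?thesis by simp
  qed
  have g_less: "g < 8 * (?m + r + 3)"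
  proof -
    have "g < 2 ^ g" by (rule less_exp)
    also have "\<dots> \<le> 8 * G" by (rule g)
    also have "\<dots> < 8 * (?m + r + 3)" using log_star_le[of "?m + r"] by (simp add: G_def)
    finally show ?thesis .
  qed
  define own where "own = owner_list ?m r (F (Lv, (r, (s, g))))"
  have own: "own \<in> set (candidates F Lv r)" 
    using s_less g_less by (auto simp: candidates_def own_def intro!: bexI[of _ s] imageI)
  have len: "length own = r" by (simp add: own_def gadget.length_owner_list)
  have hg: "hg_of (Lv, (r, (s, g))) = gadget.hg ?m r (lvl Lv) s g" by (simp add: hg_of_def)
  have "\<exists>C A. relaxed_perfect_matching (hg_players (gadget.hg ?m r (lvl Lv) s g)) (hg_resources (gadget.hg ?m r (lvl Lv) s g))
      (hg_edges (gadget.hg ?m r (lvl Lv) s g)) 1 C A"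
    by (rule gadget.allocation_matching[OF S _ g(2) G]) (use s z' in \<open>auto intro: order_trans\<close>)
  then have val: "2 ^ s / (2 ^ g * c\<^sup>2) \<le> (\<Sum>j | j < r \<and> own ! j = i. ?u i j)" if "i < ?m" for i
    unfolding own_def using gadget.owner_list_utility[OF F[of "(Lv, (r, (s, g)))", unfolded hg] _ that] by blast
  define x where "x = Min ((\<lambda>i. \<Sum>j | j < r \<and> own ! j = i. ?u i j) ` {..<?m})"
  let ?X = "(\<lambda>i. \<Sum>j | j < r \<and> own ! j = i. ?u i j) ` {..<?m}"
  have finX: "finite ?X" "?X \<noteq> {}" using m by auto
  have q: "0 < 2 ^ s / (2 ^ g * c\<^sup>2)" using c by simp
  have x: "2 ^ s / (2 ^ g * c\<^sup>2) \<le> x" "\<And>i. i < ?m \<Longrightarrow> x \<le> (\<Sum>j | j < r \<and> own ! j = i. ?u i j)" "2 \<le> x"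
  proof -
    show "2 ^ s / (2 ^ g * c\<^sup>2) \<le> x" unfolding x_def using val finX by auto
    show "x \<le> (\<Sum>j | j < r \<and> own ! j = i. ?u i j)" if "i < ?m" for i unfolding x_def using finX(1) that by simp
    have "2 \<le> (\<Sum>j | j < r \<and> own ! j = i. ?u i j)" if "i < ?m" for i
      using sum_utility_ge_2[OF less_le_trans[OF q val[OF that]]] .
    then show "2 \<le> x" unfolding x_def using finX by auto
  qed
  obtain k where k: "2 ^ k \<le> x" "x < 2 ^ Suc k" using power_bracket[of x] x(3) by auto
  \<comment> \<open>The test can lose a factor of 2, so acceptance is only guaranteed one exponent
    below \<open>k\<close>.\<close>
  have "k \<noteq> 0" using k(2) x(3) by (intro notI) simp
  then obtain t where t: "k = Suc t" using not0_implies_Suc by blast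
  have "passes Lv r t own"
    by (rule utility_passes[OF _ len]) (use k(1) x(2) t in \<open>auto intro: order_trans\<close>)
  then have ne: "filter (passes Lv r t) (candidates F Lv r) \<noteq> []" using own by (auto simp: filter_empty_conv)
  have "t < scales Lv r"
  proof -
    have "2 ^ k \<le> (\<Sum>j | j < r \<and> own ! j = i. ?u i j)" using k(1) x(2)[OF i] by simp
    also have "\<dots> < 2 ^ (scales Lv r - 1)" using sum_utility_less[of Lv i r "\<lambda>j. own ! j = i"] r by simp
    finally have "k < scales Lv r - 1" by simp
    then show ?thesis using t by simp
  qed
  then obtain t' where t': "t' \<ge> t" "best_owner F Lv r \<in> set (filter (passes Lv r t') (candidates F Lv r))"
    using hd_or_concat_rev[where f = "\<lambda>s. filter (passes Lv r s) (candidates F Lv r)" and k = t and n = "scales Lv r", OF ne]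
    unfolding best_owner_def by blast
  have "2 ^ t' \<le> (\<Sum>j | j < r \<and> best_owner F Lv r ! j = i. ?u i j)"
    by (rule passes_utility[OF _ best_owner_valid(1)[OF m] i]) (use t' in simp)
  moreover have "(2::real) ^ t \<le> 2 ^ t'" using t'(1) by (intro power_increasing) auto
  moreover have "x \<le> 4 * 2 ^ t" using k(2) t by simp
  moreover have "z / (64 * (real (log_star (?m + r)) + 2) * c\<^sup>2) \<le> x / 4"
  proof -
    have "z \<le> 2 * 2 ^ s" using s(2) z'(1) by simp
    moreover have "2 ^ g \<le> 8 * real G" using g'(1) by simp
    then have "2 ^ g * c\<^sup>2 \<le> 8 * real G * c\<^sup>2" using c by (intro mult_right_mono) auto
    ultimately have "z / (64 * real G * c\<^sup>2) \<le> (2 * 2 ^ s) / (8 * (2 ^ g * c\<^sup>2))"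
      using c by (intro frac_le) auto
    also have "\<dots> = (2 ^ s / (2 ^ g * c\<^sup>2)) / 4" by simp
    also have "\<dots> \<le> x / 4" using x(1) by simp
    finally show ?thesis by (simp add: G_def algebra_simps)
  qed
  ultimately show ?thesis by linarith
qed

section \<open>Rounding the rational input\<close>

definition rat_bits :: "rat \<Rightarrow> bool list \<times> bool list" where
  "rat_bits x = (bin (nat (fst (quotient_of x))), bin (nat (snd (quotient_of x))))"

lemma encode_rat_bits: "encode (rat_bits x) = enc_rat x"
  by (cases "quotient_of x") (simp add: rat_bits_def enc_rat_def encode_bin)

lemma encode_rat_matrix: "encode (map (map rat_bits) V) = enc_list (enc_list enc_rat) V"
proof -
  have "encode (map rat_bits row) = enc_list enc_rat row" for row
    by (induction row) (simp_all add: encode_rat_bits)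
  then show ?thesis by (induction V) simp_all
qed

lemma bin_bounds:
  assumes "0 < n"
  shows "2 ^ length (bin n) \<le> 2 * real n" "real n < 2 ^ length (bin n)"
proof -
  have "length (bin n) \<noteq> 0" using length_bin_le_iff[of 0 n] assms by simp
  then obtain k where k: "length (bin n) = Suc k" using not0_implies_Suc by blast
  then have "2 ^ k \<le> n" using length_bin_le_iff[of k n] by simp
  then have "real (2 ^ k) \<le> real n" by (rule of_nat_mono)
  then show "2 ^ length (bin n) \<le> 2 * real n" by (simp add: k)
  have "n < 2 ^ length (bin n)" using length_bin_le_iff[of "length (bin n)" n] by simp
  then have "real n < real (2 ^ length (bin n))" by (simp only: of_nat_less_iff)
  then show "real n < 2 ^ length (bin n)" by simp
qed

text \<open>Numerator and denominator are each rounded up by a factor of at most 2. The two errors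
  act in opposite directions, so the quotient is off by at most 2 either way.\<close>

lemma santa_val_utility:
  assumes V: "santa_instance V" and i: "i < length V" and j: "j < length (hd V)"
  defines "X \<equiv> map (map rat_bits) V"
  shows "santa_val V i j * 2 ^ denom_bits X \<le> 2 * utility (lvl (levels X)) i j"
    and "utility (lvl (levels X)) i j \<le> 2 * (santa_val V i j * 2 ^ denom_bits X)"
proof -
  let ?Z = "denom_bits X" and ?x = "V ! i ! j"
  have "V ! i \<in> set V" using i by simp
  then have len: "length (V ! i) = length (hd V)" and row: "\<forall>x\<in>set (V ! i). 0 \<le> x"
    using V unfolding santa_instance_def by blast+
  have nonneg: "0 \<le> ?x" using row nth_mem[of j "V ! i"] j len by simp
  obtain p q where pq: "quotient_of ?x = (p, q)" by fastforce
  then have q: "0 < q" and x: "?x = of_int p / of_int q" by (simp_all add: quotient_of_denom_pos quotient_of_div)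
  have p: "0 \<le> p" using nonneg q unfolding x by (simp add: zero_le_divide_iff)
  let ?p = "nat p" and ?q = "nat q"
  have val: "santa_val V i j = real ?p / real ?q"
    using p q by (simp add: santa_val_def x of_rat_divide)
  have entry: "X ! i ! j = (bin ?p, bin ?q)" using i j len by (simp add: X_def rat_bits_def pq)
  have jX: "j < length (X ! i)" "i < length X" using i j len by (auto simp: X_def)
  then have lv: "lvl (levels X) i j = (if bin ?p = [] then 0 else length (bin ?p) + ?Z - length (bin ?q))"
    by (simp add: lvl_def levels_def nth_or_def entry)
  have "length (bin ?q) \<le> sum_list (map (\<lambda>e. length (snd e)) (X ! i))"
  proof (rule member_le_sum_list)
    show "length (bin ?q) \<in> set (map (\<lambda>e. length (snd e)) (X ! i))"
      using nth_mem[OF jX(1)] unfolding entry by force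
  qed simp
  also have "\<dots> \<le> ?Z" unfolding denom_bits_def using jX by (intro member_le_sum_list) auto
  \<comment> \<open>The common scaling exceeds every denominator length. Hence the subtraction in
    the level is not truncated, and positive entries keep a positive level.\<close>
  finally have qZ: "length (bin ?q) \<le> ?Z" .
  have "santa_val V i j * 2 ^ ?Z \<le> 2 * utility (lvl (levels X)) i j \<and>
      utility (lvl (levels X)) i j \<le> 2 * (santa_val V i j * 2 ^ ?Z)"
  proof (cases "?p = 0")
    case True
    then show ?thesis unfolding utility_def lv val by (simp add: bin.simps)
  next
    case False
    then have ne: "bin ?p \<noteq> []" by (subst bin.simps) simp
    let ?lp = "length (bin ?p)" and ?lq = "length (bin ?q)"
    have u: "utility (lvl (levels X)) i j = 2 ^ (?lp + ?Z - ?lq)"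
      using ne qZ by (cases "bin ?p") (auto simp: utility_def lv)
    have pow: "(2::real) ^ (?lp + ?Z - ?lq) * 2 ^ ?lq = 2 ^ ?lp * 2 ^ ?Z"
      unfolding power_add[symmetric] using qZ by simp
    have P: "2 ^ ?lp \<le> 2 * real ?p" "real ?p < 2 ^ ?lp" using bin_bounds[of ?p] False by auto
    have Q: "2 ^ ?lq \<le> 2 * real ?q" "real ?q < 2 ^ ?lq" "0 < real ?q" using bin_bounds[of ?q] q by auto
    have "real ?p * 2 ^ ?Z \<le> 2 ^ ?lp * 2 ^ ?Z" using P by simp
    also have "\<dots> \<le> 2 ^ (?lp + ?Z - ?lq) * (2 * real ?q)" unfolding pow[symmetric] using Q by simp
    finally have 1: "real ?p * 2 ^ ?Z \<le> 2 ^ (?lp + ?Z - ?lq) * (2 * real ?q)" .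
    have "2 ^ (?lp + ?Z - ?lq) * real ?q \<le> 2 ^ (?lp + ?Z - ?lq) * 2 ^ ?lq" using Q by simp
    also have "\<dots> \<le> 2 * real ?p * 2 ^ ?Z" unfolding pow using P by simp
    finally have 2: "2 ^ (?lp + ?Z - ?lq) * real ?q \<le> 2 * real ?p * 2 ^ ?Z" .
    show ?thesis unfolding u val using 1 2 Q(3) by (simp add: field_simps)
  qed
  then show "santa_val V i j * 2 ^ ?Z \<le> 2 * utility (lvl (levels X)) i j"
    "utility (lvl (levels X)) i j \<le> 2 * (santa_val V i j * 2 ^ ?Z)" by auto
qed

text \<open>Rounding the values costs 2 when passing from the optimum to levels and 2 when passing
  back, so 64 becomes 256. Replacing \<open>log_star n + 2\<close> by
  \<open>3 * (log_star n)^2\<close> gives 768.\<close>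

lemma santa_bundles_solution:
  assumes F: "\<And>q. matching_solution c (hg_of q) (F q)" and c: "c \<ge> 1" and V: "santa_instance V"
  shows "santa_solution (\<lambda>n. 768 * (c * real (log_star n))\<^sup>2) V (encode (santa_bundles F (map (map rat_bits) V)))"
proof -
  define X where "X = map (map rat_bits) V"
  let ?m = "length V" and ?r = "length (hd V)"
  let ?Z = "denom_bits X" and ?u = "utility (lvl (levels X))"
  let ?n = "?m + ?r" and ?v = "santa_val V"
  define own where "own = best_owner F (levels X) ?r"
  define T where "T i = {j. j < ?r \<and> own ! j = i}" for i
  define L where "L = map (\<lambda>i. filter (\<lambda>j. nth_or 0 own j = i) [0..<?r]) [0..<?m]"
  have m: "0 < ?m" using V by (simp add: santa_instance_def)
  have lens: "length (levels X) = ?m" "length X = ?m" by (simp_all add: levels_def X_def)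
  have hdX: "length (hd_or [] X) = ?r" using m by (cases V) (auto simp: X_def hd_or_def)
  have own: "length own = ?r" "\<And>j. j < ?r \<Longrightarrow> own ! j < ?m"
    using best_owner_valid[where Lv = "levels X" and F = F and r = ?r] m unfolding own_def lens by auto
  have out: "encode (santa_bundles F X) = enc_list (enc_list enc_nat) L"
  proof -
    have "santa_bundles F X = map (map bin) L"
      by (simp add: santa_bundles_def L_def lens hdX own_def)
    then show ?thesis by (simp add: encode_map_map_bin)
  qed
  have LT: "set (L ! i) = T i" if "i < ?m" for i using that own(1) by (auto simp: L_def T_def nth_or_def)
  define S where "S = restrict (\<lambda>i. set (L ! i)) (santa_players V)"
  have S_T: "S i = T i" if "i < ?m" for i using that LT by (simp add: S_def santa_players_def)
  have alloc: "S \<in> allocations (santa_players V) (santa_resources V)"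
  proof -
    have "S \<in> santa_players V \<rightarrow>\<^sub>E Pow (santa_resources V)"
      using LT by (auto simp: S_def santa_players_def santa_resources_def T_def)
    moreover have "disjoint_family_on S (santa_players V)"
      unfolding disjoint_family_on_def using S_T by (auto simp: santa_players_def T_def)
    moreover have "(\<Union>i\<in>santa_players V. S i) = santa_resources V"
      using S_T own(2) by (auto simp: santa_players_def santa_resources_def T_def)
    ultimately show ?thesis by (simp add: allocations_def)
  qed
  have finA: "finite (allocations (santa_players V) (santa_resources V))"
    by (rule finite_subset[OF _ finite_PiE[of "santa_players V" "\<lambda>_. Pow (santa_resources V)"]])
      (auto simp: allocations_def santa_players_def santa_resources_def)
  define OPT where "OPT = santa_opt (santa_players V) (santa_resources V) ?v"
  have "OPT \<in> santa_value (santa_players V) ?v ` allocations (santa_players V) (santa_resources V)"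
    unfolding OPT_def santa_opt_def using finA alloc by (intro Max_in) auto
  then obtain W where W: "W \<in> allocations (santa_players V) (santa_resources V)"
    and OPT: "OPT = santa_value (santa_players V) ?v W" by blast
  have OPT_le: "OPT \<le> (\<Sum>j\<in>W i. ?v i j)" if "i < ?m" for i
    unfolding OPT santa_value_def using that by (intro Min_le) (auto simp: santa_players_def)
  have O_sub: "W i \<subseteq> {..<?r}" if "i < ?m" for i
    using W that unfolding allocations_def santa_players_def santa_resources_def by blast
  have vpos: "0 \<le> ?v i j" if "i < ?m" "j < ?r" for i j
  proof -
    have "0 \<le> 2 * (?v i j * 2 ^ ?Z)"
      using santa_val_utility(2)[OF V that] utility_nonneg[of "lvl (levels X)" i j] unfolding X_def by (rule order_trans[rotated])
    moreover have "?v i j * 2 ^ ?Z < 0" if "?v i j < 0" using that by (intro mult_neg_pos) auto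
    ultimately show ?thesis by linarith
  qed
  let ?\<beta> = "768 * (c * real (log_star ?n))\<^sup>2"
  have goal: "OPT / ?\<beta> \<le> (\<Sum>j\<in>T i. ?v i j)" if i: "i < ?m" for i
  \<comment> \<open>A nonpositive optimum includes the instance of size 1, where
    \<open>log_star\<close> is 0 and so is the ratio; a positive one forces a resource to exist and
    hence size at least 2.\<close>
  proof (cases "0 < OPT")
    case False
    have "0 \<le> (\<Sum>j\<in>T i. ?v i j)" using vpos[OF i] by (intro sum_nonneg) (auto simp: T_def)
    moreover have "OPT / ?\<beta> \<le> 0" using False by (simp add: divide_nonpos_nonneg)
    ultimately show ?thesis by linarith
  next
    case True
    have r: "0 < ?r"
    proof (rule ccontr)
      assume "\<not> 0 < ?r"
      then have "W i = {}" using O_sub[OF i] by auto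
      then show False using OPT_le[OF i] True by simp
    qed
    \<comment> \<open>The optimum in scaled units, halved for the rounding of values to
      levels.\<close>
    define z where "z = OPT * 2 ^ ?Z / 2"
    have z: "z \<le> (\<Sum>j\<in>W i. ?u i j)" if i: "i < ?m" for i
    proof -
      have "OPT * 2 ^ ?Z \<le> (\<Sum>j\<in>W i. ?v i j) * 2 ^ ?Z" using OPT_le[OF i] by simp
      also have "\<dots> = (\<Sum>j\<in>W i. ?v i j * 2 ^ ?Z)" by (rule sum_distrib_right)
      also have "\<dots> \<le> (\<Sum>j\<in>W i. 2 * ?u i j)"
        using santa_val_utility(1)[OF V i] O_sub[OF i] unfolding X_def by (intro sum_mono) auto
      also have "\<dots> = 2 * (\<Sum>j\<in>W i. ?u i j)" by (simp add: sum_distrib_left)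
      finally show ?thesis by (simp add: z_def)
    qed
    have "disjoint_family_on W {..<?m}" using W by (simp add: allocations_def santa_players_def)
    then have "z / (64 * (real (log_star ?n) + 2) * c\<^sup>2) \<le> (\<Sum>j\<in>T i. ?u i j)"
      unfolding T_def own_def
      by (intro best_owner_utility[where S = W and Lv = "levels X", unfolded lens, OF F c m r])
        (use O_sub z i True in \<open>auto simp: z_def\<close>)
    also have "\<dots> \<le> (\<Sum>j\<in>T i. 2 * (?v i j * 2 ^ ?Z))"
      using santa_val_utility(2)[OF V i] unfolding X_def by (intro sum_mono) (auto simp: T_def)
    also have "\<dots> = 2 * 2 ^ ?Z * (\<Sum>j\<in>T i. ?v i j)"
      unfolding sum_distrib_left by (rule sum.cong) simp_all
    finally have "OPT * 2 ^ ?Z / 2 / (64 * (real (log_star ?n) + 2) * c\<^sup>2) \<le> 2 * 2 ^ ?Z * (\<Sum>j\<in>T i. ?v i j)"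
      by (simp add: z_def)
    moreover have "a * p / 2 / (64 * d * e) = 2 * p * (a / (256 * d * e))" for a p d e :: real by simp
    ultimately have "2 * 2 ^ ?Z * (OPT / (256 * (real (log_star ?n) + 2) * c\<^sup>2)) \<le> 2 * 2 ^ ?Z * (\<Sum>j\<in>T i. ?v i j)"
      by (simp only:)
    then have 1: "OPT / (256 * (real (log_star ?n) + 2) * c\<^sup>2) \<le> (\<Sum>j\<in>T i. ?v i j)"
      by (rule mult_left_le_imp_le) simp
    have "1 \<le> log_star ?n" using m r by (intro log_star_pos) linarith
    then have l: "1 \<le> real (log_star ?n)" by simp
    \<comment> \<open>Uses \<open>log_star n \<ge> 1\<close>. Here the linear dependence is weakened
      to the square in the claim.\<close>
    then have "real (log_star ?n) + 2 \<le> 3 * (real (log_star ?n))\<^sup>2"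
      by (smt (verit) mult_left_mono power2_eq_square mult_cancel_left1)
    then have "256 * (real (log_star ?n) + 2) * c\<^sup>2 \<le> 256 * (3 * (real (log_star ?n))\<^sup>2) * c\<^sup>2"
      by (intro mult_right_mono mult_left_mono) auto
    also have "\<dots> = ?\<beta>" by (simp add: power_mult_distrib)
    finally have "OPT / ?\<beta> \<le> OPT / (256 * (real (log_star ?n) + 2) * c\<^sup>2)"
      using True l c by (intro divide_left_mono mult_pos_pos) auto
    then show ?thesis using 1 by linarith
  qed
  have "OPT / ?\<beta> \<le> santa_value (santa_players V) ?v S"
    unfolding santa_value_def using m goal S_T by (subst Min_ge_iff) (auto simp: santa_players_def)
  moreover have "santa_size V = ?n" by (simp add: santa_size_def santa_players_def santa_resources_def)
  ultimately show ?thesis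
    unfolding santa_solution_def using out alloc
    by (intro exI[of _ L] exI[of _ S]) (auto simp: X_def OPT_def S_def L_def)
qed

theorem theorem4:
  "\<exists>K :: real. K > 0 \<and> (\<forall>c :: real. c \<ge> 1 \<longrightarrow>
     (\<exists>p. poly_time_matching_approx c p) \<longrightarrow>
     (\<exists>q. poly_time_santa_approx (\<lambda>n. K * (c * real (log_star n))\<^sup>2) q))"
proof (intro exI[of _ 768] conjI allI impI)
  fix c :: real assume c: "c \<ge> 1" and "\<exists>p. poly_time_matching_approx c p"
  then obtain F where F: "pt F" "\<And>q. matching_solution c (hg_of q) (F q)" using matching_oracle by blast
  show "\<exists>q. poly_time_santa_approx (\<lambda>n. 768 * (c * real (log_star n))\<^sup>2) q"
    unfolding poly_time_santa_approx_def
    by (rule poly_time_solves_pt[OF pt_santa_bundles[OF F(1)] encode_rat_matrix])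
      (rule santa_bundles_solution[OF F(2) c])
qed simp

end
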